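(* Let $\alpha>-1/2$ and $\alpha\ge\beta>-1$, and let $p=\frac{4(\alpha+1)}{2\alpha+1}$ or $p=\frac{4(\alpha+1)}{2\alpha+3}$. Then there is no constant $C$ such that $\Vert S_nf\Vert_{L^{p,\infty}(d\nu)}\le C\Vert f\Vert_{L^p(d\nu)}$ for every $n\ge0$ and every $f\in L^p(d\nu)$.
   Context: $d\nu=(1-x)^\alpha(1+x)^\beta dx+\sum_{i=1}^kM_i\delta_{a_i}$ on $[-1,1]$, with $a_1,\dots,a_k\in[-1,1]$ distinct and $M_i>0$. $(P_n)$ are the orthonormal polynomials for $\nu$ (positive leading coefficients), $L_n(x,y)=\sum_{j=0}^nP_j(x)P_j(y)$, $S_nf(x)=\int L_n(x,y)f(y)\,d\nu(y)$. $L^{p,\infty}(d\nu)$ is the weak $L^p$ space with quasinorm $\sup_{t>0}t^{1/p}f^*(t)$, $f^*$ the nonincreasing rearrangement of $f$ with respect to $\nu$. *)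

theory Defs
  imports "HOL-Analysis.Analysis" "HOL-Computational_Algebra.Polynomial"
begin

definition jacobi_weight :: "real \<Rightarrow> real \<Rightarrow> real \<Rightarrow> real" where
  "jacobi_weight \<alpha> \<beta> x =
     indicator {-1..1} x * (1 - x) powr \<alpha> * (1 + x) powr \<beta>"

definition jacobi_mass_measure ::
  "real \<Rightarrow> real \<Rightarrow> nat \<Rightarrow> (nat \<Rightarrow> real) \<Rightarrow> (nat \<Rightarrow> real) \<Rightarrow> real measure" where
  "jacobi_mass_measure \<alpha> \<beta> k a M =
     measure_of UNIV (sets borel)
       (\<lambda>A. emeasure (density lborel (\<lambda>x. ennreal (jacobi_weight \<alpha> \<beta> x))) A
            + (\<Sum>i<k. ennreal (M i) * indicator A (a i)))"

definition orthonormal_polys :: "real measure \<Rightarrow> (nat \<Rightarrow> real poly) \<Rightarrow> bool" where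
  "orthonormal_polys \<nu> P \<longleftrightarrow>
     (\<forall>n. degree (P n) = n \<and> lead_coeff (P n) > 0 \<and>
       (\<forall>m. integrable \<nu> (\<lambda>x. poly (P m) x * poly (P n) x) \<and>
            (\<integral>x. poly (P m) x * poly (P n) x \<partial>\<nu>) = (if m = n then 1 else 0)))"

definition kernel_L :: "(nat \<Rightarrow> real poly) \<Rightarrow> nat \<Rightarrow> real \<Rightarrow> real \<Rightarrow> real" where
  "kernel_L P n x y = (\<Sum>j\<le>n. poly (P j) x * poly (P j) y)"

definition partial_sum_op ::
  "real measure \<Rightarrow> (nat \<Rightarrow> real poly) \<Rightarrow> nat \<Rightarrow> (real \<Rightarrow> real) \<Rightarrow> real \<Rightarrow> real" where
  "partial_sum_op \<nu> P n f x = (\<integral>y. kernel_L P n x y * f y \<partial>\<nu>)"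

text \<open>L^p membership and norm (norm only meaningful for f in L^p, where the integral is finite).\<close>
definition in_Lp :: "real measure \<Rightarrow> real \<Rightarrow> (real \<Rightarrow> real) \<Rightarrow> bool" where
  "in_Lp \<nu> p f \<longleftrightarrow> f \<in> borel_measurable \<nu> \<and>
     (\<integral>\<^sup>+x. ennreal (\<bar>f x\<bar> powr p) \<partial>\<nu>) < \<infinity>"

definition Lp_norm :: "real measure \<Rightarrow> real \<Rightarrow> (real \<Rightarrow> real) \<Rightarrow> ennreal" where
  "Lp_norm \<nu> p f = ennreal ((enn2real (\<integral>\<^sup>+x. ennreal (\<bar>f x\<bar> powr p) \<partial>\<nu>)) powr (1 / p))"

definition rearrangement :: "real measure \<Rightarrow> (real \<Rightarrow> real) \<Rightarrow> real \<Rightarrow> ennreal" where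
  "rearrangement \<nu> f t =
     (INF s \<in> {s::ennreal. emeasure \<nu> {x \<in> space \<nu>. ennreal \<bar>f x\<bar> > s} \<le> ennreal t}. s)"

definition weak_Lp_norm :: "real measure \<Rightarrow> real \<Rightarrow> (real \<Rightarrow> real) \<Rightarrow> ennreal" where
  "weak_Lp_norm \<nu> p f =
     (SUP t \<in> {0<..}. ennreal (t powr (1 / p)) * rearrangement \<nu> f t)"

end

theory Submission
  imports Defs
begin

text \<open>
  Put \<open>x = cos t\<close>, so that the measure becomes a weight \<open>w\<close> on \<open>(0, pi)\<close> plus point masses, and let
  \<open>u n t = poly (P n) (cos t) * sqrt (w t)\<close>. By Szego's method \<open>u n\<close> is asymptotic in the mean to
  \<open>v n t = sqrt (2 / pi) * cos (n * t + phase t)\<close> with an affine phase: the mean value property of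
  the Szego function \<open>D z = (1 - z) powr A * (1 + z) powr B\<close> expresses the inner product of \<open>u n\<close> and
  \<open>v n\<close> through the leading coefficient of \<open>P n\<close>, which is bounded from below by its extremal property
  applied to monic polynomials built from approximations of \<open>1 / D\<close>. These may be chosen to vanish at
  the mass points, which is why the masses play no role.

  Let \<open>f (cos s) * sqrt (w s) = g s * cos ((n + 1/2) * s + phase s + \<psi>)\<close> with \<open>g\<close> supported
  on \<open>[\<delta>, 1]\<close>. By the Christoffel-Darboux formula, on an interval \<open>X\<close> disjoint from \<open>[\<delta>, 1]\<close> the
  function \<open>S n f (cos t) * sqrt (w t)\<close> is asymptotically an oscillation of amplitude comparable to a
  Cauchy integral of \<open>g\<close>. For the upper exponent take \<open>g = 1\<close>, \<open>X = [\<delta>/4, \<delta>/2]\<close>, for the lower one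
  \<open>g s = 1 / s\<close>, \<open>X = [2, 5/2]\<close>. With \<open>T = ln (1 / \<delta>)\<close>, the weak norm of \<open>S n f\<close> is at least a multiple
  of \<open>T\<close> for large \<open>n\<close>, while the norm of \<open>f\<close> is at most a multiple of \<open>T powr (1 / p)\<close>.
\<close>

section \<open>The measure in the variable \<open>x = cos t\<close>\<close>

text \<open>The gap between T and T^(1/p) rests on an exact cancellation of powers. Near t = 0 the
  weight behaves like t^(2A) with A = \<alpha> + 1/2, and the p-th power integral of f becomes that
  of |g|^p w^(1 - p/2). The two exponents are (2A+1)/A and its conjugate (2A+1)/(A+1); they are the
  values at which this integrand is comparable to 1/s for the chosen g, so that it contributes one
  factor T before the p-th root is taken. The Cauchy integral of g produces a full factor T. In the
  upper case the powers of \<delta> coming from the measure of X and from sqrt(w) on X cancel; in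
  the lower case w is bounded above and below on X. The asymptotics are an L1 statement without
  control at individual points. This is enough because \<delta> is fixed before n grows, so that all
  constants may depend on \<delta>, and because a weak norm is bounded from below by any set of
  definite measure on which the values are large. Keeping X apart from the support of g makes 1 /
  (cos t - cos s) bounded, so that no principal values occur.\<close>

definition arcm :: "real measure" where
  "arcm = restrict_space lborel {0<..<pi}"

definition arc_weight :: "real \<Rightarrow> real \<Rightarrow> real \<Rightarrow> real" where
  "arc_weight a b t = (1 - cos t) powr a * (1 + cos t) powr b"

lemma space_arc [simp]: "space arcm = {0<..<pi}"
  by (simp add: arcm_def space_restrict_space)

lemma borel_measurable_arc [measurable (raw)]:
  "f \<in> borel_measurable borel \<Longrightarrow> f \<in> borel_measurable arcm"
  unfolding arcm_def by (intro measurable_restrict_space1) simp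

interpretation arcm: finite_measure arcm
proof
  show "emeasure arcm (space arcm) \<noteq> \<infinity>"
    unfolding space_arc unfolding arcm_def by (subst emeasure_restrict_space) auto
qed

lemma measure_arc_space: "measure arcm {0<..<pi} = pi"
  unfolding arcm_def by (subst measure_restrict_space) auto

lemma arc_weight_measurable [measurable]: "arc_weight a b \<in> borel_measurable borel"
  unfolding arc_weight_def by measurable

lemma cos_arc: assumes "t \<in> {0<..<pi}" shows "- 1 < cos t" "cos t < 1" "0 < sin t"
proof -
  show "0 < sin t" using assms by (intro sin_gt_zero) auto
  show "- 1 < cos t" using assms cos_monotone_0_pi[of t pi] by auto
  show "cos t < 1" using assms cos_monotone_0_pi[of 0 t] by auto
qed

lemma arc_weight_pos: "t \<in> {0<..<pi} \<Longrightarrow> 0 < arc_weight a b t"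
  using cos_arc[of t] by (simp add: arc_weight_def)

lemma arc_weight_nonneg: "0 \<le> arc_weight a b t"
  by (simp add: arc_weight_def)

lemma nn_integral_arc:
  assumes [measurable]: "f \<in> borel_measurable borel"
  shows "(\<integral>\<^sup>+t. f t \<partial>arcm) = (\<integral>\<^sup>+t. f t * indicator {0<..<pi} t \<partial>lborel)"
  unfolding arcm_def by (subst nn_integral_restrict_space) auto

lemma nn_integral_cos_substitution:
  fixes h :: "real \<Rightarrow> ennreal"
  assumes [measurable]: "h \<in> borel_measurable borel"
  shows "(\<integral>\<^sup>+x. h x * indicator {-1..1} x \<partial>lborel) = (\<integral>\<^sup>+t. h (cos t) * ennreal (sin t) \<partial>arcm)"
proof -
  \<comment> \<open>The substitution rule wants a nondecreasing map, so the line is first reflected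
    and -cos is substituted.\<close>
  have "(\<integral>\<^sup>+x. h x * indicator {-1..1} x \<partial>lborel)
      = (\<integral>\<^sup>+x. h (- x) * indicator {- cos 0..- cos pi} x \<partial>lborel)"
    by (subst nn_integral_real_affine[where c="-1" and t=0])
       (auto intro!: nn_integral_cong simp: indicator_def)
  also have "\<dots> = (\<integral>\<^sup>+t. h (- (- cos t)) * ennreal (sin t) * indicator {0..pi} t \<partial>lborel)"
    by (rule nn_integral_substitution_aux)
       (auto intro!: derivative_eq_intros continuous_intros sin_ge_zero)
  also have "\<dots> = (\<integral>\<^sup>+t. h (cos t) * ennreal (sin t) * indicator {0<..<pi} t \<partial>lborel)"
    by (intro nn_integral_cong) (auto simp: indicator_def)
  also have "\<dots> = (\<integral>\<^sup>+t. h (cos t) * ennreal (sin t) \<partial>arcm)"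
    by (subst nn_integral_arc) auto
  finally show ?thesis .
qed

lemma jacobi_weight_cos:
  assumes "t \<in> {0<..<pi}"
  shows "jacobi_weight \<alpha> \<beta> (cos t) * sin t = arc_weight (\<alpha> + 1/2) (\<beta> + 1/2) t"
proof -
  have c: "0 < 1 - cos t" "0 < 1 + cos t" "0 < sin t" using cos_arc[OF assms] by auto
  have "sin t = sqrt ((1 - cos t) * (1 + cos t))"
    using c(3) by (intro real_sqrt_unique[symmetric]) (auto simp: sin_squared_eq algebra_simps power2_eq_square)
  also have "\<dots> = (1 - cos t) powr (1/2) * (1 + cos t) powr (1/2)"
    using c by (simp add: real_sqrt_mult powr_half_sqrt)
  finally show ?thesis
    using c by (simp add: jacobi_weight_def arc_weight_def powr_add indicator_def)
qed

lemma jacobi_weight_measurable [measurable]: "jacobi_weight \<alpha> \<beta> \<in> borel_measurable borel"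
  unfolding jacobi_weight_def by measurable

lemma sets_jacobi_mass_measure [measurable_cong, simp]:
  "sets (jacobi_mass_measure \<alpha> \<beta> k a M) = sets borel"
  unfolding jacobi_mass_measure_def by (simp add: sets_measure_of_conv sets.sigma_sets_eq[of borel, simplified])

lemma space_jacobi_mass_measure [simp]: "space (jacobi_mass_measure \<alpha> \<beta> k a M) = UNIV"
  unfolding jacobi_mass_measure_def by (simp add: space_measure_of_conv)

text \<open>\<open>measure_of\<close> falls back to the zero measure unless its set function is
  countably additive, so additivity has to be checked before values can be read off.\<close>

lemma emeasure_jacobi_mass_measure:
  assumes "A \<in> sets borel"
  shows "emeasure (jacobi_mass_measure \<alpha> \<beta> k a M) A =
    emeasure (density lborel (\<lambda>x. ennreal (jacobi_weight \<alpha> \<beta> x))) A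
            + (\<Sum>i<k. ennreal (M i) * indicator A (a i))" (is "_ = ?\<mu> A")
proof (rule emeasure_measure_of[OF jacobi_mass_measure_def])
  let ?N = "jacobi_mass_measure \<alpha> \<beta> k a M"
  let ?D = "density lborel (\<lambda>x. ennreal (jacobi_weight \<alpha> \<beta> x))"
  show "sets borel \<subseteq> Pow (UNIV :: real set)" by simp
  show "A \<in> sets ?N" using assms by simp
  show "positive (sets ?N) ?\<mu>" by (simp add: positive_def)
  show "countably_additive (sets ?N) ?\<mu>"
  proof (rule countably_additiveI)
    fix F :: "nat \<Rightarrow> real set"
    assume F: "range F \<subseteq> sets ?N" "disjoint_family F" "\<Union>(range F) \<in> sets ?N"
    have [measurable]: "F i \<in> sets borel" for i using F by auto
    have 1: "(\<Sum>i. emeasure ?D (F i)) = emeasure ?D (\<Union>(range F))"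
      using F by (intro suminf_emeasure) auto
    have 2: "(\<Sum>j. ennreal (M i) * indicator (F j) (a i)) = ennreal (M i) * indicator (\<Union>(range F)) (a i)" for i
      using F(2) by (subst ennreal_suminf_cmult) (simp add: suminf_indicator)
    have "(\<Sum>j. ?\<mu> (F j)) = (\<Sum>j. emeasure ?D (F j)) + (\<Sum>j. \<Sum>i<k. ennreal (M i) * indicator (F j) (a i))"
      by (intro suminf_add[symmetric]) auto
    also have "(\<Sum>j. \<Sum>i<k. ennreal (M i) * indicator (F j) (a i))
        = (\<Sum>i<k. ennreal (M i) * indicator (\<Union>(range F)) (a i))"
      by (subst suminf_sum) (simp_all only: 2 summableI)
    finally show "(\<Sum>j. ?\<mu> (F j)) = ?\<mu> (\<Union>(range F))" by (simp add: 1)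
  qed
qed

text \<open>Induction over nonnegative measurable functions separates the density from the masses;
  the substitution x = cos t then moves the density to \<open>arcm\<close>.\<close>

lemma nn_integral_jacobi_mass_measure:
  fixes h :: "real \<Rightarrow> ennreal"
  assumes h: "h \<in> borel_measurable borel"
  shows "(\<integral>\<^sup>+x. h x \<partial>jacobi_mass_measure \<alpha> \<beta> k a M) =
    (\<integral>\<^sup>+t. h (cos t) * ennreal (arc_weight (\<alpha> + 1/2) (\<beta> + 1/2) t) \<partial>arcm) + (\<Sum>i<k. ennreal (M i) * h (a i))"
proof -
  let ?N = "jacobi_mass_measure \<alpha> \<beta> k a M"
  let ?D = "density lborel (\<lambda>x. ennreal (jacobi_weight \<alpha> \<beta> x))"
  have "(\<integral>\<^sup>+x. h x \<partial>?N) = (\<integral>\<^sup>+x. h x \<partial>?D) + (\<Sum>i<k. ennreal (M i) * h (a i))"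
    using h
  proof (induction h rule: borel_measurable_induct)
    case (cong f g)
    then have "f = g" by auto
    then show ?case using cong by simp
  next
    case (set A)
    then show ?case by (simp add: emeasure_jacobi_mass_measure)
  next
    case (mult u c)
    then show ?case
      by (simp add: nn_integral_cmult distrib_left sum_distrib_left mult_ac)
  next
    case (add u v)
    then show ?case
      by (simp add: nn_integral_add distrib_left sum.distrib add_ac)
  next
    case (seq U)
    note [measurable] = seq(1)
    have inc: "incseq (\<lambda>i. U i x)" for x using seq(3) by (auto simp: incseq_def le_fun_def)
    have S: "(SUP i. U i) x = (SUP i. U i x)" for x by (simp add: image_comp)
    have "(\<integral>\<^sup>+x. (SUP i. U i) x \<partial>?N) = (SUP i. \<integral>\<^sup>+x. U i x \<partial>?N)"
      unfolding S using seq(3) by (intro nn_integral_monotone_convergence_SUP) auto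
    also have "\<dots> = (SUP i. (\<integral>\<^sup>+x. U i x \<partial>?D) + (\<Sum>j<k. ennreal (M j) * U i (a j)))"
      using seq by simp
    also have "\<dots> = (SUP i. \<integral>\<^sup>+x. U i x \<partial>?D) + (SUP i. \<Sum>j<k. ennreal (M j) * U i (a j))"
      using seq(3) by (intro ennreal_SUP_add)
        (auto simp: incseq_def le_fun_def intro!: nn_integral_mono sum_mono mult_left_mono)
    also have "(SUP i. \<integral>\<^sup>+x. U i x \<partial>?D) = (\<integral>\<^sup>+x. (SUP i. U i) x \<partial>?D)"
      unfolding S using seq(3) by (intro nn_integral_monotone_convergence_SUP[symmetric]) auto
    also have "(SUP i. \<Sum>j<k. ennreal (M j) * U i (a j)) = (\<Sum>j<k. SUP i. ennreal (M j) * U i (a j))"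
      using inc by (intro ennreal_SUP_sum) (auto simp: incseq_def intro!: mult_left_mono)
    also have "\<dots> = (\<Sum>j<k. ennreal (M j) * (SUP i. U i) (a j))"
      by (simp add: SUP_mult_left_ennreal S image_comp)
    finally show ?case .
  qed
  also have "(\<integral>\<^sup>+x. h x \<partial>?D) = (\<integral>\<^sup>+x. (h x * ennreal (jacobi_weight \<alpha> \<beta> x)) * indicator {-1..1} x \<partial>lborel)"
    using h by (subst nn_integral_density)
      (auto intro!: nn_integral_cong simp: jacobi_weight_def indicator_def mult_ac)
  also have "\<dots> = (\<integral>\<^sup>+t. (h (cos t) * ennreal (jacobi_weight \<alpha> \<beta> (cos t))) * ennreal (sin t) \<partial>arcm)"
    using h by (intro nn_integral_cos_substitution) auto
  also have "\<dots> = (\<integral>\<^sup>+t. h (cos t) * ennreal (arc_weight (\<alpha> + 1/2) (\<beta> + 1/2) t) \<partial>arcm)"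
  proof (rule nn_integral_cong)
    fix t assume t: "t \<in> space arcm"
    have "0 \<le> jacobi_weight \<alpha> \<beta> (cos t)" by (simp add: jacobi_weight_def)
    then show "h (cos t) * ennreal (jacobi_weight \<alpha> \<beta> (cos t)) * ennreal (sin t)
        = h (cos t) * ennreal (arc_weight (\<alpha> + 1/2) (\<beta> + 1/2) t)"
      using t cos_arc[of t] by (simp add: jacobi_weight_cos[symmetric] ennreal_mult mult.assoc)
  qed
  finally show ?thesis .
qed

text \<open>Functions vanishing at the nodes do not see the masses. The test polynomials and the
  lifted functions are constructed to satisfy \<open>zero\<close>.\<close>

lemma integral_jacobi_mass_measure:
  fixes f :: "real \<Rightarrow> real"
  assumes [measurable]: "f \<in> borel_measurable borel"
    and int: "integrable arcm (\<lambda>t. f (cos t) * arc_weight (\<alpha> + 1/2) (\<beta> + 1/2) t)"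
    and zero: "\<And>i. i < k \<Longrightarrow> f (a i) = 0"
  shows "integrable (jacobi_mass_measure \<alpha> \<beta> k a M) f"
    "(\<integral>x. f x \<partial>jacobi_mass_measure \<alpha> \<beta> k a M) =
    (LINT t|arcm. f (cos t) * arc_weight (\<alpha> + 1/2) (\<beta> + 1/2) t)"
proof -
  let ?N = "jacobi_mass_measure \<alpha> \<beta> k a M" and ?w = "arc_weight (\<alpha> + 1/2) (\<beta> + 1/2)"
  have nn: "(\<integral>\<^sup>+x. ennreal (g x) \<partial>?N) = (\<integral>\<^sup>+t. ennreal (g (cos t) * ?w t) \<partial>arcm)"
    if [measurable]: "g \<in> borel_measurable borel" and "\<And>i. i < k \<Longrightarrow> g (a i) = 0" for g
    using that by (subst nn_integral_jacobi_mass_measure)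
      (auto simp: arc_weight_nonneg ennreal_mult'' intro!: nn_integral_cong)
  show "integrable ?N f"
  proof (rule integrableI_bounded)
    have "(\<integral>\<^sup>+x. ennreal (norm (f x)) \<partial>?N) = (\<integral>\<^sup>+t. ennreal (norm (f (cos t) * ?w t)) \<partial>arcm)"
      using zero by (subst nn) (auto simp: abs_mult arc_weight_nonneg)
    also have "\<dots> < \<infinity>" using int by (simp add: integrable_iff_bounded)
    finally show "(\<integral>\<^sup>+x. ennreal (norm (f x)) \<partial>?N) < \<infinity>" .
  qed simp
  then have "(LINT x|?N. f x) = enn2real (\<integral>\<^sup>+x. ennreal (f x) \<partial>?N) - enn2real (\<integral>\<^sup>+x. ennreal (- f x) \<partial>?N)"
    by (rule real_lebesgue_integral_def)
  also have "\<dots> = enn2real (\<integral>\<^sup>+t. ennreal (f (cos t) * ?w t) \<partial>arcm)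
      - enn2real (\<integral>\<^sup>+t. ennreal (- (f (cos t) * ?w t)) \<partial>arcm)"
    using zero by (subst (1 2) nn) auto
  also have "\<dots> = (LINT t|arcm. f (cos t) * ?w t)"
    using int by (rule real_lebesgue_integral_def[symmetric])
  finally show "(LINT x|?N. f x) = (LINT t|arcm. f (cos t) * ?w t)" .
qed

section \<open>Orthonormal polynomials\<close>

lemma orthonormal_polysD:
  assumes "orthonormal_polys \<nu> P"
  shows "degree (P n) = n" "lead_coeff (P n) > 0" "coeff (P n) n > 0"
    "integrable \<nu> (\<lambda>x. poly (P m) x * poly (P n) x)"
    "(LINT x|\<nu>. poly (P m) x * poly (P n) x) = (if m = n then 1 else 0)"
proof -
  show *: "degree (P n) = n" "lead_coeff (P n) > 0"
    "integrable \<nu> (\<lambda>x. poly (P m) x * poly (P n) x)"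
    "(LINT x|\<nu>. poly (P m) x * poly (P n) x) = (if m = n then 1 else 0)"
    using assms unfolding orthonormal_polys_def by blast+
  show "coeff (P n) n > 0" using *(1,2) by simp
qed

lemma poly_eq_sum_of_basis:
  fixes q :: "'a::field poly" and P :: "nat \<Rightarrow> 'a poly"
  assumes P: "\<And>n. degree (P n) = n" "\<And>n. coeff (P n) n \<noteq> 0" and "degree q < n"
  shows "\<exists>c. q = (\<Sum>j<n. smult (c j) (P j))"
  using assms(3)
proof (induction n arbitrary: q)
  case 0
  then show ?case by simp
next
  case (Suc n)
  define r where "r = q - smult (coeff q n / coeff (P n) n) (P n)"
  have cn: "coeff r n = 0" using P(2)[of n] by (simp add: r_def)
  have "degree r \<le> n"
    using Suc.prems P(1)[of n] unfolding r_def by (intro degree_diff_le) auto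
  show ?case
  proof (cases "n = 0")
    case True
    then have "r = 0" using cn \<open>degree r \<le> n\<close> by (metis le_0_eq leading_coeff_0_iff)
    then show ?thesis using True by (intro exI[of _ "\<lambda>_. coeff q n / coeff (P n) n"]) (simp add: r_def)
  next
    case False
    have "degree r < n"
      using cn \<open>degree r \<le> n\<close> False by (metis degree_0 leading_coeff_0_iff le_neq_implies_less gr0I)
    from Suc.IH[OF this] obtain c where c: "r = (\<Sum>j<n. smult (c j) (P j))" by blast
    have "q = (\<Sum>j<Suc n. smult ((c(n := coeff q n / coeff (P n) n)) j) (P j))"
      using c by (simp add: r_def algebra_simps)
    then show ?thesis by blast
  qed
qed

context
  fixes \<nu> :: "real measure" and P :: "nat \<Rightarrow> real poly"
  assumes ON: "orthonormal_polys \<nu> P"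
begin

lemma orthonormal_expand:
  assumes "degree q < n"
  shows "\<exists>c. q = (\<Sum>j<n. smult (c j) (P j))"
  using poly_eq_sum_of_basis[of P q n] assms orthonormal_polysD(1,3)[OF ON] by (metis less_irrefl)

text \<open>\<open>orthonormal_polys\<close> supplies integrability for products of basis elements;
  expanding both factors extends it to all polynomials.\<close>

lemma orthonormal_integrable_mult: "integrable \<nu> (\<lambda>x. poly p x * poly q x)"
proof -
  obtain c where c: "p = (\<Sum>j<Suc (degree p). smult (c j) (P j))" using orthonormal_expand[of p] by blast
  obtain d where d: "q = (\<Sum>j<Suc (degree q). smult (d j) (P j))" using orthonormal_expand[of q] by blast
  have eq: "(\<lambda>x. poly p x * poly q x) = (\<lambda>x. \<Sum>i<Suc (degree p). \<Sum>j<Suc (degree q). c i * d j * (poly (P i) x * poly (P j) x))"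
    by (subst c, subst d) (simp add: poly_sum sum_product mult_ac del: sum.lessThan_Suc)
  show ?thesis unfolding eq
    using orthonormal_polysD(4)[OF ON] by (intro Bochner_Integration.integrable_sum integrable_mult_right) auto
qed

lemma orthonormal_coeff:
  "(LINT x|\<nu>. poly (\<Sum>j<n. smult (c j) (P j)) x * poly (P m) x) = (if m < n then c m else 0)"
proof -
  have "(LINT x|\<nu>. poly (\<Sum>j<n. smult (c j) (P j)) x * poly (P m) x)
      = (LINT x|\<nu>. (\<Sum>j<n. c j * (poly (P j) x * poly (P m) x)))"
    by (simp add: poly_sum sum_distrib_right mult.assoc)
  also have "\<dots> = (\<Sum>j<n. c j * (LINT x|\<nu>. poly (P j) x * poly (P m) x))"
    using orthonormal_polysD(4)[OF ON] by (subst Bochner_Integration.integral_sum) auto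
  also have "\<dots> = (if m < n then c m else 0)"
    unfolding orthonormal_polysD(5)[OF ON] by (simp add: if_distrib cong: if_cong)
  finally show ?thesis .
qed

lemma orthonormal_lower_degree:
  assumes "degree q < n" shows "(LINT x|\<nu>. poly q x * poly (P n) x) = 0"
  using orthonormal_expand[OF assms] orthonormal_coeff[where n=n and m=n] by auto

lemma orthonormal_top_coeff:
  assumes "degree q \<le> n"
  shows "(LINT x|\<nu>. poly q x * poly (P n) x) = coeff q n / coeff (P n) n"
proof -
  obtain c where c: "q = (\<Sum>j<Suc n. smult (c j) (P j))"
    using orthonormal_expand[of q "Suc n"] assms by auto
  have "coeff q n = c n * coeff (P n) n"
    by (subst c) (auto simp: coeff_sum orthonormal_polysD(1)[OF ON] intro!: sum.neutral coeff_eq_0)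
  moreover have "(LINT x|\<nu>. poly q x * poly (P n) x) = c n"
    by (subst c, subst orthonormal_coeff) simp
  ultimately show ?thesis using orthonormal_polysD(3)[OF ON, of n] by simp
qed

text \<open>Nonnegativity of the integral of (q - P n / \<kappa>)^2, whose cross term is given by
  \<open>orthonormal_top_coeff\<close>. Every monic competitor thus bounds the leading coefficient
  of \<open>P n\<close> from below.\<close>

lemma leading_coeff_extremal:
  assumes "degree q \<le> n" "coeff q n = 1"
  shows "1 / (coeff (P n) n)\<^sup>2 \<le> (LINT x|\<nu>. (poly q x)\<^sup>2)"
proof -
  define \<kappa> where "\<kappa> = coeff (P n) n"
  have \<kappa>: "\<kappa> > 0" using orthonormal_polysD(3)[OF ON] by (simp add: \<kappa>_def)
  have i: "integrable \<nu> (\<lambda>x. poly q x * poly q x)" "integrable \<nu> (\<lambda>x. poly q x * poly (P n) x)"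
     "integrable \<nu> (\<lambda>x. poly (P n) x * poly (P n) x)"
    by (rule orthonormal_integrable_mult)+
  have "0 \<le> (LINT x|\<nu>. (poly q x - poly (P n) x / \<kappa>)\<^sup>2)" by simp
  also have "\<dots> = (LINT x|\<nu>. (poly q x * poly q x - 2 / \<kappa> * (poly q x * poly (P n) x))
        + 1 / \<kappa>\<^sup>2 * (poly (P n) x * poly (P n) x))"
    using \<kappa> by (intro Bochner_Integration.integral_cong) (auto simp: field_simps power2_eq_square)
  also have "\<dots> = (LINT x|\<nu>. poly q x * poly q x) - 2 / \<kappa> * (1 / \<kappa>) + 1 / \<kappa>\<^sup>2 * 1"
    using i assms orthonormal_top_coeff[of q n] orthonormal_polysD(5)[OF ON, of n n]
    by (simp add: \<kappa>_def)
  finally show ?thesis using \<kappa> by (simp add: \<kappa>_def[symmetric] power2_eq_square)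
qed

text \<open>Multiplication by x is symmetric for the inner product: moving x to the other factor
  kills all coefficients below n - 1 and identifies the one at n - 1 with the top coefficient of the
  previous step.\<close>

lemma three_term_recurrence:
  defines "r \<equiv> \<lambda>n. coeff (P n) n / coeff (P (Suc n)) (Suc n)"
  shows "\<exists>b. \<forall>n x. x * poly (P n) x = r n * poly (P (Suc n)) x + b n * poly (P n) x
     + (if n = 0 then 0 else r (n - 1) * poly (P (n - 1)) x)"
proof -
  note D = orthonormal_polysD[OF ON]
  have "\<exists>b. \<forall>x. x * poly (P n) x = r n * poly (P (Suc n)) x + b * poly (P n) x
     + (if n = 0 then 0 else r (n - 1) * poly (P (n - 1)) x)" for n
  proof -
    define q where "q = pCons 0 (P n)"
    have q: "poly q x = x * poly (P n) x" for x by (simp add: q_def)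
    have "degree q \<le> Suc n" by (metis q_def degree_pCons_le D(1))
    then obtain c where c: "q = (\<Sum>j<Suc (Suc n). smult (c j) (P j))"
      using orthonormal_expand[of q "Suc (Suc n)"] by auto
    have cj: "c j = (LINT x|\<nu>. poly q x * poly (P j) x)" if "j < Suc (Suc n)" for j
      using that by (subst c, subst orthonormal_coeff) simp
    have cj': "c j = (LINT x|\<nu>. poly (pCons 0 (P j)) x * poly (P n) x)" if "j < Suc (Suc n)" for j
      unfolding cj[OF that] q by (simp add: mult_ac)
    have c1: "c (Suc n) = r n"
      using \<open>degree q \<le> Suc n\<close> by (simp add: cj orthonormal_top_coeff r_def) (simp add: q_def)
    have c0: "c j = 0" if "Suc j < n" for j
    proof -
      have "degree (pCons 0 (P j)) < n" using that D(1)[of j] degree_pCons_le[of 0 "P j"] by linarith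
      then show ?thesis using that by (simp add: cj' orthonormal_lower_degree del: poly_pCons)
    qed
    have c2: "c (n - 1) = r (n - 1)" if "n > 0"
    proof -
      have "degree (pCons 0 (P (n - 1))) \<le> n"
        using that D(1)[of "n - 1"] degree_pCons_le[of 0 "P (n - 1)"] by linarith
      then show ?thesis using that by (cases n) (simp_all add: cj' orthonormal_top_coeff r_def del: poly_pCons)
    qed
    have "x * poly (P n) x = r n * poly (P (Suc n)) x + c n * poly (P n) x
       + (if n = 0 then 0 else r (n - 1) * poly (P (n - 1)) x)" for x
    proof -
      have "x * poly (P n) x = (\<Sum>j<Suc (Suc n). c j * poly (P j) x)"
        unfolding q[symmetric] by (subst c) (simp add: poly_sum)
      also have "\<dots> = c (Suc n) * poly (P (Suc n)) x + c n * poly (P n) x + (\<Sum>j<n. c j * poly (P j) x)"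
        by simp
      also have "(\<Sum>j<n. c j * poly (P j) x)
          = (if n = 0 then 0 else r (n - 1) * poly (P (n - 1)) x)"
      proof (cases n)
        case (Suc m)
        have "(\<Sum>j<m. c j * poly (P j) x) = 0"
          using c0 Suc by (intro sum.neutral) auto
        then show ?thesis using Suc c2 by simp
      qed simp
      finally show ?thesis by (simp add: c1)
    qed
    then show ?thesis by blast
  qed
  then show ?thesis by metis
qed

text \<open>In x P(x) P(y) - P(x) y P(y) the diagonal terms \<open>b n\<close> cancel, and what
  remains telescopes over n.\<close>

lemma christoffel_darboux:
  "(x - y) * kernel_L P n x y = coeff (P n) n / coeff (P (Suc n)) (Suc n) *
     (poly (P (Suc n)) x * poly (P n) y - poly (P n) x * poly (P (Suc n)) y)"
proof -
  define r where "r n = coeff (P n) n / coeff (P (Suc n)) (Suc n)" for n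
  obtain b where b: "\<And>n x. x * poly (P n) x = r n * poly (P (Suc n)) x + b n * poly (P n) x
     + (if n = 0 then 0 else r (n - 1) * poly (P (n - 1)) x)"
    using three_term_recurrence[folded r_def] by blast
  have "(x - y) * kernel_L P n x y = r n * (poly (P (Suc n)) x * poly (P n) y - poly (P n) x * poly (P (Suc n)) y)"
  proof (induction n)
    case 0
    have "(x - y) * kernel_L P 0 x y = (x * poly (P 0) x) * poly (P 0) y - poly (P 0) x * (y * poly (P 0) y)"
      by (simp add: kernel_L_def algebra_simps)
    also have "\<dots> = r 0 * (poly (P (Suc 0)) x * poly (P 0) y - poly (P 0) x * poly (P (Suc 0)) y)"
      by (subst (1 2) b) (simp add: algebra_simps)
    finally show ?case .
  next
    case (Suc n)
    have "(x - y) * kernel_L P (Suc n) x y = (x - y) * kernel_L P n x y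
        + ((x * poly (P (Suc n)) x) * poly (P (Suc n)) y - poly (P (Suc n)) x * (y * poly (P (Suc n)) y))"
      by (simp add: kernel_L_def algebra_simps)
    also have "\<dots> = r (Suc n) * (poly (P (Suc (Suc n))) x * poly (P (Suc n)) y - poly (P (Suc n)) x * poly (P (Suc (Suc n))) y)"
      by (subst (1 2) b, subst Suc.IH) (simp add: algebra_simps)
    finally show ?case .
  qed
  then show ?thesis by (simp add: r_def)
qed

end

section \<open>The Riemann-Lebesgue lemma\<close>

text \<open>Bessel's inequality for a system that is orthogonal and bounded but not normalised:
  dividing by one K that bounds all squared norms, instead of by the norms themselves, still makes
  the remainder \<open>R n\<close> lose at least K c_n^2 at every step. The losses of a decreasing
  nonnegative sequence tend to 0.\<close>

lemma (in finite_measure) bessel_tendsto_zero: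
  fixes e :: "nat \<Rightarrow> 'a \<Rightarrow> real" and h :: "'a \<Rightarrow> real"
  assumes e [measurable]: "\<And>n. e n \<in> borel_measurable M" and e1: "\<And>n x. \<bar>e n x\<bar> \<le> 1"
    and orth: "\<And>m n. m \<noteq> n \<Longrightarrow> (LINT x|M. e m x * e n x) = 0"
    and h [measurable]: "h \<in> borel_measurable M" and hB: "\<And>x. \<bar>h x\<bar> \<le> B"
  shows "(\<lambda>n. LINT x|M. h x * e n x) \<longlonglongrightarrow> 0"
proof -
  \<comment> \<open>The summand 1 keeps K positive even if the space has measure 0.\<close>
  define K where "K = measure M (space M) + 1"
  have K: "K > 0" by (simp add: K_def add_nonneg_pos)
  define c where "c n = (LINT x|M. h x * e n x) / K" for n
  define R where "R n x = h x - (\<Sum>k<n. c k * e k x)" for n x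
  have [measurable]: "R n \<in> borel_measurable M" for n unfolding R_def by measurable
  have "\<exists>C. \<forall>x. \<bar>R n x\<bar> \<le> C" for n
  proof (induction n)
    case 0 then show ?case using hB by (auto simp: R_def)
  next
    case (Suc n)
    then obtain C where C: "\<And>x. \<bar>R n x\<bar> \<le> C" by blast
    have "\<bar>R (Suc n) x\<bar> \<le> C + \<bar>c n\<bar>" for x
    proof -
      have "\<bar>R (Suc n) x\<bar> = \<bar>R n x - c n * e n x\<bar>" by (simp add: R_def algebra_simps)
      also have "\<dots> \<le> \<bar>R n x\<bar> + \<bar>c n\<bar> * \<bar>e n x\<bar>" by (metis abs_mult abs_triangle_ineq4)
      also have "\<dots> \<le> C + \<bar>c n\<bar> * 1" by (intro add_mono C mult_left_mono e1) auto
      finally show ?thesis by simp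
    qed
    then show ?case by blast
  qed
  then obtain C where C: "\<And>n x. \<bar>R n x\<bar> \<le> C n" by metis
  have int: "integrable M (\<lambda>x. f x * g x)"
    if "f \<in> borel_measurable M" "g \<in> borel_measurable M" "\<And>x. \<bar>f x\<bar> \<le> A" "\<And>x. \<bar>g x\<bar> \<le> D" for f g :: "'a \<Rightarrow> real" and A D
    using that by (intro integrable_const_bound[where B="A * D"])
      (auto simp: abs_mult intro!: mult_mono order_trans[OF abs_ge_zero that(3)])
  have Re: "(LINT x|M. R n x * e m x) = (LINT x|M. h x * e m x)" if "n \<le> m" for n m
    using that
  proof (induction n)
    case 0 then show ?case by (simp add: R_def)
  next
    case (Suc n)
    have "(LINT x|M. R (Suc n) x * e m x) = (LINT x|M. R n x * e m x - c n * (e n x * e m x))"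
      by (intro Bochner_Integration.integral_cong) (auto simp: R_def algebra_simps)
    also have "\<dots> = (LINT x|M. R n x * e m x) - c n * (LINT x|M. e n x * e m x)"
      using int[OF _ _ C e1] int[OF _ _ e1 e1] by (subst Bochner_Integration.integral_diff) auto
    finally show ?case using Suc orth[of n m] by simp
  qed
  define s where "s n = (LINT x|M. R n x * R n x)" for n
  have e2: "(LINT x|M. e n x * e n x) \<le> K" for n
  proof -
    have "(LINT x|M. e n x * e n x) \<le> (LINT x|M. 1)"
    proof (intro integral_mono int[OF _ _ e1 e1])
      fix x show "e n x * e n x \<le> 1" using e1[of n x] by (metis abs_mult_self_eq abs_ge_zero mult_le_one)
    qed auto
    then show ?thesis by (simp add: K_def)
  qed
  have step: "K * (c n)\<^sup>2 \<le> s n - s (Suc n)" for n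
  proof -
    have "s (Suc n) = (LINT x|M. (R n x * R n x - 2 * c n * (R n x * e n x)) + (c n)\<^sup>2 * (e n x * e n x))"
      unfolding s_def by (intro Bochner_Integration.integral_cong) (auto simp: R_def algebra_simps power2_eq_square)
    also have "\<dots> = s n - 2 * c n * (LINT x|M. R n x * e n x) + (c n)\<^sup>2 * (LINT x|M. e n x * e n x)"
      using int[OF _ _ C e1] int[OF _ _ e1 e1] int[OF _ _ C C]
      by (simp add: s_def)
    also have "\<dots> \<le> s n - 2 * c n * (K * c n) + (c n)\<^sup>2 * K"
      using K e2[of n] Re[of n n] by (intro add_mono mult_left_mono) (auto simp: c_def)
    finally show ?thesis by (simp add: power2_eq_square algebra_simps)
  qed
  have "decseq s"
  proof (rule decseq_SucI)
    fix n have "0 \<le> K * (c n)\<^sup>2" using K by simp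
    then show "s (Suc n) \<le> s n" using step[of n] by linarith
  qed
  moreover have "\<forall>n. 0 \<le> s n" unfolding s_def by simp
  ultimately obtain l where l: "s \<longlonglongrightarrow> l" by (rule decseq_convergent)
  have "(\<lambda>n. s n - s (Suc n)) \<longlonglongrightarrow> l - l" by (intro tendsto_diff l LIMSEQ_Suc)
  then have lim: "(\<lambda>n. s n - s (Suc n)) \<longlonglongrightarrow> 0" by simp
  have "(\<lambda>n. K * (c n)\<^sup>2) \<longlonglongrightarrow> 0"
  proof (rule tendsto_sandwich[OF _ _ tendsto_const lim])
    show "\<forall>\<^sub>F n in sequentially. 0 \<le> K * (c n)\<^sup>2" using K by (intro always_eventually) simp
    show "\<forall>\<^sub>F n in sequentially. K * (c n)\<^sup>2 \<le> s n - s (Suc n)" by (intro always_eventually allI step)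
  qed
  then have "(\<lambda>n. K * (K * (c n)\<^sup>2)) \<longlonglongrightarrow> K * 0" by (rule tendsto_mult[OF tendsto_const])
  then have "(\<lambda>n. sqrt (K * (K * (c n)\<^sup>2))) \<longlonglongrightarrow> sqrt (K * 0)" by (rule tendsto_real_sqrt)
  moreover have "sqrt (K * (K * (c n)\<^sup>2)) = \<bar>LINT x|M. h x * e n x\<bar>" for n
  proof -
    have "K * (K * (c n)\<^sup>2) = (LINT x|M. h x * e n x)\<^sup>2" using K by (simp add: c_def power2_eq_square)
    then show ?thesis by simp
  qed
  ultimately show ?thesis by (simp add: tendsto_rabs_zero_iff)
qed

text \<open>Truncating h at height N reduces to bounded functions: the truncation error is small in
  L1 and, since \<open>e n\<close> is bounded by 1, this is uniform in n.\<close>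

lemma (in finite_measure) orthogonal_tendsto_zero:
  fixes e :: "nat \<Rightarrow> 'a \<Rightarrow> real" and h :: "'a \<Rightarrow> real"
  assumes e [measurable]: "\<And>n. e n \<in> borel_measurable M" and e1: "\<And>n x. \<bar>e n x\<bar> \<le> 1"
    and orth: "\<And>m n. m \<noteq> n \<Longrightarrow> (LINT x|M. e m x * e n x) = 0"
    and h: "integrable M h"
  shows "(\<lambda>n. LINT x|M. h x * e n x) \<longlonglongrightarrow> 0"
proof (rule LIMSEQ_I)
  fix r :: real assume r: "r > 0"
  have [measurable]: "h \<in> borel_measurable M" using h by auto
  define g where "g N x = max (- real N) (min (real N) (h x))" for N x
  have [measurable]: "g N \<in> borel_measurable M" for N unfolding g_def by measurable
  have gh: "\<bar>g N x\<bar> \<le> \<bar>h x\<bar>" for N x by (auto simp: g_def)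
  have "(\<lambda>N. LINT x|M. \<bar>h x - g N x\<bar>) \<longlonglongrightarrow> (LINT x|M. 0)"
  proof (rule integral_dominated_convergence[where w="\<lambda>x. 2 * \<bar>h x\<bar>"])
    show "integrable M (\<lambda>x. 2 * \<bar>h x\<bar>)" using h by simp
    show "AE x in M. norm \<bar>h x - g N x\<bar> \<le> 2 * \<bar>h x\<bar>" for N
      using gh[of N] by (intro AE_I2) (smt (verit) real_norm_def)
    show "AE x in M. (\<lambda>N. \<bar>h x - g N x\<bar>) \<longlonglongrightarrow> 0"
    proof (intro AE_I2 tendsto_eventually)
      fix x
      obtain N0 where "\<bar>h x\<bar> \<le> real N0" using real_arch_simple by blast
      then show "\<forall>\<^sub>F N in sequentially. \<bar>h x - g N x\<bar> = 0"
        by (intro eventually_sequentiallyI[of N0]) (auto simp: g_def)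
    qed
  qed auto
  then obtain N where N: "(LINT x|M. \<bar>h x - g N x\<bar>) < r / 2"
    using r by (auto dest!: LIMSEQ_D[where r="r/2"])
  have gN: "\<bar>g N x\<bar> \<le> real N" for x by (auto simp: g_def)
  have "(\<lambda>n. LINT x|M. g N x * e n x) \<longlonglongrightarrow> 0"
    by (rule bessel_tendsto_zero[OF e e1 orth _ gN]) auto
  from LIMSEQ_D[OF this half_gt_zero[OF r]]
  obtain n0 where n0: "\<And>n. n \<ge> n0 \<Longrightarrow> \<bar>LINT x|M. g N x * e n x\<bar> < r / 2"
    unfolding real_norm_def diff_zero by blast
  have ig: "integrable M (g N)"
    by (rule Bochner_Integration.integrable_bound[OF h]) (use gh[of N] in auto)
  have ie: "integrable M (\<lambda>x. f x * e n x)" if "integrable M f" for f n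
    using that by (intro Bochner_Integration.integrable_bound[OF that])
       (auto simp: abs_mult intro!: mult_left_le e1)
  show "\<exists>n0. \<forall>n\<ge>n0. norm ((LINT x|M. h x * e n x) - 0) < r"
  proof (intro exI allI impI)
    fix n assume n: "n \<ge> n0"
    have "(LINT x|M. h x * e n x) = (LINT x|M. (h x - g N x) * e n x) + (LINT x|M. g N x * e n x)"
      using ie[OF h] ie[OF ig] by (simp add: left_diff_distrib)
    moreover have "\<bar>LINT x|M. (h x - g N x) * e n x\<bar> \<le> (LINT x|M. \<bar>h x - g N x\<bar>)"
    proof (rule order_trans[OF integral_abs_bound integral_mono])
      show "integrable M (\<lambda>x. \<bar>(h x - g N x) * e n x\<bar>)" using h ig by (intro integrable_abs ie) auto
      show "\<bar>(h x - g N x) * e n x\<bar> \<le> \<bar>h x - g N x\<bar>" for x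
        by (simp add: abs_mult mult_left_le e1)
    qed (use h ig in auto)
    ultimately show "norm ((LINT x|M. h x * e n x) - 0) < r" using N n0[OF n] by simp
  qed
qed

lemma integral_arc_cos: "(LINT t|arcm. cos (real j * t)) = (if j = 0 then pi else 0)"
proof (cases "j = 0")
  case True
  then show ?thesis by (simp add: measure_arc_space)
next
  case False
  have "(LINT t|arcm. cos (real j * t)) = (LINT t|lborel. indicator {0<..<pi} t *\<^sub>R cos (real j * t))"
    unfolding arcm_def by (rule integral_restrict_space) auto
  also have "\<dots> = (LINT t|lborel. indicator {0..pi} t *\<^sub>R cos (real j * t))"
    by (intro integral_cong_AE) (auto intro!: AE_I[where N="{0, pi}"] simp: indicator_def emeasure_lborel_countable split: if_splits)
  also have "\<dots> = sin (real j * pi) / real j - sin (real j * 0) / real j"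
    using False by (intro integral_FTC_Icc)
       (auto intro!: derivative_eq_intros continuous_intros simp flip: has_real_derivative_iff_has_vector_derivative)
  also have "\<dots> = 0" by simp
  finally show ?thesis using False by simp
qed

lemma integrable_arc_bounded:
  fixes f :: "real \<Rightarrow> real"
  assumes "f \<in> borel_measurable arcm" "\<And>t. \<bar>f t\<bar> \<le> B"
  shows "integrable arcm f"
  using assms by (intro arcm.integrable_const_bound[where B=B]) auto

text \<open>The phase g is merely measurable, so the addition formula moves cos g and sin g into the
  integrable factor. On (0, pi) the cosines and the sines are each orthogonal systems, though in
  general not to each other, so they are treated separately.\<close>

lemma riemann_lebesgue_arc:
  assumes h: "integrable arcm h" and [measurable]: "g \<in> borel_measurable borel"
  shows "(\<lambda>n. LINT t|arcm. h t * cos (real n * t + g t)) \<longlonglongrightarrow> 0"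
proof -
  have diff: "\<exists>j>0. \<forall>t. cos (real m * t - real n * t) = cos (real j * t)" if "m \<noteq> n" for m n :: nat
  proof (cases "m < n")
    case True
    have "cos (real m * t - real n * t) = cos (real (n - m) * t)" for t
      using True by (subst cos_minus[symmetric]) (simp add: of_nat_diff algebra_simps)
    then show ?thesis using True by (intro exI[of _ "n - m"]) auto
  next
    case False
    then show ?thesis using that by (intro exI[of _ "m - n"]) (auto simp: of_nat_diff algebra_simps)
  qed
  have ic: "integrable arcm (\<lambda>t. cos (real j * t))" for j
    by (rule integrable_arc_bounded[where B=1]) auto
  have "(\<lambda>n. LINT t|arcm. f t * cos (real n * t)) \<longlonglongrightarrow> 0" if "integrable arcm f" for f
  proof (rule arcm.orthogonal_tendsto_zero[OF _ _ _ that])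
    fix m n :: nat assume "m \<noteq> n"
    then obtain j where j: "j > 0" "\<And>t. cos (real m * t - real n * t) = cos (real j * t)" using diff by blast
    have "(LINT t|arcm. cos (real m * t) * cos (real n * t))
      = (LINT t|arcm. (1/2) * cos (real j * t) + (1/2) * cos (real (m + n) * t))"
      by (intro Bochner_Integration.integral_cong) (simp_all add: cos_times_cos j(2) distrib_right add_divide_distrib)
    also have "\<dots> = 0" using j \<open>m \<noteq> n\<close> ic[of j] ic[of "m+n"]
      by (subst Bochner_Integration.integral_add) (auto simp: integral_arc_cos simp del: of_nat_add)
    finally show "(LINT t|arcm. cos (real m * t) * cos (real n * t)) = 0" .
  qed auto
  moreover have "(\<lambda>n. LINT t|arcm. f t * sin (real n * t)) \<longlonglongrightarrow> 0" if "integrable arcm f" for f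
  proof (rule arcm.orthogonal_tendsto_zero[OF _ _ _ that])
    fix m n :: nat assume "m \<noteq> n"
    then obtain j where j: "j > 0" "\<And>t. cos (real m * t - real n * t) = cos (real j * t)" using diff by blast
    have "(LINT t|arcm. sin (real m * t) * sin (real n * t))
      = (LINT t|arcm. (1/2) * cos (real j * t) - (1/2) * cos (real (m + n) * t))"
      by (intro Bochner_Integration.integral_cong) (simp_all add: sin_times_sin j(2) distrib_right diff_divide_distrib)
    also have "\<dots> = 0" using j \<open>m \<noteq> n\<close> ic[of j] ic[of "m+n"]
      by (subst Bochner_Integration.integral_diff) (auto simp: integral_arc_cos simp del: of_nat_add)
    finally show "(LINT t|arcm. sin (real m * t) * sin (real n * t)) = 0" .
  qed auto
  moreover have i: "integrable arcm (\<lambda>t. h t * cos (g t))" "integrable arcm (\<lambda>t. h t * sin (g t))"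
    by (rule Bochner_Integration.integrable_bound[OF h]; use h in \<open>auto simp: abs_mult intro!: mult_left_le\<close>)+
  ultimately have "(\<lambda>n. (LINT t|arcm. h t * cos (g t) * cos (real n * t)) - (LINT t|arcm. h t * sin (g t) * sin (real n * t))) \<longlonglongrightarrow> 0 - 0"
    by (intro tendsto_diff) auto
  moreover have "(LINT t|arcm. h t * cos (real n * t + g t))
      = (LINT t|arcm. h t * cos (g t) * cos (real n * t)) - (LINT t|arcm. h t * sin (g t) * sin (real n * t))" for n
  proof -
    have "integrable arcm (\<lambda>t. h t * cos (g t) * cos (real n * t))" "integrable arcm (\<lambda>t. h t * sin (g t) * sin (real n * t))"
      by (rule Bochner_Integration.integrable_bound[OF i(1)], use i(1) in \<open>auto simp: abs_mult intro!: mult_left_le\<close>)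
         (rule Bochner_Integration.integrable_bound[OF i(2)], use i(2) in \<open>auto simp: abs_mult intro!: mult_left_le\<close>)
    then show ?thesis
      by (subst Bochner_Integration.integral_diff[symmetric])
         (auto intro!: Bochner_Integration.integral_cong simp: cos_add algebra_simps)
  qed
  ultimately show ?thesis by simp
qed

section \<open>The Szego function and its polynomial approximations\<close>

text \<open>Keeping the coefficients real makes the real part at \<open>cis t\<close> a cosine
  polynomial, which is what can be rewritten as a polynomial in cos t.\<close>

definition cpoly :: "real poly \<Rightarrow> complex \<Rightarrow> complex" where
  "cpoly p z = poly (map_poly of_real p) z"

lemma cpoly_add: "cpoly (p + q) z = cpoly p z + cpoly q z"
proof -
  have "map_poly complex_of_real (p + q) = map_poly of_real p + map_poly of_real q"
    by (intro poly_eqI) (simp add: coeff_map_poly)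
  then show ?thesis by (simp add: cpoly_def)
qed

lemma cpoly_mult: "cpoly (p * q) z = cpoly p z * cpoly q z"
proof -
  have "map_poly complex_of_real (p * q) = map_poly of_real p * map_poly of_real q"
    by (intro poly_eqI) (simp add: coeff_map_poly coeff_mult)
  then show ?thesis by (simp add: cpoly_def)
qed

lemma cpoly_1 [simp]: "cpoly 1 z = 1"
  by (simp add: cpoly_def)

lemma cpoly_0 [simp]: "cpoly 0 z = 0"
  by (simp add: cpoly_def)

lemma cpoly_monom: "cpoly (monom c n) z = of_real c * z ^ n"
  by (simp add: cpoly_def map_poly_monom poly_monom)

lemma cpoly_sum: "cpoly (\<Sum>i\<in>A. f i) z = (\<Sum>i\<in>A. cpoly (f i) z)"
  by (induction A rule: infinite_finite_induct) (simp_all add: cpoly_add)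

lemma cpoly_altdef: "cpoly p z = (\<Sum>j\<le>degree p. of_real (coeff p j) * z ^ j)"
  using cpoly_sum[of "\<lambda>j. monom (coeff p j) j" "{..degree p}" z]
  by (simp add: poly_as_sum_of_monoms cpoly_monom)

lemma of_real_gbinomial: "complex_of_real (e gchoose n) = of_real e gchoose n"
  by (simp add: gbinomial_prod_rev)

lemma norm_powr_of_real: "norm (z powr complex_of_real e) = norm z powr e"
  by (simp add: norm_powr_real_powr')

text \<open>Passing from 1 + t z to 1 + z changes the modulus by at most 1 - t, and |1 + t z| is
  itself at least 1 - t. This dominates negative powers of 1 + t z, uniformly in t, by those of 1 +
  z.\<close>

lemma norm_one_plus_scaled_ge:
  fixes z :: complex assumes "norm z \<le> 1" "0 \<le> t" "t \<le> 1"
  shows "norm (1 + z) \<le> 2 * norm (1 + of_real t * z)"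
proof -
  have "norm (of_real t * z) \<le> t"
    using assms by (simp add: norm_mult mult_left_le)
  have "1 - t \<le> norm (1 + of_real t * z)"
    using norm_diff_ineq[of 1 "of_real t * z"] \<open>norm (of_real t * z) \<le> t\<close> by simp
  moreover have "norm (1 + z) \<le> norm (1 + of_real t * z) + norm ((1 - of_real t) * z)"
    by (rule order_trans[OF _ norm_triangle_ineq]) (simp add: algebra_simps)
  moreover have "norm ((1 - of_real t) * z) \<le> 1 - t"
  proof -
    have "norm (1 - complex_of_real t) = 1 - t" using assms
      by (metis abs_of_nonneg diff_ge_0_iff_ge norm_of_real of_real_1 of_real_diff)
    then show ?thesis using assms by (simp add: norm_mult mult_left_le)
  qed
  ultimately show ?thesis by linarith
qed

section \<open>Polynomial approximation of powers on the unit circle\<close>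

lemma binomial_polynomial_approx:
  fixes e \<sigma> t \<epsilon> :: real
  assumes "\<bar>\<sigma>\<bar> = 1" "0 \<le> t" "t < 1" "\<epsilon> > 0"
  shows "\<exists>A::real poly. coeff A 0 = 1 \<and>
    (\<forall>z. norm z \<le> 1 \<longrightarrow> norm (cpoly A z - (1 + of_real (t * \<sigma>) * z) powr of_real e) < \<epsilon>)"
proof -
  define c where "c n = (e gchoose n) * (t * \<sigma>) ^ n" for n
  \<comment> \<open>Convergence of the binomial series at a point s beyond t gives absolute
    convergence at t, hence uniform approximation on the closed disc.\<close>
  obtain s where s: "t < s" "s < 1" using dense[OF \<open>t < 1\<close>] by blast
  have "summable (\<lambda>n. complex_of_real (e gchoose n) * of_real s ^ n)"
    using gen_binomial_complex[of "of_real s" "of_real e"] s \<open>0 \<le> t\<close>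
    by (simp add: of_real_gbinomial sums_iff)
  then have "summable (\<lambda>n. norm (complex_of_real (e gchoose n) * of_real (t * \<sigma>) ^ n))"
    by (rule powser_insidea) (use assms s in \<open>simp add: norm_mult\<close>)
  then have sc: "summable (\<lambda>n. \<bar>c n\<bar>)"
    by (simp add: c_def norm_mult norm_power abs_mult power_abs)
  obtain N0 where N0: "\<And>n. n \<ge> N0 \<Longrightarrow> norm (\<Sum>i. \<bar>c (i + n)\<bar>) < \<epsilon>"
    using suminf_exist_split[OF \<open>\<epsilon> > 0\<close> sc] by blast
  \<comment> \<open>The successor keeps the term of index 0 in the truncation, which fixes the
    constant coefficient 1.\<close>
  define N where "N = Suc N0"
  define A where "A = (\<Sum>j<N. monom (c j) j)"
  have "coeff A 0 = 1" by (simp add: A_def coeff_sum N_def c_def if_distrib sum.If_cases)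
  moreover have "norm (cpoly A z - (1 + of_real (t * \<sigma>) * z) powr of_real e) < \<epsilon>" if z: "norm z \<le> 1" for z
  proof -
    have "norm (of_real (t * \<sigma>) * z) < 1"
    proof -
      have "norm (of_real (t * \<sigma>) * z) \<le> t" using assms z by (simp add: norm_mult abs_mult mult_left_le)
      then show ?thesis using assms by simp
    qed
    from gen_binomial_complex[OF this, of "of_real e"]
    have sums: "(\<lambda>n. of_real (c n) * z ^ n) sums (1 + of_real (t * \<sigma>) * z) powr of_real e"
      by (simp add: c_def of_real_gbinomial[symmetric] power_mult_distrib mult_ac)
    have nb: "norm (of_real (c n) * z ^ n) \<le> \<bar>c n\<bar>" for n
      using z by (simp add: norm_mult norm_power mult_left_le power_le_one)
    have "(1 + of_real (t * \<sigma>) * z) powr of_real e - cpoly A z = (\<Sum>i. of_real (c (i + N)) * z ^ (i + N))"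
      using suminf_minus_initial_segment[OF sums_summable[OF sums], of N] sums_unique[OF sums]
      by (simp add: A_def cpoly_sum cpoly_monom)
    also have "norm \<dots> \<le> (\<Sum>i. \<bar>c (i + N)\<bar>)"
    proof -
      have sN: "summable (\<lambda>i. \<bar>c (i + N)\<bar>)" using summable_iff_shift[of "\<lambda>n. \<bar>c n\<bar>" N] sc by simp
      have sn: "summable (\<lambda>i. norm (of_real (c (i + N)) * z ^ (i + N)))"
        by (rule summable_comparison_test'[OF sN, of 0]) (use nb in auto)
      show ?thesis
        by (rule order_trans[OF summable_norm[OF sn] suminf_le[OF nb sn sN]])
    qed
    also have "\<dots> < \<epsilon>" using N0[of N] by (simp add: N_def)
    finally show ?thesis by (simp add: norm_minus_commute)
  qed
  ultimately show ?thesis by blast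
qed

text \<open>Dilating by factors tending to 1 moves the singular point off the circle, so that
  truncated series apply. The bound by |1 + \<sigma> z|^e, independent of m, prepares dominated
  convergence; the constant coefficient 1 is the value at 0, which carries the mean value
  property.\<close>

lemma binomial_polynomial_sequence:
  fixes e \<sigma> :: real
  assumes \<sigma>: "\<bar>\<sigma>\<bar> = 1"
  shows "\<exists>(A::nat \<Rightarrow> real poly) K. K \<ge> 0 \<and> (\<forall>m. coeff (A m) 0 = 1) \<and>
    (\<forall>m z. norm z = 1 \<longrightarrow> 1 + of_real \<sigma> * z \<noteq> 0 \<longrightarrow> norm (cpoly (A m) z) \<le> K * (1 + norm (1 + of_real \<sigma> * z) powr e)) \<and>
    (\<forall>z. norm z = 1 \<longrightarrow> 1 + of_real \<sigma> * z \<noteq> 0 \<longrightarrow>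
      (\<lambda>m. cpoly (A m) z) \<longlonglongrightarrow> (1 + of_real \<sigma> * z) powr of_real e)"
proof -
  define t where "t m = 1 - 1 / (real m + 1)" for m
  have t: "0 \<le> t m" "t m < 1" for m by (auto simp: t_def)
  have "\<forall>m. \<exists>A::real poly. coeff A 0 = 1 \<and>
    (\<forall>z. norm z \<le> 1 \<longrightarrow> norm (cpoly A z - (1 + of_real (t m * \<sigma>) * z) powr of_real e) < 1 / (real m + 1))"
    using t by (intro allI binomial_polynomial_approx \<sigma>) auto
  then obtain A where A: "\<And>m. coeff (A m) 0 = 1"
    "\<And>m z. norm z \<le> 1 \<Longrightarrow> norm (cpoly (A m) z - (1 + of_real (t m * \<sigma>) * z) powr of_real e) < 1 / (real m + 1)"
    by metis
  define K where "K = 1 + 2 powr \<bar>e\<bar>"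
  have "norm (cpoly (A m) z) \<le> K * (1 + norm (1 + of_real \<sigma> * z) powr e)"
    if z: "norm z = 1" "1 + of_real \<sigma> * z \<noteq> 0" for m z
  proof -
    let ?w = "1 + of_real (t m) * (of_real \<sigma> * z)" and ?u = "1 + of_real \<sigma> * z"
    have n1: "norm (of_real \<sigma> * z) = 1" using z \<sigma> by (simp add: norm_mult)
    have lo: "norm ?u / 2 \<le> norm ?w"
      using norm_one_plus_scaled_ge[of "of_real \<sigma> * z" "t m"] n1 t[of m] by simp
    have up: "norm ?w \<le> 2"
      using norm_triangle_ineq[of 1 "of_real (t m) * (of_real \<sigma> * z)"] t[of m] n1
      by (simp add: norm_mult[of "of_real (t m)"])
    have u: "norm ?u > 0" using z by simp
    have "norm ?w powr e \<le> 2 powr \<bar>e\<bar> * (1 + norm ?u powr e)"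
    proof (cases "e \<ge> 0")
      case True
      then have "norm ?w powr e \<le> 2 powr e * 1" using up by (simp add: powr_mono2)
      also have "\<dots> \<le> 2 powr \<bar>e\<bar> * (1 + norm ?u powr e)" using True by (intro mult_mono) auto
      finally show ?thesis .
    next
      case False
      then have "norm ?w powr e \<le> (norm ?u / 2) powr e"
        using lo u by (intro powr_mono2') auto
      also have "\<dots> = 2 powr \<bar>e\<bar> * norm ?u powr e"
        using False u by (simp add: powr_divide powr_minus field_simps)
      also have "\<dots> \<le> 2 powr \<bar>e\<bar> * (1 + norm ?u powr e)" by (intro mult_left_mono) auto
      finally show ?thesis .
    qed
    moreover have "norm (cpoly (A m) z) \<le> 1 + norm ?w powr e"
    proof -
      have "norm (cpoly (A m) z - ?w powr of_real e) < 1 / (real m + 1)"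
        using A(2)[of z m] z by (simp add: mult_ac)
      also have "\<dots> \<le> 1" by simp
      finally show ?thesis
        using norm_triangle_ineq2[of "cpoly (A m) z" "?w powr of_real e"] by (simp add: norm_powr_of_real)
    qed
    ultimately have "norm (cpoly (A m) z) \<le> 1 + 2 powr \<bar>e\<bar> * (1 + norm ?u powr e)" by linarith
    also have "\<dots> \<le> K * (1 + norm ?u powr e)" by (simp add: K_def algebra_simps)
    finally show ?thesis .
  qed
  moreover have "(\<lambda>m. cpoly (A m) z) \<longlonglongrightarrow> (1 + of_real \<sigma> * z) powr of_real e"
    if z: "norm z = 1" "1 + of_real \<sigma> * z \<noteq> 0" for z
  proof -
    let ?u = "1 + of_real \<sigma> * z"
    have n1: "norm (of_real \<sigma> * z) = 1" using z \<sigma> by (simp add: norm_mult)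
    \<comment> \<open>On the circle \<sigma> z has real part at least -1, so 1 + \<sigma> z meets
      the branch cut of the principal power only at 0.\<close>
    have "?u \<notin> \<real>\<^sub>\<le>\<^sub>0"
    proof
      assume "?u \<in> \<real>\<^sub>\<le>\<^sub>0"
      then have "Re (of_real \<sigma> * z) \<le> -1" "Im (of_real \<sigma> * z) = 0" by (auto simp: complex_nonpos_Reals_iff)
      moreover have "\<bar>Re (of_real \<sigma> * z)\<bar> \<le> 1" using abs_Re_le_cmod[of "of_real \<sigma> * z"] n1 by simp
      ultimately have "of_real \<sigma> * z = -1" by (auto simp: complex_eq_iff)
      then show False using z(2) by simp
    qed
    moreover have tl: "t \<longlonglongrightarrow> 1"
    proof -
      have "(\<lambda>m. 1 - inverse (real (Suc m))) \<longlonglongrightarrow> 1 - 0"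
        by (intro tendsto_intros LIMSEQ_inverse_real_of_nat)
      then show ?thesis by (simp add: t_def[abs_def] divide_inverse add.commute)
    qed
    moreover have "(\<lambda>m. 1 + of_real (t m * \<sigma>) * z) \<longlonglongrightarrow> 1 + of_real (1 * \<sigma>) * z"
      by (intro tendsto_intros tl)
    ultimately have 1: "(\<lambda>m. (1 + of_real (t m * \<sigma>) * z) powr of_real e) \<longlonglongrightarrow> ?u powr of_real e"
      by (intro tendsto_powr_complex) auto
    have 2: "(\<lambda>m. cpoly (A m) z - (1 + of_real (t m * \<sigma>) * z) powr of_real e) \<longlonglongrightarrow> 0"
    proof (rule Lim_null_comparison)
      show "\<forall>\<^sub>F m in sequentially. norm (cpoly (A m) z - (1 + of_real (t m * \<sigma>) * z) powr of_real e) \<le> inverse (real (Suc m))"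
        using A(2)[of z] z by (intro always_eventually allI less_imp_le) (simp add: divide_inverse add.commute)
    qed (rule LIMSEQ_inverse_real_of_nat)
    show ?thesis using tendsto_add[OF 2 1] by simp
  qed
  moreover have "K \<ge> 0" by (simp add: K_def add_nonneg_nonneg)
  ultimately show ?thesis using A(1) by blast
qed

section \<open>Real polynomials with prescribed zeros on the circle\<close>

lemma real_poly_of_conjugate_product:
  fixes p :: "complex poly"
  shows "\<exists>r::real poly. \<forall>z. cpoly r z = poly p z * cnj (poly p (cnj z))"
proof -
  let ?s = "p * map_poly cnj p"
  have s: "poly ?s z = poly p z * cnj (poly p (cnj z))" for z by simp
  have "map_poly cnj ?s = ?s"
  \<comment> \<open>Both sides agree everywhere, so agreement at more integers than either degree
    certifies equality of the polynomials.\<close>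
  proof (rule poly_eqI_degree[of "of_real ` real ` {..<Suc (max (degree (map_poly cnj ?s)) (degree ?s))}"])
    show "poly (map_poly cnj ?s) x = poly ?s x" for x by simp
    show "card (complex_of_real ` real ` {..<Suc (max (degree (map_poly cnj ?s)) (degree ?s))}) > degree (map_poly cnj ?s)"
      "card (complex_of_real ` real ` {..<Suc (max (degree (map_poly cnj ?s)) (degree ?s))}) > degree ?s"
      by (auto simp: card_image inj_on_def)
  qed
  then have "coeff ?s n \<in> \<real>" for n
    by (metis coeff_map_poly complex_cnj_zero Reals_cnj_iff)
  then have "map_poly of_real (map_poly Re ?s) = ?s"
    by (intro poly_eqI) (simp add: coeff_map_poly of_real_Re)
  then show ?thesis using s by (intro exI[of _ "map_poly Re ?s"]) (simp add: cpoly_def)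
qed

text \<open>The geometric sum stays below 2 / |1 - w| while the divisor grows.\<close>

lemma geometric_mean_tendsto_zero:
  fixes w :: complex
  assumes "norm w = 1" "w \<noteq> 1"
  shows "(\<lambda>m. (\<Sum>j=1..Suc m. w ^ j) / of_nat (Suc m)) \<longlonglongrightarrow> 0"
proof (rule Lim_null_comparison)
  have "(\<lambda>m. 2 / norm (1 - w) * inverse (real (Suc m))) \<longlonglongrightarrow> 2 / norm (1 - w) * 0"
    by (intro tendsto_intros LIMSEQ_inverse_real_of_nat)
  then show "(\<lambda>m. 2 / norm (1 - w) * inverse (real (Suc m))) \<longlonglongrightarrow> 0" by simp
  have "norm ((\<Sum>j=1..Suc m. w ^ j) / of_nat (Suc m)) \<le> 2 / norm (1 - w) * inverse (real (Suc m))" for m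
  proof -
    have "(\<Sum>j=1..Suc m. w ^ j) = (w ^ 1 - w ^ Suc (Suc m)) / (1 - w)"
      using assms by (subst sum_gp) auto
    also have "norm \<dots> \<le> 2 / norm (1 - w)"
    proof -
      have "norm (w ^ 1 - w ^ Suc (Suc m)) \<le> norm (w ^ 1) + norm (w ^ Suc (Suc m))" by (rule norm_triangle_ineq4)
      also have "\<dots> = 2" using assms by (simp only: norm_power) simp
      finally show ?thesis by (simp add: norm_divide divide_right_mono)
    qed
    finally have "norm (\<Sum>j=1..Suc m. w ^ j) \<le> 2 / norm (1 - w)" .
    then have "norm (\<Sum>j=1..Suc m. w ^ j) * inverse (real (Suc m)) \<le> 2 / norm (1 - w) * inverse (real (Suc m))"
      by (rule mult_right_mono) simp
    then show ?thesis unfolding norm_divide norm_of_nat by (simp only: divide_inverse)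
  qed
  then show "\<forall>\<^sub>F m in sequentially. norm ((\<Sum>j=1..Suc m. w ^ j) / of_nat (Suc m)) \<le> 2 / norm (1 - w) * inverse (real (Suc m))"
    by simp
qed

text \<open>Subtracting from 1 the Cesaro mean of the powers of \<open>cis \<phi> * z\<close> produces a zero at
  \<open>cis (- \<phi>)\<close> at no asymptotic cost elsewhere on the circle; multiplying by the conjugate
  polynomial makes the coefficients real.\<close>

lemma node_annihilator:
  fixes \<phi> :: real
  shows "\<exists>H::nat \<Rightarrow> real poly. (\<forall>m. coeff (H m) 0 = 1) \<and>
    (\<forall>m z. norm z = 1 \<longrightarrow> norm (cpoly (H m) z) \<le> 4) \<and>
    (\<forall>z. norm z = 1 \<longrightarrow> Re z \<noteq> cos \<phi> \<longrightarrow> (\<lambda>m. cpoly (H m) z) \<longlonglongrightarrow> 1) \<and>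
    (\<forall>m. cpoly (H m) (cis (- \<phi>)) = 0)"
proof -
  \<comment> \<open>Starting the mean at exponent 1 leaves the constant coefficient equal to
    1.\<close>
  define p :: "nat \<Rightarrow> complex poly" where
    "p m = 1 - (\<Sum>j=1..Suc m. monom (cis \<phi> ^ j / of_nat (Suc m)) j)" for m
  have p: "poly (p m) z = 1 - (\<Sum>j=1..Suc m. (cis \<phi> * z) ^ j) / of_nat (Suc m)" for m z
    by (simp only: p_def poly_diff poly_1 poly_sum poly_monom power_mult_distrib sum_divide_distrib times_divide_eq_left)
  have "\<forall>m. \<exists>r::real poly. \<forall>z. cpoly r z = poly (p m) z * cnj (poly (p m) (cnj z))"
    using real_poly_of_conjugate_product by blast
  then obtain H where H: "\<And>m z. cpoly (H m) z = poly (p m) z * cnj (poly (p m) (cnj z))" by metis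
  have "coeff (H m) 0 = 1" for m
  proof -
    have "complex_of_real (coeff (H m) 0) = cpoly (H m) 0"
      by (simp add: cpoly_def poly_0_coeff_0 coeff_map_poly)
    also have "\<dots> = 1" unfolding H p by (simp add: power_0_left)
    finally show ?thesis by simp
  qed
  moreover have "norm (cpoly (H m) z) \<le> 4" if "norm z = 1" for m z
  proof -
    have *: "norm (poly (p m) z) \<le> 2" if "norm z = 1" for z
    proof -
      have "norm (\<Sum>j=1..Suc m. (cis \<phi> * z) ^ j) \<le> (\<Sum>j=1..Suc m. norm ((cis \<phi> * z) ^ j))" by (rule norm_sum)
      also have "\<dots> = real (Suc m)" using that by (simp add: norm_power norm_mult)
      finally have "norm (\<Sum>j=1..Suc m. (cis \<phi> * z) ^ j) / real (Suc m) \<le> 1"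
        by (subst pos_divide_le_eq) auto
      then have "norm ((\<Sum>j=1..Suc m. (cis \<phi> * z) ^ j) / of_nat (Suc m)) \<le> 1"
        by (simp only: norm_divide norm_of_nat)
      then show ?thesis unfolding p
        using norm_triangle_ineq4[of 1 "(\<Sum>j=1..Suc m. (cis \<phi> * z) ^ j) / of_nat (Suc m)"] by (simp only: norm_one)
    qed
    have "norm (cpoly (H m) z) = norm (poly (p m) z) * norm (poly (p m) (cnj z))"
      by (simp add: H norm_mult)
    also have "\<dots> \<le> 2 * 2" using that by (intro mult_mono *) auto
    finally show ?thesis by simp
  qed
  moreover have "(\<lambda>m. cpoly (H m) z) \<longlonglongrightarrow> 1" if z: "norm z = 1" "Re z \<noteq> cos \<phi>" for z
  proof -
    have *: "(\<lambda>m. poly (p m) z) \<longlonglongrightarrow> 1" if z: "norm z = 1" "Re z \<noteq> cos \<phi>" for z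
    proof -
      have "cis \<phi> * z \<noteq> 1"
      proof
        assume "cis \<phi> * z = 1"
        then have "cis (-\<phi>) * (cis \<phi> * z) = cis (-\<phi>)" by simp
        then have "z = cis (-\<phi>)" by (simp add: cis_mult flip: mult.assoc)
        then show False using z by simp
      qed
      then have "(\<lambda>m. 1 - (\<Sum>j=1..Suc m. (cis \<phi> * z) ^ j) / of_nat (Suc m)) \<longlonglongrightarrow> 1 - 0"
        using z by (intro tendsto_diff tendsto_const geometric_mean_tendsto_zero) (auto simp: norm_mult)
      then show ?thesis by (simp only: p diff_0_right)
    qed
    have "(\<lambda>m. poly (p m) z * cnj (poly (p m) (cnj z))) \<longlonglongrightarrow> 1 * cnj 1"
      using z by (intro tendsto_intros *) auto
    then show ?thesis by (simp add: H)
  qed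
  moreover have "cpoly (H m) (cis (- \<phi>)) = 0" for m
  proof -
    have "poly (p m) (cis (- \<phi>)) = 0"
      unfolding p by (simp add: cis_mult del: of_nat_Suc)
    then show ?thesis by (simp add: H)
  qed
  ultimately show ?thesis by blast
qed

text \<open>Multiply the annihilators of the single nodes. The exceptional set is described through
  the real part because real coefficients force a zero at \<open>cis \<phi>\<close> together with
  the one at \<open>cis (- \<phi>)\<close>.\<close>

lemma nodes_annihilator:
  fixes F :: "real set"
  assumes "finite F"
  shows "\<exists>(H::nat \<Rightarrow> real poly) K. K \<ge> 0 \<and> (\<forall>m. coeff (H m) 0 = 1) \<and>
    (\<forall>m z. norm z = 1 \<longrightarrow> norm (cpoly (H m) z) \<le> K) \<and>
    (\<forall>z. norm z = 1 \<longrightarrow> Re z \<notin> cos ` F \<longrightarrow> (\<lambda>m. cpoly (H m) z) \<longlonglongrightarrow> 1) \<and>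
    (\<forall>m. \<forall>\<phi>\<in>F. cpoly (H m) (cis (- \<phi>)) = 0)"
  using assms
proof (induction F rule: finite_induct)
  case empty
  then show ?case by (intro exI[of _ "\<lambda>_. 1"] exI[of _ 1]) auto
next
  case (insert \<phi> F)
  from insert.IH obtain H K where H: "K \<ge> 0" "\<And>m. coeff (H m) 0 = (1::real)"
    "\<And>m z. norm z = 1 \<Longrightarrow> norm (cpoly (H m) z) \<le> K"
    "\<And>z. norm z = 1 \<Longrightarrow> Re z \<notin> cos ` F \<Longrightarrow> (\<lambda>m. cpoly (H m) z) \<longlonglongrightarrow> 1"
    "\<And>m \<phi>. \<phi> \<in> F \<Longrightarrow> cpoly (H m) (cis (- \<phi>)) = 0" by metis
  from node_annihilator[of \<phi>] obtain G where G: "\<And>m. coeff (G m) 0 = (1::real)"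
    "\<And>m z. norm z = 1 \<Longrightarrow> norm (cpoly (G m) z) \<le> 4"
    "\<And>z. norm z = 1 \<Longrightarrow> Re z \<noteq> cos \<phi> \<Longrightarrow> (\<lambda>m. cpoly (G m) z) \<longlonglongrightarrow> 1"
    "\<And>m. cpoly (G m) (cis (- \<phi>)) = 0" by metis
  have "(\<lambda>m. cpoly (H m * G m) z) \<longlonglongrightarrow> 1" if "norm z = 1" "Re z \<notin> cos ` insert \<phi> F" for z
    using tendsto_mult[OF H(4) G(3), of z] that by (simp add: cpoly_mult)
  moreover have "norm (cpoly (H m * G m) z) \<le> K * 4" if "norm z = 1" for z m
    unfolding cpoly_mult norm_mult using that H(1) by (intro mult_mono H G) auto
  ultimately show ?case using H G
    by (intro exI[of _ "\<lambda>m. H m * G m"] exI[of _ "K * 4"]) (auto simp: cpoly_mult coeff_mult)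
qed

section \<open>The Szego function on the unit circle\<close>

definition szego :: "real \<Rightarrow> real \<Rightarrow> complex \<Rightarrow> complex" where
  "szego a b z = (1 - z) powr of_real a * (1 + z) powr of_real b"

text \<open>The argument of \<open>szego a b (cis t)\<close> for 0 < t < pi: by half-angle formulas
  1 - cis t has argument (t - pi)/2 and 1 + cis t has argument t/2. The squared modulus is 2^(a+b)
  times \<open>arc_weight a b t\<close>.\<close>

definition szego_phase :: "real \<Rightarrow> real \<Rightarrow> real \<Rightarrow> real" where
  "szego_phase a b t = (a + b) / 2 * t - a * pi / 2"

lemma one_minus_cis: "1 - cis t = rcis (2 * sin (t / 2)) ((t - pi) / 2)"
proof -
  have h: "t = 2 * (t / 2)" by simp
  have "1 - cos t = 2 * sin (t/2) * sin (t/2)"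
    by (subst h, subst cos_double_sin) (simp add: power2_eq_square)
  moreover have "cos ((t - pi) / 2) = sin (t / 2)"
    by (simp add: diff_divide_distrib cos_diff)
  moreover have "sin ((t - pi) / 2) = - cos (t / 2)"
    by (simp add: diff_divide_distrib sin_diff)
  moreover have "sin t = 2 * sin (t/2) * cos (t/2)"
    by (subst h, subst sin_double) simp
  ultimately show ?thesis by (simp add: complex_eq_iff)
qed

lemma one_plus_cis: "1 + cis t = rcis (2 * cos (t / 2)) (t / 2)"
proof -
  have h: "t = 2 * (t / 2)" by simp
  have "1 + cos t = 2 * cos (t/2) * cos (t/2)"
    by (subst h, subst cos_double_cos) (simp add: power2_eq_square)
  moreover have "sin t = 2 * cos (t/2) * sin (t/2)"
    by (subst h, subst sin_double) simp
  ultimately show ?thesis by (simp add: complex_eq_iff)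
qed

lemma rcis_powr_of_real:
  assumes "r > 0" "- pi < x" "x \<le> pi"
  shows "rcis r x powr of_real e = rcis (r powr e) (e * x)"
proof -
  have "rcis r x \<noteq> 0" using assms by (simp add: rcis_def)
  then have "rcis r x powr of_real e = exp (of_real e * Complex (ln r) x)"
    using assms by (simp add: powr_def Ln_rcis)
  also have "\<dots> = rcis (r powr e) (e * x)"
    using assms by (simp add: complex_eq_iff Re_exp Im_exp powr_def)
  finally show ?thesis .
qed

lemma norm_one_minus_cis_power2: "(norm (1 - cis t))\<^sup>2 = 2 * (1 - cos t)"
  by (simp add: cmod_power2 power2_diff)

lemma norm_one_plus_cis_power2: "(norm (1 + cis t))\<^sup>2 = 2 * (1 + cos t)"
  by (simp add: cmod_power2 power2_sum)

lemma norm_powr_of_square: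
  assumes "(norm (w::complex))\<^sup>2 = s" "w \<noteq> 0" shows "(norm w powr e)\<^sup>2 = s powr e"
proof -
  have "(norm w powr e)\<^sup>2 = norm w powr (2 * e)"
    by (simp add: power2_eq_square flip: powr_add)
  also have "\<dots> = (norm w powr 2) powr e" by (simp only: powr_powr)
  also have "norm w powr 2 = s" using assms by simp
  finally show ?thesis .
qed

lemma cis_arc_ne: assumes "t \<in> {0<..<pi}" shows "1 - cis t \<noteq> 0" "1 + cis t \<noteq> 0" "1 - cis (-t) \<noteq> 0" "1 + cis (-t) \<noteq> 0"
  using cos_arc[OF assms] by (auto simp: complex_eq_iff)

lemma norm_szego_cis:
  assumes "t \<in> {0<..<pi}"
  shows "norm (szego a b (cis t)) = 2 powr ((a + b) / 2) * sqrt (arc_weight a b t)"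
proof -
  have "(norm (szego a b (cis t)))\<^sup>2 = (2 * (1 - cos t)) powr a * (2 * (1 + cos t)) powr b"
    by (simp add: szego_def norm_mult norm_powr_of_real power_mult_distrib
      norm_powr_of_square[OF norm_one_minus_cis_power2 cis_arc_ne(1)[OF assms]]
      norm_powr_of_square[OF norm_one_plus_cis_power2 cis_arc_ne(2)[OF assms]])
  also have "\<dots> = 2 powr (a + b) * arc_weight a b t"
    using cos_arc[OF assms] by (simp only: powr_mult arc_weight_def powr_add mult_ac)
  finally have "norm (szego a b (cis t)) = sqrt (2 powr (a + b) * arc_weight a b t)"
    by (metis norm_ge_zero real_sqrt_unique)
  also have "\<dots> = 2 powr ((a + b) / 2) * sqrt (arc_weight a b t)"
    by (simp add: real_sqrt_mult powr_half_sqrt[symmetric] powr_powr)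
  finally show ?thesis .
qed

lemma szego_cis:
  assumes "t \<in> {0<..<pi}"
  shows "szego a b (cis t) = rcis (2 powr ((a + b) / 2) * sqrt (arc_weight a b t)) (szego_phase a b t)"
proof -
  have s: "0 < 2 * sin (t/2)" "0 < 2 * cos (t/2)"
    using assms by (auto intro!: sin_gt_zero cos_gt_zero)
  have "szego a b (cis t) = rcis ((2 * sin (t/2)) powr a) (a * ((t - pi) / 2)) * rcis ((2 * cos (t/2)) powr b) (b * (t / 2))"
    unfolding szego_def one_minus_cis one_plus_cis
    using s assms by (subst (1 2) rcis_powr_of_real) auto
  also have "\<dots> = rcis ((2 * sin (t/2)) powr a * (2 * cos (t/2)) powr b) (szego_phase a b t)"
    unfolding rcis_mult szego_phase_def
    by (rule arg_cong2[of _ _ _ _ rcis]) (simp_all add: algebra_simps add_divide_distrib diff_divide_distrib)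
  finally have *: "szego a b (cis t) = rcis ((2 * sin (t/2)) powr a * (2 * cos (t/2)) powr b) (szego_phase a b t)" .
  then have "norm (szego a b (cis t)) = (2 * sin (t/2)) powr a * (2 * cos (t/2)) powr b"
    by (simp add: abs_mult)
  then have "(2 * sin (t/2)) powr a * (2 * cos (t/2)) powr b = 2 powr ((a + b) / 2) * sqrt (arc_weight a b t)"
    using norm_szego_cis[OF assms, of a b] by simp
  then show ?thesis using * by (simp only:)
qed

text \<open>Both factors have constant coefficient 1, hence so has the product. The exponents are
  arbitrary reals because the Szego function and its reciprocal are both approximated this
  way.\<close>

lemma szego_polynomial_sequence:
  "\<exists>(q::nat \<Rightarrow> real poly) K. K \<ge> 0 \<and> (\<forall>m. coeff (q m) 0 = 1) \<and>
    (\<forall>m z. norm z = 1 \<longrightarrow> 1 - z \<noteq> 0 \<longrightarrow> 1 + z \<noteq> 0 \<longrightarrow>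
      norm (cpoly (q m) z) \<le> K * ((1 + norm (1 - z) powr a) * (1 + norm (1 + z) powr b))) \<and>
    (\<forall>z. norm z = 1 \<longrightarrow> 1 - z \<noteq> 0 \<longrightarrow> 1 + z \<noteq> 0 \<longrightarrow> (\<lambda>m. cpoly (q m) z) \<longlonglongrightarrow> szego a b z)"
proof -
  obtain A K where A: "K \<ge> 0" "\<And>m. coeff (A m) 0 = (1::real)"
    "\<And>m z. norm z = 1 \<Longrightarrow> 1 - z \<noteq> 0 \<Longrightarrow> norm (cpoly (A m) z) \<le> K * (1 + norm (1 - z) powr a)"
    "\<And>z. norm z = 1 \<Longrightarrow> 1 - z \<noteq> 0 \<Longrightarrow> (\<lambda>m. cpoly (A m) z) \<longlonglongrightarrow> (1 - z) powr of_real a"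
    using binomial_polynomial_sequence[of "-1" a] by auto
  obtain B L where B: "L \<ge> 0" "\<And>m. coeff (B m) 0 = (1::real)"
    "\<And>m z. norm z = 1 \<Longrightarrow> 1 + z \<noteq> 0 \<Longrightarrow> norm (cpoly (B m) z) \<le> L * (1 + norm (1 + z) powr b)"
    "\<And>z. norm z = 1 \<Longrightarrow> 1 + z \<noteq> 0 \<Longrightarrow> (\<lambda>m. cpoly (B m) z) \<longlonglongrightarrow> (1 + z) powr of_real b"
    using binomial_polynomial_sequence[of 1 b] by auto
  have "norm (cpoly (A m * B m) z) \<le> K * L * ((1 + norm (1 - z) powr a) * (1 + norm (1 + z) powr b))"
    if "norm z = 1" "1 - z \<noteq> 0" "1 + z \<noteq> 0" for m z
  proof -
    have "norm (cpoly (A m * B m) z) \<le> (K * (1 + norm (1 - z) powr a)) * (L * (1 + norm (1 + z) powr b))"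
      unfolding cpoly_mult norm_mult using that A(1) by (intro mult_mono A(3) B(3)) (auto simp: add_nonneg_nonneg)
    then show ?thesis by (simp only: mult_ac)
  qed
  moreover have "(\<lambda>m. cpoly (A m * B m) z) \<longlonglongrightarrow> szego a b z" if "norm z = 1" "1 - z \<noteq> 0" "1 + z \<noteq> 0" for z
    unfolding cpoly_mult szego_def using that by (intro tendsto_mult A B) auto
  ultimately show ?thesis using A(1,2) B(1,2)
    by (intro exI[of _ "\<lambda>m. A m * B m"] exI[of _ "K * L"]) (auto simp: coeff_mult)
qed

lemma one_minus_cis_powr_le: "a \<ge> 0 \<Longrightarrow> norm (1 - cis t) powr a \<le> 2 powr a"
  using norm_triangle_ineq4[of 1 "cis t"] by (intro powr_mono2) auto

text \<open>Approximants of 1 / D, the Szego function with exponents -a and -b, times the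
  annihilator of F. Multiplying by |D| tames the bound for negative powers: as a \<ge> 0, |1 - z|^a
  is bounded on the circle, and only |1 + z|^b, which may be unbounded for negative b,
  remains.\<close>

lemma inverse_szego_polynomial_sequence:
  assumes "a \<ge> 0" "finite F"
  shows "\<exists>(q::nat \<Rightarrow> real poly) K. K \<ge> 0 \<and> (\<forall>m. coeff (q m) 0 = 1) \<and>
    (\<forall>m. \<forall>\<phi>\<in>F. cpoly (q m) (cis (- \<phi>)) = 0) \<and>
    (\<forall>m. \<forall>t\<in>{0<..<pi}. norm (cpoly (q m) (cis (-t))) * norm (szego a b (cis (-t))) \<le> K * (1 + norm (1 + cis (-t)) powr b)) \<and>
    (\<forall>t\<in>{0<..<pi}. cos t \<notin> cos ` F \<longrightarrow> (\<lambda>m. norm (cpoly (q m) (cis (-t))) * norm (szego a b (cis (-t)))) \<longlonglongrightarrow> 1)"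
proof -
  obtain A K where A: "K \<ge> 0" "\<And>m. coeff (A m) 0 = (1::real)"
    "\<And>m z. norm z = 1 \<Longrightarrow> 1 - z \<noteq> 0 \<Longrightarrow> 1 + z \<noteq> 0 \<Longrightarrow>
      norm (cpoly (A m) z) \<le> K * ((1 + norm (1 - z) powr (-a)) * (1 + norm (1 + z) powr (-b)))"
    "\<And>z. norm z = 1 \<Longrightarrow> 1 - z \<noteq> 0 \<Longrightarrow> 1 + z \<noteq> 0 \<Longrightarrow> (\<lambda>m. cpoly (A m) z) \<longlonglongrightarrow> szego (-a) (-b) z"
    using szego_polynomial_sequence[of "-a" "-b"] by auto
  from nodes_annihilator[OF assms(2)] obtain H J where H: "J \<ge> 0" "\<And>m. coeff (H m) 0 = (1::real)"
    "\<And>m z. norm z = 1 \<Longrightarrow> norm (cpoly (H m) z) \<le> J"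
    "\<And>z. norm z = 1 \<Longrightarrow> Re z \<notin> cos ` F \<Longrightarrow> (\<lambda>m. cpoly (H m) z) \<longlonglongrightarrow> 1"
    "\<And>m \<phi>. \<phi> \<in> F \<Longrightarrow> cpoly (H m) (cis (- \<phi>)) = 0" by metis
  define q where "q m = A m * H m" for m
  have "norm (cpoly (q m) (cis (-t))) * norm (szego a b (cis (-t)))
      \<le> K * (1 + 2 powr a) * J * (1 + norm (1 + cis (-t)) powr b)"
    if t: "t \<in> {0<..<pi}" for m t
  proof -
    let ?z = "cis (-t)"
    let ?x = "norm (1 - ?z) powr a" and ?y = "norm (1 + ?z) powr b"
    note ne = cis_arc_ne(3,4)[OF t]
    have xy: "?x > 0" "?y > 0" "?x \<le> 2 powr a" using ne one_minus_cis_powr_le[OF assms(1)] by auto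
    have "norm (cpoly (A m) ?z) * (?x * ?y) \<le> K * ((1 + norm (1 - ?z) powr (-a)) * (1 + norm (1 + ?z) powr (-b))) * (?x * ?y)"
      using A(3)[of ?z m] ne by (intro mult_right_mono) auto
    also have "\<dots> = K * (1 + ?x) * (1 + ?y)"
      using xy by (simp add: powr_minus field_simps)
    also have "\<dots> \<le> K * (1 + 2 powr a) * (1 + ?y)"
      using xy A(1) by (intro mult_right_mono mult_left_mono) auto
    finally have le: "norm (cpoly (A m) ?z) * (?x * ?y) \<le> K * (1 + 2 powr a) * (1 + ?y)" .
    have "norm (cpoly (q m) ?z) * norm (szego a b ?z) = norm (cpoly (A m) ?z) * (?x * ?y) * norm (cpoly (H m) ?z)"
      by (simp add: q_def cpoly_mult norm_mult szego_def norm_powr_of_real mult_ac)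
    also have "\<dots> \<le> K * (1 + 2 powr a) * (1 + ?y) * J"
      using A(1) xy by (intro mult_mono le H) (auto simp: add_nonneg_nonneg)
    finally show ?thesis by (simp only: mult_ac)
  qed
  moreover have "(\<lambda>m. norm (cpoly (q m) (cis (-t))) * norm (szego a b (cis (-t)))) \<longlonglongrightarrow> 1"
    if t: "t \<in> {0<..<pi}" "cos t \<notin> cos ` F" for t
  proof -
    let ?z = "cis (-t)"
    note ne = cis_arc_ne(3,4)[OF t(1)]
    have "(\<lambda>m. cpoly (q m) ?z) \<longlonglongrightarrow> szego (-a) (-b) ?z * 1"
      unfolding q_def cpoly_mult using ne t(2) by (intro tendsto_mult A H) auto
    from tendsto_mult[OF tendsto_norm[OF this] tendsto_const[of "norm (szego a b ?z)"]]
    have "(\<lambda>m. norm (cpoly (q m) ?z) * norm (szego a b ?z)) \<longlonglongrightarrow> norm (szego (-a) (-b) ?z * 1) * norm (szego a b ?z)" .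
    also have "norm (szego (-a) (-b) ?z * 1) * norm (szego a b ?z) = 1"
      unfolding szego_def norm_mult norm_powr_of_real using ne by (simp add: powr_minus field_simps)
    finally show ?thesis .
  qed
  moreover have "coeff (q m) 0 = 1" for m using A H by (simp add: q_def coeff_mult)
  moreover have "cpoly (q m) (cis (- \<phi>)) = 0" if "\<phi> \<in> F" for m \<phi> using H(5)[OF that] by (simp add: q_def cpoly_mult)
  moreover have "K * (1 + 2 powr a) * J \<ge> 0" using A(1) H(1) by (auto simp: add_nonneg_nonneg)
  ultimately show ?thesis by blast
qed

section \<open>Integrals against the boundary values of the Szego function\<close>

lemma cis_measurable [measurable]: "cis \<in> borel_measurable borel"
  by (intro borel_measurable_continuous_onI continuous_intros)

lemma szego_phase_measurable [measurable]: "szego_phase a b \<in> borel_measurable borel"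
  unfolding szego_phase_def by measurable

lemma norm_one_plus_cis_minus: "norm (1 + cis (-t)) = norm (1 + cis t)"
proof -
  have "1 + cis (-t) = cnj (1 + cis t)" by (simp add: complex_eq_iff)
  then show ?thesis by (metis complex_mod_cnj)
qed

lemma norm_one_minus_cis_minus: "norm (1 - cis (-t)) = norm (1 - cis t)"
proof -
  have "1 - cis (-t) = cnj (1 - cis t)" by (simp add: complex_eq_iff)
  then show ?thesis by (metis complex_mod_cnj)
qed

lemma norm_szego_cis_minus:
  "norm (szego a b (cis (-t))) = norm (szego a b (cis t))"
  by (simp add: szego_def norm_mult norm_powr_of_real norm_one_plus_cis_minus norm_one_minus_cis_minus)

text \<open>The question is the integrability of (1 + cos t)^b. Where cos t \<ge> 0 it is bounded;
  where cos t < 0 the factor (1 - cos t)^a is at least 1, so the weight itself dominates.\<close>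

lemma integrable_envelope:
  assumes a: "a > 0" and w: "integrable arcm (arc_weight a b)"
  shows "integrable arcm (\<lambda>t. (1 + norm (1 + cis t) powr b)\<^sup>2)"
proof (rule Bochner_Integration.integrable_bound)
  show "integrable arcm (\<lambda>t. 2 + 2 * 2 powr b * (2 powr \<bar>b\<bar> + arc_weight a b t))"
    using w by auto
  show "(\<lambda>t. (1 + norm (1 + cis t) powr b)\<^sup>2) \<in> borel_measurable arcm" by measurable
  have "(1 + norm (1 + cis t) powr b)\<^sup>2 \<le> 2 + 2 * 2 powr b * (2 powr \<bar>b\<bar> + arc_weight a b t)"
    if t: "t \<in> {0<..<pi}" for t
  proof -
    have sq: "(norm (1 + cis t) powr b)\<^sup>2 = 2 powr b * (1 + cos t) powr b"
      using cos_arc[OF t] norm_powr_of_square[OF norm_one_plus_cis_power2 cis_arc_ne(2)[OF t], of b]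
      by (simp only: powr_mult)
    have "(1 + cos t) powr b \<le> 2 powr \<bar>b\<bar> + arc_weight a b t"
    proof (cases "cos t \<ge> 0")
      case True
      have "(1 + cos t) powr b \<le> (1 + cos t) powr \<bar>b\<bar>" using True by (intro powr_mono) auto
      also have "\<dots> \<le> 2 powr \<bar>b\<bar>" using True cos_arc[OF t] by (intro powr_mono2) auto
      finally show ?thesis using arc_weight_nonneg[of a b t] by linarith
    next
      case False
      then have "1 \<le> (1 - cos t) powr a" using a by (intro ge_one_powr_ge_zero) auto
      then have "1 * (1 + cos t) powr b \<le> arc_weight a b t"
        unfolding arc_weight_def by (intro mult_right_mono) auto
      then show ?thesis by (simp add: add_increasing)
    qed
    then have "(norm (1 + cis t) powr b)\<^sup>2 \<le> 2 powr b * (2 powr \<bar>b\<bar> + arc_weight a b t)"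
      unfolding sq by (intro mult_left_mono) auto
    moreover have "(1 + norm (1 + cis t) powr b)\<^sup>2 \<le> 2 + 2 * (norm (1 + cis t) powr b)\<^sup>2"
      using sum_squares_bound[of 1 "norm (1 + cis t) powr b"] by (simp add: power2_sum)
    ultimately show ?thesis by (simp add: algebra_simps)
  qed
  then show "AE t in arcm. norm ((1 + norm (1 + cis t) powr b)\<^sup>2) \<le> norm (2 + 2 * 2 powr b * (2 powr \<bar>b\<bar> + arc_weight a b t))"
    by (intro AE_I2) (auto intro: order_trans[OF _ abs_ge_self])
qed

lemma Re_cpoly_cis:
  "Re (cpoly q (cis t) * cis (real m * t)) = (\<Sum>j\<le>degree q. coeff q j * cos (real (j + m) * t))"
proof -
  have "cpoly q (cis t) * cis (real m * t) = (\<Sum>j\<le>degree q. of_real (coeff q j) * cis (real (j + m) * t))"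
    by (simp only: cpoly_altdef sum_distrib_right Complex.DeMoivre mult.assoc cis_mult distrib_right of_nat_add)
  then show ?thesis by simp
qed

lemma Re_cpoly_cis_minus:
  "Re (cis (real n * t) * cpoly q (cis (-t))) = (\<Sum>j\<le>degree q. coeff q j * cos ((real n - real j) * t))"
proof -
  have "cis (real n * t) * cpoly q (cis (-t)) = (\<Sum>j\<le>degree q. of_real (coeff q j) * cis ((real n - real j) * t))"
    unfolding cpoly_altdef sum_distrib_left
  proof (intro sum.cong refl)
    fix j
    have "cis (real n * t) * cis (- t) ^ j = cis ((real n - real j) * t)"
      by (simp only: Complex.DeMoivre cis_mult) (simp add: algebra_simps)
    then show "cis (real n * t) * (of_real (coeff q j) * cis (- t) ^ j) = of_real (coeff q j) * cis ((real n - real j) * t)"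
      by (simp only: mult.left_commute)
  qed
  then show ?thesis by simp
qed

text \<open>The mean value property of the Szego function (times \<open>z ^ m\<close>) on the unit circle, obtained
  from polynomials approximating it with a common integrable majorant.\<close>

lemma integral_szego_phase:
  assumes a: "a > 0" and w: "integrable arcm (arc_weight a b)"
  shows "(LINT t|arcm. sqrt (arc_weight a b t) * cos (real m * t + szego_phase a b t))
     = (if m = 0 then pi / 2 powr ((a + b) / 2) else 0)"
proof -
  obtain q K0 where K0: "K0 \<ge> 0" and q: "\<And>k. coeff (q k) 0 = (1::real)"
    "\<And>k z. norm z = 1 \<Longrightarrow> 1 - z \<noteq> 0 \<Longrightarrow> 1 + z \<noteq> 0 \<Longrightarrow>
      norm (cpoly (q k) z) \<le> K0 * ((1 + norm (1 - z) powr a) * (1 + norm (1 + z) powr b))"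
    "\<And>z. norm z = 1 \<Longrightarrow> 1 - z \<noteq> 0 \<Longrightarrow> 1 + z \<noteq> 0 \<Longrightarrow> (\<lambda>k. cpoly (q k) z) \<longlonglongrightarrow> szego a b z"
    using szego_polynomial_sequence[of a b] by auto
  define K where "K = K0 * (1 + 2 powr a)"
  have K: "K \<ge> 0" using K0 by (simp add: K_def add_nonneg_nonneg)
  have qK: "norm (cpoly (q k) (cis t)) \<le> K * (1 + norm (1 + cis t) powr b)" if t: "t \<in> {0<..<pi}" for k t
  proof -
    have "K0 * ((1 + norm (1 - cis t) powr a) * (1 + norm (1 + cis t) powr b)) \<le> K0 * ((1 + 2 powr a) * (1 + norm (1 + cis t) powr b))"
      using K0 a one_minus_cis_powr_le[of a t] by (intro mult_left_mono mult_right_mono) auto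
    then show ?thesis using q(2)[of "cis t" k] cis_arc_ne[OF t] by (simp add: K_def mult.assoc)
  qed
  define c where "c = 2 powr ((a + b) / 2)"
  have c: "c > 0" by (simp add: c_def)
  have ic: "integrable arcm (\<lambda>t. cos (real j * t))" for j
    by (rule integrable_arc_bounded[where B=1]) auto
  have cm [measurable]: "(\<lambda>t. Re (cpoly (q k) (cis t) * cis (real m * t))) \<in> borel_measurable borel" for k
    unfolding Re_cpoly_cis by measurable
  \<comment> \<open>Integrated term by term, only frequency 0 survives: it carries the constant
    coefficient 1 if m = 0 and is absent if m > 0.\<close>
  have I: "(LINT t|arcm. Re (cpoly (q k) (cis t) * cis (real m * t))) = (if m = 0 then pi else 0)" for k
  proof -
    have "(LINT t|arcm. Re (cpoly (q k) (cis t) * cis (real m * t)))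
        = (\<Sum>j\<le>degree (q k). coeff (q k) j * (LINT t|arcm. cos (real (j + m) * t)))"
      unfolding Re_cpoly_cis using ic by (subst Bochner_Integration.integral_sum) (auto simp del: of_nat_add)
    also have "\<dots> = (\<Sum>j\<le>degree (q k). if j = 0 then (if m = 0 then pi else 0) else 0)"
      unfolding integral_arc_cos using q(1) by (intro sum.cong) auto
    finally show ?thesis by simp
  qed
  have "(\<lambda>k. LINT t|arcm. Re (cpoly (q k) (cis t) * cis (real m * t)))
     \<longlonglongrightarrow> (LINT t|arcm. c * (sqrt (arc_weight a b t) * cos (real m * t + szego_phase a b t)))"
  proof (rule integral_dominated_convergence[where w="\<lambda>t. K * (1 + norm (1 + cis t) powr b)\<^sup>2"])
    show "integrable arcm (\<lambda>t. K * (1 + norm (1 + cis t) powr b)\<^sup>2)"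
      using integrable_envelope[OF a w] by simp
    show "AE t in arcm. (\<lambda>k. Re (cpoly (q k) (cis t) * cis (real m * t)))
       \<longlonglongrightarrow> c * (sqrt (arc_weight a b t) * cos (real m * t + szego_phase a b t))"
    proof (rule AE_I2)
      fix t assume "t \<in> space arcm"
      then have t: "t \<in> {0<..<pi}" by simp
      have "(\<lambda>k. Re (cpoly (q k) (cis t) * cis (real m * t))) \<longlonglongrightarrow> Re (szego a b (cis t) * cis (real m * t))"
        using cis_arc_ne[OF t] by (intro tendsto_intros q(3)) auto
      also have "szego a b (cis t) * cis (real m * t)
          = rcis (c * sqrt (arc_weight a b t)) (real m * t + szego_phase a b t)"
        unfolding szego_cis[OF t] c_def by (simp add: rcis_def cis_mult mult.assoc add.commute)
      finally show "(\<lambda>k. Re (cpoly (q k) (cis t) * cis (real m * t)))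
       \<longlonglongrightarrow> c * (sqrt (arc_weight a b t) * cos (real m * t + szego_phase a b t))" by (simp add: mult.assoc)
    qed
    show "AE t in arcm. norm (Re (cpoly (q k) (cis t) * cis (real m * t))) \<le> K * (1 + norm (1 + cis t) powr b)\<^sup>2" for k
    proof (rule AE_I2)
      fix t assume "t \<in> space arcm"
      then have t: "t \<in> {0<..<pi}" by simp
      let ?y = "1 + norm (1 + cis t) powr b"
      have "\<bar>Re (cpoly (q k) (cis t) * cis (real m * t))\<bar> \<le> norm (cpoly (q k) (cis t) * cis (real m * t))"
        by (rule abs_Re_le_cmod)
      also have "\<dots> = norm (cpoly (q k) (cis t))" by (simp add: norm_mult)
      also have "\<dots> \<le> K * ?y" by (rule qK[OF t])
      \<comment> \<open>The envelope is at least 1, so it is dominated by its square, whose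
        integrability is known.\<close>
      also have "\<dots> \<le> K * ?y\<^sup>2" using K self_le_power[of ?y 2] by (intro mult_left_mono) auto
      finally show "norm (Re (cpoly (q k) (cis t) * cis (real m * t))) \<le> K * ?y\<^sup>2" by simp
    qed
    show "(\<lambda>t. Re (cpoly (q k) (cis t) * cis (real m * t))) \<in> borel_measurable arcm" for k
      by (rule borel_measurable_arc[OF cm])
  qed measurable
  then have "(LINT t|arcm. c * (sqrt (arc_weight a b t) * cos (real m * t + szego_phase a b t))) = (if m = 0 then pi else 0)"
    unfolding I by (simp add: LIMSEQ_const_iff)
  then show ?thesis using c by (simp add: c_def[symmetric] field_simps split: if_splits)
qed

lemma integrable_sqrt_arc_weight:
  assumes w: "integrable arcm (arc_weight a b)" and [measurable]: "f \<in> borel_measurable borel" and f: "\<And>t. \<bar>f t\<bar> \<le> B"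
  shows "integrable arcm (\<lambda>t. f t * sqrt (arc_weight a b t))"
proof (rule Bochner_Integration.integrable_bound)
  show "integrable arcm (\<lambda>t. B * (1 + arc_weight a b t))" using w by auto
  have "B \<ge> 0" using f[of 0] by linarith
  have "sqrt y \<le> 1 + y" if "y \<ge> 0" for y
  proof -
    have "sqrt y \<le> sqrt ((1 + y)\<^sup>2)" using that by (intro real_sqrt_le_mono) (auto simp: power2_sum)
    then show ?thesis using that by simp
  qed
  then have "\<bar>f t\<bar> * sqrt (arc_weight a b t) \<le> B * (1 + arc_weight a b t)" for t
    using f[of t] \<open>B \<ge> 0\<close> arc_weight_nonneg[of a b t] by (intro mult_mono) auto
  then show "AE t in arcm. norm (f t * sqrt (arc_weight a b t)) \<le> norm (B * (1 + arc_weight a b t))"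
    using \<open>B \<ge> 0\<close> by (intro AE_I2) (simp add: abs_mult arc_weight_nonneg)
qed measurable

text \<open>Each factor cos t shifts the frequency by +1 or -1 with weight 1/2. As m \<ge> k,
  frequency 0 is reached only if m = k and all k shifts go down, which gives 2^(-k); all other
  frequencies stay positive and integrate to 0.\<close>

lemma integral_cos_power_szego:
  assumes a: "a > 0" and w: "integrable arcm (arc_weight a b)" and "k \<le> m"
  defines "\<phi> \<equiv> szego_phase a b" and "\<omega> \<equiv> \<lambda>t. sqrt (arc_weight a b t)" and "J \<equiv> pi / 2 powr ((a + b) / 2)"
  shows "(LINT t|arcm. cos t ^ k * cos (real m * t + \<phi> t) * \<omega> t)
     = (if m = k then J / 2 ^ k else 0)"
  using \<open>k \<le> m\<close>
proof (induction k arbitrary: m)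
  case 0
  then show ?case using integral_szego_phase[OF a w, of m] by (simp add: mult_ac \<phi>_def \<omega>_def J_def)
next
  case (Suc k)
  then obtain l where m: "m = Suc l" "k \<le> l" by (cases m) auto
  have i: "integrable arcm (\<lambda>t. cos t ^ k * cos (real j * t + \<phi> t) * \<omega> t)" for j
    unfolding \<phi>_def \<omega>_def by (rule integrable_sqrt_arc_weight[OF w, where B=1])
       (auto simp: abs_mult power_abs intro!: mult_le_one power_le_one)
  have *: "cos t ^ Suc k * cos (real m * t + \<phi> t) =
     (cos t ^ k * cos (real (Suc m) * t + \<phi> t) + cos t ^ k * cos (real l * t + \<phi> t)) / 2" for t
  proof -
    have "cos t * cos (real m * t + \<phi> t) = (cos (real l * t + \<phi> t) + cos (real (Suc m) * t + \<phi> t)) / 2"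
      unfolding cos_times_cos by (subst cos_minus[symmetric]) (simp add: m algebra_simps)
    then show ?thesis
      by (simp only: power_Suc2 mult.assoc) (simp only: distrib_left times_divide_eq_right add.commute)
  qed
  have "(LINT t|arcm. cos t ^ Suc k * cos (real m * t + \<phi> t) * \<omega> t)
    = (LINT t|arcm. (1/2) * (cos t ^ k * cos (real (Suc m) * t + \<phi> t) * \<omega> t)
         + (1/2) * (cos t ^ k * cos (real l * t + \<phi> t) * \<omega> t))"
    unfolding * by (intro Bochner_Integration.integral_cong) (auto simp: algebra_simps add_divide_distrib)
  also have "\<dots> = (1/2) * (if Suc m = k then J / 2 ^ k else 0)
       + (1/2) * (if l = k then J / 2 ^ k else 0)"
    using i[of "Suc m"] i[of l] m Suc.IH[of "Suc m"] Suc.IH[of l]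
    by (subst Bochner_Integration.integral_add) (auto simp del: of_nat_Suc)
  also have "\<dots> = (if m = Suc k then J / 2 ^ Suc k else 0)"
    using m by auto
  finally show ?case .
qed

text \<open>Against the oscillation of frequency n all powers of cos t below n vanish, so the
  integral reads off the top coefficient. This is how the inner product of \<open>u n\<close> and
  \<open>v n\<close> comes to contain the leading coefficient of \<open>P n\<close>.\<close>

lemma integral_poly_szego:
  assumes a: "a > 0" and w: "integrable arcm (arc_weight a b)" and p: "degree p \<le> n"
  defines "\<phi> \<equiv> szego_phase a b" and "\<omega> \<equiv> \<lambda>t. sqrt (arc_weight a b t)" and "J \<equiv> pi / 2 powr ((a + b) / 2)"
  shows "(LINT t|arcm. poly p (cos t) * cos (real n * t + \<phi> t) * \<omega> t)
     = coeff p n / 2 ^ n * (J)"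
proof -
  have i: "integrable arcm (\<lambda>t. cos t ^ k * cos (real n * t + \<phi> t) * \<omega> t)" for k
    unfolding \<phi>_def \<omega>_def by (rule integrable_sqrt_arc_weight[OF w, where B=1])
       (auto simp: abs_mult power_abs intro!: mult_le_one power_le_one)
  have "(LINT t|arcm. poly p (cos t) * cos (real n * t + \<phi> t) * \<omega> t)
    = (LINT t|arcm. (\<Sum>k\<le>n. coeff p k * (cos t ^ k * cos (real n * t + \<phi> t) * \<omega> t)))"
  proof (intro Bochner_Integration.integral_cong refl)
    fix t
    have "poly p (cos t) = (\<Sum>k\<le>n. coeff p k * cos t ^ k)"
      using p arg_cong[OF poly_as_sum_of_monoms'[OF p], of "\<lambda>p. poly p (cos t)"]
      by (simp add: poly_sum poly_monom)
    then show "poly p (cos t) * cos (real n * t + \<phi> t) * \<omega> t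
       = (\<Sum>k\<le>n. coeff p k * (cos t ^ k * cos (real n * t + \<phi> t) * \<omega> t))"
      by (simp add: sum_distrib_right mult.assoc)
  qed
  also have "\<dots> = (\<Sum>k\<le>n. coeff p k * (LINT t|arcm. cos t ^ k * cos (real n * t + \<phi> t) * \<omega> t))"
    using i by (subst Bochner_Integration.integral_sum) auto
  also have "\<dots> = (\<Sum>k\<le>n. if k = n then coeff p n * (J / 2 ^ n) else 0)"
    using integral_cos_power_szego[OF a w] unfolding \<phi>_def \<omega>_def J_def by (intro sum.cong) auto
  finally show ?thesis by simp
qed

section \<open>Monic polynomials from trigonometric ones\<close>

lemma chebyshev_exists:
  "\<exists>T::real poly. degree T \<le> n \<and> coeff T n = (if n = 0 then 1 else 2 ^ (n - 1)) \<and>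
     (\<forall>t. poly T (cos t) = cos (real n * t))"
proof (induction n rule: induct_nat_012)
  case 0
  then show ?case by (intro exI[of _ 1]) auto
next
  case 1
  then show ?case by (intro exI[of _ "[:0, 1:]"]) auto
next
  case (ge2 n)
  then obtain S T where S: "degree S \<le> n" "\<And>t. poly S (cos t) = cos (real n * t)"
    and T: "degree T \<le> Suc n" "coeff T (Suc n) = 2 ^ n" "\<And>t. poly T (cos t) = cos (real (Suc n) * t)"
    by auto
  define U where "U = pCons 0 (smult 2 T) - S"
  have "degree U \<le> Suc (Suc n)"
  proof -
    have "degree (pCons 0 (smult 2 T)) \<le> Suc (Suc n)"
      using T(1) degree_pCons_le[of 0 "smult 2 T"] degree_smult_le[of 2 T] by linarith
    then show ?thesis unfolding U_def using S(1) by (intro degree_diff_le) auto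
  qed
  moreover have "coeff U (Suc (Suc n)) = 2 ^ Suc n"
    using T(2) S(1) by (simp add: U_def coeff_eq_0)
  moreover have "poly U (cos t) = cos (real (Suc (Suc n)) * t)" for t
  proof -
    have "cos (real (Suc (Suc n)) * t) + cos (real n * t) = 2 * (cos (real (Suc n) * t) * cos t)"
      unfolding cos_times_cos by (simp add: algebra_simps)
    then show ?thesis by (simp add: U_def S(2) T(3) algebra_simps)
  qed
  ultimately show ?case by (intro exI[of _ U]) auto
qed

text \<open>With \<open>degree q < n\<close> the frequencies n - j are positive and realised by
  Chebyshev polynomials. Only j = 0 reaches degree n, where the Chebyshev coefficient is 2^(n-1);
  hence the factor 2 / 2^n.\<close>

lemma monic_trigonometric_poly:
  fixes q :: "real poly"
  assumes "coeff q 0 = 1" "degree q < n"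
  shows "\<exists>Q::real poly. degree Q \<le> n \<and> coeff Q n = 1 \<and>
    (\<forall>t. poly Q (cos t) = 2 / 2 ^ n * Re (cis (real n * t) * cpoly q (cis (-t))))"
proof -
  from chebyshev_exists obtain T :: "nat \<Rightarrow> real poly" where T: "\<And>n. degree (T n) \<le> n"
    "\<And>n. coeff (T n) n = (if n = 0 then 1 else 2 ^ (n - 1))" "\<And>n t. poly (T n) (cos t) = cos (real n * t)"
    by metis
  define Q where "Q = (\<Sum>j\<le>degree q. smult (2 / 2 ^ n * coeff q j) (T (n - j)))"
  have "degree Q \<le> n"
    unfolding Q_def using T(1) by (intro degree_sum_le) (auto intro: order_trans[OF degree_smult_le] order_trans[OF T(1)])
  moreover have "coeff Q n = 1"
  proof -
    have "coeff Q n = (\<Sum>j\<le>degree q. if j = 0 then 1 else 0)"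
      unfolding Q_def coeff_sum
    proof (intro sum.cong refl)
      fix j assume j: "j \<in> {..degree q}"
      have n: "n > 0" using assms by auto
      have "coeff (T (n - j)) n = 0" if "j \<noteq> 0"
        using T(1)[of "n - j"] that n by (intro coeff_eq_0) auto
      moreover have "2 / 2 ^ n * 2 ^ (n - 1) = (1::real)" using n by (cases n) auto
      ultimately show "coeff (smult (2 / 2 ^ n * coeff q j) (T (n - j))) n = (if j = 0 then 1 else 0)"
        using assms n T(2)[of n] by auto
    qed
    then show ?thesis by simp
  qed
  moreover have "poly Q (cos t) = 2 / 2 ^ n * Re (cis (real n * t) * cpoly q (cis (-t)))" for t
    unfolding Re_cpoly_cis_minus Q_def poly_sum sum_distrib_left
    using assms by (intro sum.cong) (auto simp: T(3) of_nat_diff mult.assoc)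
  ultimately show ?thesis by blast
qed

section \<open>Szego asymptotics\<close>

lemma poly_borel_measurable [measurable]: "poly p \<in> borel_measurable (borel :: real measure)"
  by (intro borel_measurable_continuous_onI continuous_intros)

lemma poly_cos_bounded: "\<exists>B. \<forall>t::real. \<bar>poly p (cos t)\<bar> \<le> B"
proof -
  have "compact (poly p ` {-1..1})" by (intro compact_continuous_image continuous_intros) auto
  then obtain B where "\<And>x. x \<in> {-1..1} \<Longrightarrow> \<bar>poly p x\<bar> \<le> B"
    using compact_imp_bounded bounded_iff by (metis imageI real_norm_def)
  then show ?thesis by (intro exI[of _ B]) auto
qed

text \<open>Cauchy-Schwarz against the constant 1, obtained from the nonnegative variance of |f|
  about its mean m over an interval of length pi.\<close>

lemma square_integral_abs_le_arc:
  assumes f: "integrable arcm f" and f2: "integrable arcm (\<lambda>t. (f t)\<^sup>2)"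
  shows "(LINT t|arcm. \<bar>f t\<bar>)\<^sup>2 \<le> pi * (LINT t|arcm. (f t)\<^sup>2)"
proof -
  define m where "m = (LINT t|arcm. \<bar>f t\<bar>) / pi"
  have "0 \<le> (LINT t|arcm. (\<bar>f t\<bar> - m)\<^sup>2)" by simp
  also have "\<dots> = (LINT t|arcm. (f t)\<^sup>2 - 2 * m * \<bar>f t\<bar> + m\<^sup>2)"
    by (intro Bochner_Integration.integral_cong) (auto simp: power2_diff algebra_simps)
  also have "\<dots> = (LINT t|arcm. (f t)\<^sup>2) - 2 * m * (m * pi) + m\<^sup>2 * pi"
    using f f2 by (simp add: measure_arc_space m_def)
  finally have "m\<^sup>2 * pi \<le> (LINT t|arcm. (f t)\<^sup>2)" by (simp add: power2_eq_square algebra_simps)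
  then have "pi * (m\<^sup>2 * pi) \<le> pi * (LINT t|arcm. (f t)\<^sup>2)" by (intro mult_left_mono) auto
  then show ?thesis by (simp add: m_def power2_eq_square)
qed

text \<open>(Re z)^2 = |z|^2 / 2 + Re(z^2) / 2, and squaring doubles the frequency, so the second
  part is removed by Riemann-Lebesgue along the frequencies 2n. This serves the norm of
  \<open>v n\<close>, the test integrals and the mean square of the oscillation on X.\<close>

lemma tendsto_integral_Re_square:
  fixes F :: "real \<Rightarrow> complex"
  assumes F [measurable]: "F \<in> borel_measurable borel" and B: "\<And>t. norm (F t) \<le> B" and w: "integrable arcm w"
    and w0: "\<And>t. w t \<ge> 0"
  shows "(\<lambda>n. LINT t|arcm. (Re (cis (real n * t) * F t))\<^sup>2 * w t) \<longlonglongrightarrow> (LINT t|arcm. (norm (F t))\<^sup>2 * w t) / 2"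
proof -
  have [measurable]: "w \<in> borel_measurable arcm" using w by auto
  have i: "integrable arcm (\<lambda>t. h t * w t)" if [measurable]: "h \<in> borel_measurable borel" and "\<And>t. \<bar>h t\<bar> \<le> B\<^sup>2" for h
  proof (rule Bochner_Integration.integrable_bound[of _ "\<lambda>t. B\<^sup>2 * w t"])
    show "AE t in arcm. norm (h t * w t) \<le> norm (B\<^sup>2 * w t)"
      using that(2) w0 by (intro AE_I2) (simp add: abs_mult mult_right_mono)
  qed (use w in auto)
  have n2: "norm ((F t)\<^sup>2) \<le> B\<^sup>2" for t by (simp add: norm_power power_mono B)
  have 1: "integrable arcm (\<lambda>t. Re ((F t)\<^sup>2) * w t)" "integrable arcm (\<lambda>t. Im ((F t)\<^sup>2) * w t)"
    "integrable arcm (\<lambda>t. (norm (F t))\<^sup>2 * w t)"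
    using n2 by (intro i; measurable; fastforce intro: order_trans[OF abs_Re_le_cmod] order_trans[OF abs_Im_le_cmod] simp: norm_power)+
  have sub: "strict_mono (\<lambda>n::nat. 2 * n)" by (simp add: strict_mono_def)
  define f1 where "f1 n t = Re ((F t)\<^sup>2) * w t * cos (real (2 * n) * t + 0)" for n t
  \<comment> \<open>The shift by - pi/2 writes the sine as a cosine with constant phase.\<close>
  define f2 where "f2 n t = Im ((F t)\<^sup>2) * w t * cos (real (2 * n) * t + (- pi/2))" for n t
  have A: "(\<lambda>n. LINT t|arcm. f1 n t) \<longlonglongrightarrow> 0"
    unfolding f1_def
    using LIMSEQ_subseq_LIMSEQ[OF riemann_lebesgue_arc[OF 1(1), of "\<lambda>_. 0"] sub] by (simp add: o_def)
  have C: "(\<lambda>n. LINT t|arcm. f2 n t) \<longlonglongrightarrow> 0"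
    unfolding f2_def
    using LIMSEQ_subseq_LIMSEQ[OF riemann_lebesgue_arc[OF 1(2), of "\<lambda>_. - pi/2"] sub] by (simp add: o_def)
  have ic: "integrable arcm (\<lambda>t. h t * cos (g t))" if "integrable arcm h" and [measurable]: "g \<in> borel_measurable borel" for h g :: "real \<Rightarrow> real"
  proof (rule Bochner_Integration.integrable_bound[OF that(1)])
    show "(\<lambda>t. h t * cos (g t)) \<in> borel_measurable arcm"
      by (rule borel_measurable_times[OF borel_measurable_integrable[OF that(1)] borel_measurable_arc])
        (use that(2) in measurable)
    show "AE t in arcm. norm (h t * cos (g t)) \<le> norm (h t)"
      by (intro AE_I2) (simp add: abs_mult mult_left_le)
  qed
  have eq: "(LINT t|arcm. (Re (cis (real n * t) * F t))\<^sup>2 * w t) =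
     (LINT t|arcm. (norm (F t))\<^sup>2 * w t) / 2 + (LINT t|arcm. f1 n t) / 2 - (LINT t|arcm. f2 n t) / 2" for n
  proof -
    have Re2: "(Re z)\<^sup>2 = (norm z)\<^sup>2 / 2 + Re (z\<^sup>2) / 2" for z
      by (simp add: cmod_power2 Re_power2 add_divide_distrib diff_divide_distrib)
    have *: "(Re (cis (real n * t) * F t))\<^sup>2 * w t = (1/2) * ((norm (F t))\<^sup>2 * w t) + (1/2) * f1 n t - (1/2) * f2 n t" for t
    proof -
      have "(cis (real n * t) * F t)\<^sup>2 = cis (real (2 * n) * t) * (F t)\<^sup>2"
        unfolding power_mult_distrib Complex.DeMoivre by (simp add: mult.assoc)
      then have "Re ((cis (real n * t) * F t)\<^sup>2) = cos (real (2 * n) * t) * Re ((F t)\<^sup>2) - sin (real (2 * n) * t) * Im ((F t)\<^sup>2)"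
        by (metis times_complex.sel(1) cis.sel)
      moreover have "cos (real (2 * n) * t + (- pi/2)) = sin (real (2 * n) * t)"
        by (simp add: cos_diff)
      moreover have "norm (cis (real n * t) * F t) = norm (F t)" by (simp add: norm_mult)
      ultimately have "(Re (cis (real n * t) * F t))\<^sup>2 = (1/2) * (norm (F t))\<^sup>2 + (1/2) * (Re ((F t)\<^sup>2) * cos (real (2 * n) * t + 0))
        - (1/2) * (Im ((F t)\<^sup>2) * cos (real (2 * n) * t + (- pi/2)))"
        unfolding Re2 by (simp add: diff_divide_distrib mult.commute)
      then show ?thesis unfolding f1_def f2_def
        by (simp only: left_diff_distrib distrib_right mult.assoc) (simp only: mult_ac)
    qed
    have i1: "integrable arcm (f1 n)" unfolding f1_def by (rule ic[OF 1(1)]) measurable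
    have i2: "integrable arcm (f2 n)" unfolding f2_def by (rule ic[OF 1(2)]) measurable
    show ?thesis unfolding *
      by (subst Bochner_Integration.integral_diff Bochner_Integration.integral_add;
          (intro Bochner_Integration.integrable_add integrable_mult_right 1 i1 i2)?)+ simp
  qed
  have "(\<lambda>n. (LINT t|arcm. (norm (F t))\<^sup>2 * w t) / 2 + (LINT t|arcm. f1 n t) / 2 - (LINT t|arcm. f2 n t) / 2)
     \<longlonglongrightarrow> (LINT t|arcm. (norm (F t))\<^sup>2 * w t) / 2 + 0 / 2 - 0 / 2"
    by (intro tendsto_intros A C) auto
  then show ?thesis by (simp only: eq) simp
qed

section \<open>Normalised orthonormal polynomials and their oscillating targets\<close>

locale jacobi_mass_system =
  fixes \<alpha> \<beta> :: real and k :: nat and a M :: "nat \<Rightarrow> real" and P :: "nat \<Rightarrow> real poly"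
  assumes alpha: "\<alpha> > - 1/2"
    and nodes: "\<And>i. i < k \<Longrightarrow> a i \<in> {-1..1}"
    and ON: "orthonormal_polys (jacobi_mass_measure \<alpha> \<beta> k a M) P"
begin

abbreviation "\<nu> \<equiv> jacobi_mass_measure \<alpha> \<beta> k a M"

definition "A = \<alpha> + 1/2"
definition "B = \<beta> + 1/2"
definition "w = arc_weight A B"
definition "phase = szego_phase A B"
definition "\<kappa> n = coeff (P n) n"
definition "u n t = poly (P n) (cos t) * sqrt (w t)"
text \<open>The constant makes the mean square integral of \<open>v n\<close> over (0, pi) tend to
  1.\<close>

definition "v n t = sqrt (2 / pi) * cos (real n * t + phase t)"

lemma A_pos: "A > 0" using alpha by (simp add: A_def)

lemma w_measurable [measurable]: "w \<in> borel_measurable borel" by (simp add: w_def)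

lemma phase_measurable [measurable]: "phase \<in> borel_measurable borel" by (simp add: phase_def)

lemma u_measurable [measurable]: "u n \<in> borel_measurable borel"
  unfolding u_def by measurable

lemma v_measurable [measurable]: "v n \<in> borel_measurable borel"
  unfolding v_def by measurable

lemma w_nonneg: "w t \<ge> 0" by (simp add: w_def arc_weight_nonneg)

lemma w_pos: "t \<in> {0<..<pi} \<Longrightarrow> w t > 0" by (simp add: w_def arc_weight_pos)

lemma kappa_pos: "\<kappa> n > 0" unfolding \<kappa>_def by (rule orthonormal_polysD(3)[OF ON])

lemma nn_integral_nu:
  assumes "h \<in> borel_measurable borel"
  shows "(\<integral>\<^sup>+x. h x \<partial>\<nu>) = (\<integral>\<^sup>+t. h (cos t) * ennreal (w t) \<partial>arcm) + (\<Sum>i<k. ennreal (M i) * h (a i))"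
  using nn_integral_jacobi_mass_measure[OF assms] by (simp add: w_def A_def B_def)

text \<open>Only an inequality, because the point masses take their share of the unit norm of
  \<open>P n\<close>.\<close>

lemma u_square_nn: "(\<integral>\<^sup>+t. ennreal ((u n t)\<^sup>2) \<partial>arcm) \<le> 1"
proof -
  have "(\<integral>\<^sup>+t. ennreal ((u n t)\<^sup>2) \<partial>arcm) = (\<integral>\<^sup>+t. ennreal ((poly (P n) (cos t))\<^sup>2) * ennreal (w t) \<partial>arcm)"
    by (intro nn_integral_cong) (simp add: u_def power_mult_distrib w_nonneg ennreal_mult')
  also have "\<dots> \<le> (\<integral>\<^sup>+x. ennreal ((poly (P n) x)\<^sup>2) \<partial>\<nu>)"
    by (subst nn_integral_nu) auto
  also have "\<dots> = ennreal (LINT x|\<nu>. (poly (P n) x)\<^sup>2)"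
    using orthonormal_polysD(4)[OF ON, of n n] by (intro nn_integral_eq_integral) (auto simp: power2_eq_square)
  also have "(LINT x|\<nu>. (poly (P n) x)\<^sup>2) = 1"
    using orthonormal_polysD(5)[OF ON, of n n] by (simp add: power2_eq_square)
  finally show ?thesis by simp
qed

lemma u_square: "integrable arcm (\<lambda>t. (u n t)\<^sup>2)" "(LINT t|arcm. (u n t)\<^sup>2) \<le> 1"
proof -
  show i: "integrable arcm (\<lambda>t. (u n t)\<^sup>2)"
    using u_square_nn[of n] by (intro integrableI_bounded) (auto simp: le_less_trans)
  show "(LINT t|arcm. (u n t)\<^sup>2) \<le> 1"
    using u_square_nn[of n] nn_integral_eq_integral[OF i] by simp
qed

text \<open>\<open>P 0\<close> is a nonzero constant with integrable square, so the weight inherits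
  integrability from the orthonormal system.\<close>

lemma w_integrable: "integrable arcm w"
proof -
  obtain c where c: "P 0 = [:c:]" using orthonormal_polysD(1)[OF ON, of 0] by (metis degree_0_id degree_eq_zeroE)
  have "c > 0" using orthonormal_polysD(3)[OF ON, of 0] c by simp
  have "integrable arcm (\<lambda>t. (u 0 t)\<^sup>2 / c\<^sup>2)" using u_square(1) by simp
  then show ?thesis using \<open>c > 0\<close> by (simp add: u_def c w_nonneg power_mult_distrib)
qed

lemma u_integrable: "integrable arcm (u n)"
proof (rule Bochner_Integration.integrable_bound)
  show "integrable arcm (\<lambda>t. 1 + (u n t)\<^sup>2)" using u_square(1) by auto
  have "\<bar>x\<bar> \<le> 1 + x\<^sup>2" for x :: real
    using sum_squares_bound[of 1 "\<bar>x\<bar>"] by (simp add: power2_eq_square)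
  then show "AE t in arcm. norm (u n t) \<le> norm (1 + (u n t)\<^sup>2)" by (intro AE_I2) simp
qed measurable

lemma v_bound: "\<bar>v n t\<bar> \<le> 1"
proof -
  have "\<bar>v n t\<bar> \<le> sqrt (2 / pi) * 1" unfolding v_def abs_mult by (intro mult_mono) auto
  also have "\<dots> \<le> 1" using pi_gt3 by simp
  finally show ?thesis .
qed

lemma v_integrable: "integrable arcm (v n)"
  by (rule integrable_arc_bounded[OF _ v_bound]) measurable

lemma v_square_integrable: "integrable arcm (\<lambda>t. (v n t)\<^sup>2)"
  by (rule integrable_arc_bounded[of _ 1]) (measurable, use v_bound abs_square_le_1 in auto)

lemma v_square_tendsto: "(\<lambda>n. LINT t|arcm. (v n t)\<^sup>2) \<longlonglongrightarrow> 1"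
proof -
  have "(\<lambda>n. LINT t|arcm. (Re (cis (real n * t) * cis (phase t)))\<^sup>2 * 1) \<longlonglongrightarrow> (LINT t|arcm. (norm (cis (phase t)))\<^sup>2 * 1) / 2"
    by (rule tendsto_integral_Re_square[where B=1]) auto
  then have "(\<lambda>n. 2 / pi * (LINT t|arcm. (cos (real n * t + phase t))\<^sup>2)) \<longlonglongrightarrow> 2 / pi * (pi / 2)"
    by (intro tendsto_mult tendsto_const) (simp add: cis_mult measure_arc_space cos_add)
  moreover have "(LINT t|arcm. (v n t)\<^sup>2) = 2 / pi * (LINT t|arcm. (cos (real n * t + phase t))\<^sup>2)" for n
    by (simp add: v_def power_mult_distrib)
  ultimately show ?thesis by simp
qed

lemma uv_integrable: "integrable arcm (\<lambda>t. u n t * v n t)"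
  by (rule Bochner_Integration.integrable_bound[OF u_integrable[of n]])
     (measurable, use v_bound in \<open>auto simp: abs_mult intro!: mult_left_le\<close>)

text \<open>The factor relating the inner product of \<open>u n\<close> and \<open>v n\<close> to
  \<open>\<kappa> n / 2 ^ n\<close>; the limit of that quotient is the reciprocal of this
  constant.\<close>

definition "\<kappa>lim = sqrt (2 * pi) / 2 powr ((A + B) / 2)"

lemma kappa_lim_pos: "\<kappa>lim > 0" by (simp add: \<kappa>lim_def)

lemma integral_uv: "(LINT t|arcm. u n t * v n t) = \<kappa>lim * (\<kappa> n / 2 ^ n)"
proof -
  have "(LINT t|arcm. u n t * v n t) = sqrt (2 / pi) * (LINT t|arcm. poly (P n) (cos t) * cos (real n * t + phase t) * sqrt (w t))"
    by (subst integral_mult_right_zero[symmetric]) (auto intro!: Bochner_Integration.integral_cong simp: u_def v_def mult_ac)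
  also have "(LINT t|arcm. poly (P n) (cos t) * cos (real n * t + phase t) * sqrt (w t))
     = \<kappa> n / 2 ^ n * (pi / 2 powr ((A + B) / 2))"
    using integral_poly_szego[OF A_pos, of B "P n" n] w_integrable orthonormal_polysD(1)[OF ON, of n]
    by (simp add: w_def phase_def \<kappa>_def)
  also have "sqrt (2 / pi) * (\<kappa> n / 2 ^ n * (pi / 2 powr ((A + B) / 2))) = \<kappa>lim * (\<kappa> n / 2 ^ n)"
  proof -
    have "sqrt (2 / pi) * pi = sqrt (2 * pi)"
      by (intro real_sqrt_unique[symmetric]) (simp_all add: power_mult_distrib power2_eq_square[of pi])
    then show ?thesis by (simp add: \<kappa>lim_def mult_ac)
  qed
  finally show ?thesis .
qed

text \<open>Used twice: nonnegativity of the left side bounds \<open>\<kappa> n\<close> from above,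
  and once the limit of \<open>\<kappa> n / 2 ^ n\<close> is known the right side tends to 1 + 1 - 2
  = 0.\<close>

lemma integral_uv_diff_square:
  "(LINT t|arcm. (u n t - v n t)\<^sup>2) \<le> 1 + (LINT t|arcm. (v n t)\<^sup>2) - 2 * (\<kappa>lim * (\<kappa> n / 2 ^ n))"
proof -
  have "(LINT t|arcm. (u n t - v n t)\<^sup>2) = (LINT t|arcm. (u n t)\<^sup>2 + (v n t)\<^sup>2 - 2 * (u n t * v n t))"
    by (intro Bochner_Integration.integral_cong) (auto simp: power2_diff)
  also have "\<dots> = (LINT t|arcm. (u n t)\<^sup>2) + (LINT t|arcm. (v n t)\<^sup>2) - 2 * (\<kappa>lim * (\<kappa> n / 2 ^ n))"
    unfolding integral_uv[symmetric] using u_square(1)[of n] v_square_integrable[of n] uv_integrable[of n] by simp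
  finally show ?thesis using u_square(2)[of n] by simp
qed

section \<open>Limit of the leading coefficients\<close>

lemma AE_nodes: "AE t in arcm. cos t \<notin> a ` {..<k}"
proof -
  define F where "F = (\<lambda>i. arccos (a i)) ` {..<k}"
  have "AE t in lborel. t \<notin> F"
    by (intro AE_I[of _ _ F]) (auto simp: emeasure_lborel_countable countable_finite F_def finite_imp_closed)
  then have "AE t in arcm. t \<notin> F"
    unfolding arcm_def by (subst AE_restrict_space_iff) auto
  then show ?thesis
  proof (rule AE_mp, intro AE_I2 impI)
    fix t assume t: "t \<in> space arcm" "t \<notin> F"
    show "cos t \<notin> a ` {..<k}"
    proof
      assume "cos t \<in> a ` {..<k}"
      then obtain i where "i < k" "arccos (a i) = arccos (cos t)" by force
      then show False using t by (force simp: F_def arccos_cos)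
    qed
  qed
qed

text \<open>As q vanishes at the angles of the nodes, the monic polynomial Q built from it vanishes
  at the nodes, and its norm is an integral against the weight alone. The square of 2 / 2^n produces
  4 / 4^n.\<close>

lemma kappa_test:
  assumes q: "coeff q 0 = 1" "degree q < n" "\<And>i. i < k \<Longrightarrow> cpoly q (cis (- arccos (a i))) = 0"
  shows "4 ^ n / (\<kappa> n)\<^sup>2 \<le> 4 * (LINT t|arcm. (Re (cis (real n * t) * cpoly q (cis (-t))))\<^sup>2 * w t)"
proof -
  obtain Q where Q: "degree Q \<le> n" "coeff Q n = (1::real)"
    "\<And>t. poly Q (cos t) = 2 / 2 ^ n * Re (cis (real n * t) * cpoly q (cis (-t)))"
    using monic_trigonometric_poly[OF q(1,2)] by blast
  obtain C where C: "\<And>t. \<bar>poly Q (cos t)\<bar> \<le> C" using poly_cos_bounded by blast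
  have zero: "poly Q (a i) = 0" if "i < k" for i
    using Q(3)[of "arccos (a i)"] q(3)[OF that] nodes[OF that] by simp
  have "integrable arcm (\<lambda>t. (poly Q (cos t))\<^sup>2 * w t)"
  proof (rule Bochner_Integration.integrable_bound)
    show "integrable arcm (\<lambda>t. C\<^sup>2 * w t)" using w_integrable by simp
    have "(poly Q (cos t))\<^sup>2 \<le> C\<^sup>2" for t using C[of t] by (metis abs_ge_zero power2_abs power_mono)
    then show "AE t in arcm. norm ((poly Q (cos t))\<^sup>2 * w t) \<le> norm (C\<^sup>2 * w t)"
      using w_nonneg by (intro AE_I2) (simp add: abs_mult mult_right_mono)
  qed measurable
  then have "(LINT x|\<nu>. (poly Q x)\<^sup>2) = (LINT t|arcm. (poly Q (cos t))\<^sup>2 * w t)"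
    using zero integral_jacobi_mass_measure(2)[of "\<lambda>x. (poly Q x)\<^sup>2" \<alpha> \<beta> k a M] by (simp add: w_def A_def B_def)
  also have "\<dots> = (2 / 2 ^ n)\<^sup>2 * (LINT t|arcm. (Re (cis (real n * t) * cpoly q (cis (-t))))\<^sup>2 * w t)"
    unfolding Q(3) power_mult_distrib mult.assoc by (rule integral_mult_right_zero)
  also have "(2 / 2 ^ n)\<^sup>2 = (4 / 4 ^ n :: real)"
    by (simp add: power_divide power2_eq_square flip: power_mult_distrib)
  finally have "1 / (\<kappa> n)\<^sup>2 \<le> 4 / 4 ^ n * (LINT t|arcm. (Re (cis (real n * t) * cpoly q (cis (-t))))\<^sup>2 * w t)"
    using leading_coeff_extremal[OF ON Q(1,2)] by (simp add: \<kappa>_def)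
  then have "4 ^ n * (1 / (\<kappa> n)\<^sup>2) \<le> 4 ^ n * (4 / 4 ^ n * (LINT t|arcm. (Re (cis (real n * t) * cpoly q (cis (-t))))\<^sup>2 * w t))"
    by (rule mult_left_mono) simp
  then show ?thesis by simp
qed

text \<open>A double limit. As m grows, |q_m|^2 w tends to 1/c with c = 2^(A+B), and its integral to
  pi/c; then, for one fixed m, letting n grow halves the integral through the squared real part. The
  factor 4 of \<open>kappa_test\<close> gives 2 pi / c = \<open>\<kappa>lim\<^sup>2\<close>.\<close>

lemma inverse_kappa_eventually:
  assumes "\<epsilon> > 0"
  shows "\<forall>\<^sub>F n in sequentially. 4 ^ n / (\<kappa> n)\<^sup>2 \<le> \<kappa>lim\<^sup>2 + \<epsilon>"
proof -
  define F where "F = (\<lambda>i. arccos (a i)) ` {..<k}"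
  have fin: "finite F" by (simp add: F_def)
  obtain q K where q: "K \<ge> 0" "\<And>m. coeff (q m) 0 = (1::real)" "\<And>m \<phi>. \<phi> \<in> F \<Longrightarrow> cpoly (q m) (cis (- \<phi>)) = 0"
    "\<And>m t. t \<in> {0<..<pi} \<Longrightarrow> norm (cpoly (q m) (cis (-t))) * norm (szego A B (cis (-t))) \<le> K * (1 + norm (1 + cis (-t)) powr B)"
    "\<And>t. t \<in> {0<..<pi} \<Longrightarrow> cos t \<notin> cos ` F \<Longrightarrow> (\<lambda>m. norm (cpoly (q m) (cis (-t))) * norm (szego A B (cis (-t)))) \<longlonglongrightarrow> 1"
    using inverse_szego_polynomial_sequence[OF less_imp_le[OF A_pos] fin, of B] by blast
  define N where "N m t = norm (cpoly (q m) (cis (-t)))" for m t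
  define S where "S t = norm (szego A B (cis (-t)))" for t
  note q = q[folded N_def S_def]
  define c where "c = 2 powr (A + B)"
  have c: "c > 0" by (simp add: c_def)
  have cm [measurable]: "(\<lambda>t. cpoly (q m) (cis (-t))) \<in> borel_measurable borel" for m
    unfolding cpoly_altdef by measurable
  have [measurable]: "N m \<in> borel_measurable borel" for m unfolding N_def by measurable
  have szw: "(S t)\<^sup>2 = c * w t" if "t \<in> {0<..<pi}" for t
    unfolding S_def norm_szego_cis_minus norm_szego_cis[OF that]
    by (simp add: power_mult_distrib w_def arc_weight_nonneg c_def) (simp add: power2_eq_square flip: powr_add)
  have cosF: "cos ` F = a ` {..<k}"
    unfolding F_def image_image using nodes by (intro image_cong) auto
  have "(\<lambda>m. LINT t|arcm. c * ((N m t)\<^sup>2 * w t)) \<longlonglongrightarrow> (LINT t|arcm. 1)"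
  proof (rule integral_dominated_convergence[where w="\<lambda>t. K\<^sup>2 * (1 + norm (1 + cis t) powr B)\<^sup>2"])
    show "integrable arcm (\<lambda>t. K\<^sup>2 * (1 + norm (1 + cis t) powr B)\<^sup>2)"
      using integrable_envelope[OF A_pos, of B] w_integrable by (simp add: w_def)
    have eq: "c * ((N m t)\<^sup>2 * w t) = (N m t * S t)\<^sup>2"
      if "t \<in> {0<..<pi}" for m t
      unfolding power_mult_distrib szw[OF that] by (simp add: mult_ac)
    show "AE t in arcm. norm (c * ((N m t)\<^sup>2 * w t)) \<le> K\<^sup>2 * (1 + norm (1 + cis t) powr B)\<^sup>2" for m
    proof (rule AE_I2)
      fix t assume "t \<in> space arcm"
      then have t: "t \<in> {0<..<pi}" by simp
      have "(N m t * S t)\<^sup>2 \<le> (K * (1 + norm (1 + cis (-t)) powr B))\<^sup>2"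
        by (intro power_mono q(4) t) (simp add: N_def S_def)
      then show "norm (c * ((N m t)\<^sup>2 * w t)) \<le> K\<^sup>2 * (1 + norm (1 + cis t) powr B)\<^sup>2"
        unfolding eq[OF t] by (simp add: power_mult_distrib norm_one_plus_cis_minus)
    qed
    from AE_nodes show "AE t in arcm. (\<lambda>m. c * ((N m t)\<^sup>2 * w t)) \<longlonglongrightarrow> 1"
    proof (rule AE_mp, intro AE_I2 impI)
      fix t assume "t \<in> space arcm" "cos t \<notin> a ` {..<k}"
      then have t: "t \<in> {0<..<pi}" "cos t \<notin> cos ` F" using cosF by auto
      have "(\<lambda>m. (N m t * S t)\<^sup>2) \<longlonglongrightarrow> 1\<^sup>2"
        by (intro tendsto_power q(5) t)
      then show "(\<lambda>m. c * ((N m t)\<^sup>2 * w t)) \<longlonglongrightarrow> 1"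
        unfolding eq[OF t(1)] by simp
    qed
  qed measurable
  then have "(\<lambda>m. (LINT t|arcm. c * ((N m t)\<^sup>2 * w t)) / c) \<longlonglongrightarrow> pi / c"
    using c by (intro tendsto_divide tendsto_const) (auto simp: measure_arc_space)
  then have "(\<lambda>m. LINT t|arcm. (N m t)\<^sup>2 * w t) \<longlonglongrightarrow> pi / c"
    using c by simp
  then have "\<forall>\<^sub>F m in sequentially. (LINT t|arcm. (N m t)\<^sup>2 * w t) < pi / c + \<epsilon> / 2"
    by (rule order_tendstoD) (use assms in auto)
  then obtain m where m: "(LINT t|arcm. (N m t)\<^sup>2 * w t) < pi / c + \<epsilon> / 2"
    using eventually_happens'[OF sequentially_bot] by blast
  have "N m t \<le> (\<Sum>j\<le>degree (q m). \<bar>coeff (q m) j\<bar>)" for t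
    unfolding N_def cpoly_altdef by (rule order_trans[OF norm_sum]) (simp add: norm_mult norm_power)
  then have "(\<lambda>n. LINT t|arcm. (Re (cis (real n * t) * cpoly (q m) (cis (-t))))\<^sup>2 * w t)
      \<longlonglongrightarrow> (LINT t|arcm. (N m t)\<^sup>2 * w t) / 2"
    unfolding N_def by (intro tendsto_integral_Re_square w_integrable w_nonneg) measurable
  then have "\<forall>\<^sub>F n in sequentially. (LINT t|arcm. (Re (cis (real n * t) * cpoly (q m) (cis (-t))))\<^sup>2 * w t) < (pi / c + \<epsilon> / 2) / 2"
    by (rule order_tendstoD) (use m in auto)
  moreover have "\<forall>\<^sub>F n in sequentially. degree (q m) < n" by (rule eventually_gt_at_top)
  ultimately show ?thesis
  proof eventually_elim
    case (elim n)
    have "4 ^ n / (\<kappa> n)\<^sup>2 \<le> 4 * (LINT t|arcm. (Re (cis (real n * t) * cpoly (q m) (cis (-t))))\<^sup>2 * w t)"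
      using elim by (intro kappa_test q(2)) (auto intro!: q(3) simp: F_def)
    also have "\<dots> \<le> 2 * pi / c + \<epsilon>" using elim by (simp add: field_simps)
    also have "2 * pi / c = \<kappa>lim\<^sup>2"
      by (simp add: \<kappa>lim_def c_def power_divide power2_eq_square flip: powr_add)
    finally show ?case .
  qed
qed

lemma kappa_tendsto: "(\<lambda>n. \<kappa> n / 2 ^ n) \<longlonglongrightarrow> 1 / \<kappa>lim"
proof (rule LIMSEQ_I)
  fix r :: real assume r: "r > 0"
  define L where "L = 1 / \<kappa>lim"
  have L: "L > 0" using kappa_lim_pos by (simp add: L_def)
  \<comment> \<open>Kept below L, so that L - \<epsilon> is positive and reciprocal squares can be
    compared.\<close>
  define \<epsilon> where "\<epsilon> = min r (L / 2)"
  have \<epsilon>: "\<epsilon> > 0" "\<epsilon> < L" "\<epsilon> \<le> r" using r L by (auto simp: \<epsilon>_def)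
  have "1 / L\<^sup>2 < 1 / (L - \<epsilon>)\<^sup>2"
    using \<epsilon> by (intro divide_strict_left_mono power_strict_mono) auto
  \<comment> \<open>Only half of the gap between the reciprocal squares is spent, so that this
    non-strict bound yields a strict one.\<close>
  then have ev1: "\<forall>\<^sub>F n in sequentially. 4 ^ n / (\<kappa> n)\<^sup>2 \<le> \<kappa>lim\<^sup>2 + (1 / (L - \<epsilon>)\<^sup>2 - 1 / L\<^sup>2) / 2"
    by (intro inverse_kappa_eventually) auto
  have kl: "\<kappa>lim\<^sup>2 = 1 / L\<^sup>2" using kappa_lim_pos by (simp add: L_def power_divide)
  have "(\<lambda>n. (1 + (LINT t|arcm. (v n t)\<^sup>2)) / (2 * \<kappa>lim)) \<longlonglongrightarrow> (1 + 1) / (2 * \<kappa>lim)"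
    using kappa_lim_pos by (intro tendsto_intros v_square_tendsto) auto
  then have "\<forall>\<^sub>F n in sequentially. (1 + (LINT t|arcm. (v n t)\<^sup>2)) / (2 * \<kappa>lim) < L + r"
    by (rule order_tendstoD) (use r kappa_lim_pos in \<open>simp add: L_def field_simps\<close>)
  with ev1 have "\<forall>\<^sub>F n in sequentially. norm (\<kappa> n / 2 ^ n - L) < r"
  proof eventually_elim
    case (elim n)
    define y where "y = \<kappa> n / 2 ^ n"
    have y: "y > 0" using kappa_pos[of n] by (simp add: y_def)
    have "0 \<le> (LINT t|arcm. (u n t - v n t)\<^sup>2)" by simp
    also note integral_uv_diff_square
    finally have "y \<le> (1 + (LINT t|arcm. (v n t)\<^sup>2)) / (2 * \<kappa>lim)"
      using kappa_lim_pos by (simp add: y_def field_simps)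
    then have up: "y < L + r" using elim by linarith
    have y2: "4 ^ n / (\<kappa> n)\<^sup>2 = 1 / y\<^sup>2"
      by (simp add: y_def power_divide power2_eq_square flip: power_mult_distrib)
    have midpoint: "p < s" if "p \<le> q + (s - q) / 2" "q < s" for p q s :: real
      using that by (simp add: field_simps)
    have "1 / y\<^sup>2 < 1 / (L - \<epsilon>)\<^sup>2"
      using midpoint[OF elim(1)[unfolded kl y2] \<open>1 / L\<^sup>2 < 1 / (L - \<epsilon>)\<^sup>2\<close>] .
    then have "(L - \<epsilon>)\<^sup>2 < y\<^sup>2" using \<epsilon> y by (simp add: field_simps)
    then have "L - \<epsilon> < y" using y by (intro power2_less_imp_less[of "L - \<epsilon>" y]) auto
    then show ?case using up \<epsilon> by (auto simp: y_def[symmetric])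
  qed
  then show "\<exists>no. \<forall>n\<ge>no. norm (\<kappa> n / 2 ^ n - 1 / \<kappa>lim) < r"
    by (simp add: L_def eventually_sequentially)
qed

lemma kappa_ratio_tendsto: "(\<lambda>n. \<kappa> n / \<kappa> (Suc n)) \<longlonglongrightarrow> 1 / 2"
proof -
  have "(\<lambda>n. (\<kappa> n / 2 ^ n) / (\<kappa> (Suc n) / 2 ^ Suc n)) \<longlonglongrightarrow> (1 / \<kappa>lim) / (1 / \<kappa>lim)"
    using kappa_lim_pos by (intro tendsto_divide kappa_tendsto LIMSEQ_Suc) auto
  then have "(\<lambda>n. (\<kappa> n / 2 ^ n) / (\<kappa> (Suc n) / 2 ^ Suc n) / 2) \<longlonglongrightarrow> 1 / 2"
    using kappa_lim_pos by (intro tendsto_divide tendsto_const) auto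
  then show ?thesis by simp
qed

text \<open>Convergence in mean square, weakened to L1 by Cauchy-Schwarz; the L1 form combines
  directly with bounded factors.\<close>

lemma uv_L1_tendsto: "(\<lambda>n. LINT t|arcm. \<bar>u n t - v n t\<bar>) \<longlonglongrightarrow> 0"
proof -
  have "(\<lambda>n. 1 + (LINT t|arcm. (v n t)\<^sup>2) - 2 * (\<kappa>lim * (\<kappa> n / 2 ^ n))) \<longlonglongrightarrow> 1 + 1 - 2 * (\<kappa>lim * (1 / \<kappa>lim))"
    by (intro tendsto_intros v_square_tendsto kappa_tendsto)
  then have l: "(\<lambda>n. 1 + (LINT t|arcm. (v n t)\<^sup>2) - 2 * (\<kappa>lim * (\<kappa> n / 2 ^ n))) \<longlonglongrightarrow> 0"
    using kappa_lim_pos by simp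
  have "(\<lambda>n. LINT t|arcm. (u n t - v n t)\<^sup>2) \<longlonglongrightarrow> 0"
    by (rule tendsto_sandwich[OF _ _ tendsto_const l])
       (intro always_eventually allI integral_uv_diff_square | simp)+
  then have "(\<lambda>n. sqrt (pi * (LINT t|arcm. (u n t - v n t)\<^sup>2))) \<longlonglongrightarrow> sqrt (pi * 0)"
    by (intro tendsto_intros)
  then have l2: "(\<lambda>n. sqrt (pi * (LINT t|arcm. (u n t - v n t)\<^sup>2))) \<longlonglongrightarrow> 0" by simp
  have i: "integrable arcm (\<lambda>t. (u n t - v n t)\<^sup>2)" for n
  proof -
    have "(\<lambda>t. (u n t - v n t)\<^sup>2) = (\<lambda>t. (u n t)\<^sup>2 + (v n t)\<^sup>2 - 2 * (u n t * v n t))"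
      by (auto simp: power2_diff)
    then show ?thesis using u_square(1)[of n] v_square_integrable[of n] uv_integrable[of n] by simp
  qed
  show ?thesis
  proof (rule tendsto_sandwich[OF _ _ tendsto_const l2])
    show "\<forall>\<^sub>F n in sequentially. (LINT t|arcm. \<bar>u n t - v n t\<bar>) \<le> sqrt (pi * (LINT t|arcm. (u n t - v n t)\<^sup>2))"
      using square_integral_abs_le_arc[OF _ i] u_integrable v_integrable
      by (intro always_eventually allI real_le_rsqrt) auto
  qed auto
qed

end

section \<open>Weak norms and the angular variable\<close>

lemma weak_Lp_norm_ge:
  assumes [measurable]: "f \<in> borel_measurable \<nu>"
    and m: "ennreal t < emeasure \<nu> {x \<in> space \<nu>. \<bar>f x\<bar> > s}" and "t > 0" "s \<ge> 0"
  shows "ennreal (t powr (1 / p) * s) \<le> weak_Lp_norm \<nu> p f"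
proof -
  have "ennreal s \<le> rearrangement \<nu> f t"
    unfolding rearrangement_def
  proof (rule INF_greatest)
    fix r :: ennreal assume r: "r \<in> {s. emeasure \<nu> {x \<in> space \<nu>. ennreal \<bar>f x\<bar> > s} \<le> ennreal t}"
    show "ennreal s \<le> r"
    proof (rule ccontr)
      assume "\<not> ennreal s \<le> r"
      then have rs: "r < ennreal s" by simp
      have "{x \<in> space \<nu>. \<bar>f x\<bar> > s} \<subseteq> {x \<in> space \<nu>. ennreal \<bar>f x\<bar> > r}"
        using rs \<open>s \<ge> 0\<close> by (auto intro: less_trans simp: ennreal_less_iff)
      then have "emeasure \<nu> {x \<in> space \<nu>. \<bar>f x\<bar> > s} \<le> emeasure \<nu> {x \<in> space \<nu>. ennreal \<bar>f x\<bar> > r}"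
        by (rule emeasure_mono) measurable
      then show False using r m by auto
    qed
  qed
  then have "ennreal (t powr (1 / p)) * ennreal s \<le> ennreal (t powr (1 / p)) * rearrangement \<nu> f t"
    by (intro mult_left_mono) auto
  also have "\<dots> \<le> weak_Lp_norm \<nu> p f"
    unfolding weak_Lp_norm_def using \<open>t > 0\<close> by (intro SUP_upper) auto
  finally show ?thesis using \<open>s \<ge> 0\<close> by (simp add: ennreal_mult')
qed

lemma integral_arc_indicator:
  assumes "0 < x0" "x0 \<le> x1" "x1 < pi"
  shows "(LINT t|arcm. indicator {x0..x1} t) = x1 - x0"
proof -
  have "(LINT t|arcm. indicat_real {x0..x1} t) = (LINT t|lborel. indicat_real {0<..<pi} t *\<^sub>R indicat_real {x0..x1} t)"
    unfolding arcm_def by (subst integral_restrict_space) auto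
  also have "\<dots> = (LINT t|lborel. indicat_real {x0..x1} t)"
    using assms by (intro Bochner_Integration.integral_cong) (auto simp: indicator_def)
  also have "\<dots> = x1 - x0" using assms by simp
  finally show ?thesis .
qed

lemma cauchy_kernel_bound:
  fixes g :: "real \<Rightarrow> real"
  assumes G: "\<And>s. \<bar>g s\<bar> \<le> G" and d: "d > 0" "\<And>s. g s \<noteq> 0 \<Longrightarrow> d \<le> \<bar>cos t - cos s\<bar>"
  shows "\<bar>g s / (cos t - cos s)\<bar> \<le> G / d"
proof (cases "g s = 0")
  case True
  then show ?thesis using G[of s] d(1) by simp
next
  case False
  then show ?thesis unfolding abs_divide using d(1) d(2)[OF False] G[of s] by (intro frac_le) auto
qed

text \<open>Clamping extends the inverse of cos continuously to the whole line, which gives Borel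
  measurability.\<close>

definition clamped_arccos :: "real \<Rightarrow> real" where
  "clamped_arccos x = arccos (max (-1) (min 1 x))"

lemma clamped_arccos_measurable [measurable]: "clamped_arccos \<in> borel_measurable borel"
  unfolding clamped_arccos_def[abs_def]
  by (rule borel_measurable_continuous_onI, rule continuous_on_arccos)
     (auto intro!: continuous_on_max continuous_on_min)

lemma clamped_arccos_cos: "t \<in> {0<..<pi} \<Longrightarrow> clamped_arccos (cos t) = t"
  by (simp add: clamped_arccos_def arccos_cos)

section \<open>Partial sums as Cauchy integrals\<close>

context jacobi_mass_system
begin

lemma christoffel_darboux_u:
  "(cos t - cos s) * (\<Sum>j\<le>n. u j t * u j s) = \<kappa> n / \<kappa> (Suc n) * (u (Suc n) t * u n s - u n t * u (Suc n) s)"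
proof -
  have "(cos t - cos s) * (\<Sum>j\<le>n. u j t * u j s)
    = ((cos t - cos s) * kernel_L P n (cos t) (cos s)) * (sqrt (w t) * sqrt (w s))"
    by (simp add: kernel_L_def u_def sum_distrib_right sum_distrib_left mult_ac)
  also have "\<dots> = \<kappa> n / \<kappa> (Suc n) * (u (Suc n) t * u n s - u n t * u (Suc n) s)"
    unfolding christoffel_darboux[OF ON] by (simp add: u_def \<kappa>_def algebra_simps)
  finally show ?thesis .
qed

text \<open>Zero at the mass points, so that integrals of \<open>lift h\<close> against the measure only see the
  Jacobi weight, where \<open>lift h (cos t) * sqrt (w t) = h t\<close>.\<close>

definition lift :: "(real \<Rightarrow> real) \<Rightarrow> real \<Rightarrow> real" where
  "lift h x = (if x \<in> a ` {..<k} then 0 else h (clamped_arccos x) / sqrt (w (clamped_arccos x)))"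

lemma lift_measurable [measurable]:
  assumes [measurable]: "h \<in> borel_measurable borel"
  shows "lift h \<in> borel_measurable borel"
proof -
  define N where "N = a ` {..<k}"
  have [measurable]: "N \<in> sets borel" unfolding N_def by (intro borel_closed finite_imp_closed) auto
  define F where "F x = h (clamped_arccos x)" for x
  define G where "G x = w (clamped_arccos x)" for x
  have [measurable]: "F \<in> borel_measurable borel"
    unfolding F_def by (rule measurable_compose[OF clamped_arccos_measurable assms])
  have [measurable]: "G \<in> borel_measurable borel"
    unfolding G_def by (rule measurable_compose[OF clamped_arccos_measurable w_measurable])
  have "lift h = (\<lambda>x. indicator (- N) x * (F x / sqrt (G x)))"
    by (auto simp: lift_def N_def F_def G_def fun_eq_iff)
  moreover have "(\<lambda>x. indicator (- N) x * (F x / sqrt (G x))) \<in> borel_measurable borel"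
    by (intro borel_measurable_times borel_measurable_indicator borel_measurable_divide) measurable
  ultimately show ?thesis by (simp only:)
qed

lemma lift_node: "i < k \<Longrightarrow> lift h (a i) = 0"
  by (simp add: lift_def)

lemma AE_lift: "AE t in arcm. lift h (cos t) = h t / sqrt (w t)"
  by (rule AE_mp[OF AE_nodes], intro AE_I2 impI) (simp add: lift_def clamped_arccos_cos)

lemma uh_integrable:
  assumes [measurable]: "h \<in> borel_measurable borel" and h: "\<And>t. \<bar>h t\<bar> \<le> H"
  shows "integrable arcm (\<lambda>t. h t * u j t)"
proof (rule Bochner_Integration.integrable_bound)
  show "integrable arcm (\<lambda>t. H * u j t)" using u_integrable by simp
  show "AE t in arcm. norm (h t * u j t) \<le> norm (H * u j t)"
    using h by (intro AE_I2) (simp add: abs_mult mult_right_mono order_trans[OF _ abs_ge_self])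
qed measurable

lemma integral_poly_lift:
  assumes [measurable]: "h \<in> borel_measurable borel" and h: "\<And>t. \<bar>h t\<bar> \<le> H"
  shows "integrable \<nu> (\<lambda>y. poly (P j) y * lift h y)"
    "(LINT y|\<nu>. poly (P j) y * lift h y) = (LINT t|arcm. u j t * h t)"
proof -
  have i: "integrable arcm (\<lambda>t. u j t * h t)"
    using uh_integrable[OF assms] by (simp only: mult.commute)
  have ae: "AE t in arcm. u j t * h t = poly (P j) (cos t) * lift h (cos t) * w t"
  proof (rule AE_mp[OF AE_lift[of h]], intro AE_I2 impI)
    fix t assume t: "t \<in> space arcm" and l: "lift h (cos t) = h t / sqrt (w t)"
    have "w t / sqrt (w t) = sqrt (w t)" using t w_pos[of t] by (intro real_div_sqrt) auto
    moreover have "poly (P j) (cos t) * lift h (cos t) * w t = poly (P j) (cos t) * h t * (w t / sqrt (w t))"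
      unfolding l by simp
    moreover have "u j t * h t = poly (P j) (cos t) * h t * sqrt (w t)" by (simp add: u_def mult_ac)
    ultimately show "u j t * h t = poly (P j) (cos t) * lift h (cos t) * w t" by (simp only:)
  qed
  have i2: "integrable arcm (\<lambda>t. poly (P j) (cos t) * lift h (cos t) * w t)"
    by (rule integrable_cong_AE_imp[OF i _ ae]) measurable
  show "integrable \<nu> (\<lambda>y. poly (P j) y * lift h y)"
    by (rule integral_jacobi_mass_measure(1)) (use i2 lift_node in \<open>auto simp: w_def A_def B_def\<close>)
  have "(LINT y|\<nu>. poly (P j) y * lift h y) = (LINT t|arcm. poly (P j) (cos t) * lift h (cos t) * w t)"
    unfolding w_def A_def B_def
    by (rule integral_jacobi_mass_measure(2)) (use i2 lift_node in \<open>auto simp: w_def A_def B_def\<close>)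
  also have "\<dots> = (LINT t|arcm. u j t * h t)"
    by (rule integral_cong_AE) (use ae in \<open>auto elim: AE_mp\<close>)
  finally show "(LINT y|\<nu>. poly (P j) y * lift h y) = (LINT t|arcm. u j t * h t)" .
qed

lemma partial_sum_lift:
  assumes "h \<in> borel_measurable borel" "\<And>t. \<bar>h t\<bar> \<le> H"
  shows "partial_sum_op \<nu> P n (lift h) x = (\<Sum>j\<le>n. poly (P j) x * (LINT t|arcm. u j t * h t))"
proof -
  note i = integral_poly_lift[OF assms]
  have "partial_sum_op \<nu> P n (lift h) x = (LINT y|\<nu>. (\<Sum>j\<le>n. poly (P j) x * (poly (P j) y * lift h y)))"
    unfolding partial_sum_op_def kernel_L_def by (simp add: sum_distrib_right mult.assoc)
  also have "\<dots> = (\<Sum>j\<le>n. poly (P j) x * (LINT y|\<nu>. poly (P j) y * lift h y))"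
    using i(1) by (subst Bochner_Integration.integral_sum) auto
  finally show ?thesis unfolding i(2) .
qed

lemma partial_sum_lift_measurable:
  assumes "h \<in> borel_measurable borel" "\<And>t. \<bar>h t\<bar> \<le> H"
  shows "partial_sum_op \<nu> P n (lift h) \<in> borel_measurable borel"
  unfolding partial_sum_lift[OF assms, abs_def]
  by (intro borel_measurable_sum borel_measurable_times borel_measurable_const poly_borel_measurable)

text \<open>As h vanishes wherever |cos t - cos s| < d, it can be divided by cos t - cos s; the
  Christoffel-Darboux formula then reduces n + 1 terms to two coefficients of a bounded
  function.\<close>

lemma partial_sum_lift_cos:
  assumes h: "h \<in> borel_measurable borel" "\<And>t. \<bar>h t\<bar> \<le> H"
    and d: "d > 0" "\<And>s. h s \<noteq> 0 \<Longrightarrow> d \<le> \<bar>cos t - cos s\<bar>"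
  shows "partial_sum_op \<nu> P n (lift h) (cos t) * sqrt (w t) = \<kappa> n / \<kappa> (Suc n) *
     (u (Suc n) t * (LINT s|arcm. h s / (cos t - cos s) * u n s) - u n t * (LINT s|arcm. h s / (cos t - cos s) * u (Suc n) s))"
proof -
  note [measurable] = h(1)
  define g where "g s = h s / (cos t - cos s)" for s
  have [measurable]: "g \<in> borel_measurable borel" unfolding g_def by measurable
  have gb: "\<bar>g s\<bar> \<le> H / d" for s
    unfolding g_def by (rule cauchy_kernel_bound[OF h(2) d])
  have iu: "integrable arcm (\<lambda>s. g s * u j s)" for j by (rule uh_integrable[OF _ gb]) measurable
  have ih: "integrable arcm (\<lambda>s. h s * u j s)" for j by (rule uh_integrable[OF h])
  have "partial_sum_op \<nu> P n (lift h) (cos t) * sqrt (w t) = (\<Sum>j\<le>n. u j t * (LINT s|arcm. h s * u j s))"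
    unfolding partial_sum_lift[OF h] sum_distrib_right
    by (intro sum.cong refl) (simp add: u_def[of _ t] mult_ac)
  also have "\<dots> = (LINT s|arcm. (\<Sum>j\<le>n. u j t * (h s * u j s)))"
    using ih by (subst Bochner_Integration.integral_sum) auto
  also have "\<dots> = (LINT s|arcm. \<kappa> n / \<kappa> (Suc n) * (u (Suc n) t * (g s * u n s) - u n t * (g s * u (Suc n) s)))"
  proof (intro Bochner_Integration.integral_cong refl)
    fix s
    have hg: "h s = g s * (cos t - cos s)" using d(1) d(2)[of s] by (cases "h s = 0") (auto simp: g_def)
    have "(\<Sum>j\<le>n. u j t * (h s * u j s)) = g s * ((cos t - cos s) * (\<Sum>j\<le>n. u j t * u j s))"
      unfolding hg by (simp add: sum_distrib_left mult_ac)
    also have "\<dots> = \<kappa> n / \<kappa> (Suc n) * (u (Suc n) t * (g s * u n s) - u n t * (g s * u (Suc n) s))"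
      unfolding christoffel_darboux_u by (simp only: right_diff_distrib mult_ac)
    finally show "(\<Sum>j\<le>n. u j t * (h s * u j s)) = \<kappa> n / \<kappa> (Suc n) * (u (Suc n) t * (g s * u n s) - u n t * (g s * u (Suc n) s))" .
  qed
  also have "\<dots> = \<kappa> n / \<kappa> (Suc n) * (u (Suc n) t * (LINT s|arcm. g s * u n s) - u n t * (LINT s|arcm. g s * u (Suc n) s))"
    using iu by simp
  finally show ?thesis by (simp add: g_def)
qed

text \<open>Lifting divides by sqrt(w), so the p-th power contributes w^(-p/2) against the weight w.
  The exponent 1 - p/2 is where the critical values of p enter.\<close>

lemma nn_integral_lift:
  assumes [measurable]: "h \<in> borel_measurable borel"
  shows "(\<integral>\<^sup>+x. ennreal (\<bar>lift h x\<bar> powr p) \<partial>\<nu>) = (\<integral>\<^sup>+t. ennreal (\<bar>h t\<bar> powr p * w t powr (1 - p / 2)) \<partial>arcm)"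
proof -
  have "(\<integral>\<^sup>+x. ennreal (\<bar>lift h x\<bar> powr p) \<partial>\<nu>) = (\<integral>\<^sup>+t. ennreal (\<bar>lift h (cos t)\<bar> powr p) * ennreal (w t) \<partial>arcm)"
    by (subst nn_integral_nu) (auto simp: lift_node)
  also have "\<dots> = (\<integral>\<^sup>+t. ennreal (\<bar>h t\<bar> powr p * w t powr (1 - p / 2)) \<partial>arcm)"
  proof (rule nn_integral_cong_AE, rule AE_mp[OF AE_lift[of h]], intro AE_I2 impI)
    fix t assume t: "t \<in> space arcm" and l: "lift h (cos t) = h t / sqrt (w t)"
    have wt: "w t > 0" using t w_pos by simp
    have "\<bar>lift h (cos t)\<bar> powr p * w t = \<bar>h t\<bar> powr p * (w t / (sqrt (w t)) powr p)"
      using wt by (simp add: l powr_divide)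
    also have "w t / (sqrt (w t)) powr p = w t powr 1 / w t powr (p / 2)"
      using wt by (simp add: powr_half_sqrt[symmetric] powr_powr)
    also have "\<dots> = w t powr (1 - p / 2)" by (simp add: powr_diff)
    finally show "ennreal (\<bar>lift h (cos t)\<bar> powr p) * ennreal (w t) = ennreal (\<bar>h t\<bar> powr p * w t powr (1 - p / 2))"
      using wt by (simp add: ennreal_mult'[symmetric])
  qed
  finally show ?thesis .
qed

end

section \<open>Partial sums of oscillating functions\<close>

lemma cauchy_integral_measurable:
  assumes [measurable]: "q \<in> borel_measurable borel"
  shows "(\<lambda>t. LINT s|arcm. q s / (cos t - cos s)) \<in> borel_measurable (borel :: real measure)"
proof -
  have eq: "(LINT s|arcm. q s / (cos t - cos s)) = (LINT s|lborel. indicat_real {0<..<pi} s *\<^sub>R (q s / (cos t - cos s)))" for t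
    unfolding arcm_def by (subst integral_restrict_space) auto
  show ?thesis unfolding eq
    by (rule lborel.borel_measurable_lebesgue_integral) measurable
qed

context jacobi_mass_system
begin

text \<open>The half-integer frequency makes both terms of the Christoffel-Darboux formula resonate.\<close>

definition osc :: "nat \<Rightarrow> real \<Rightarrow> real \<Rightarrow> real" where
  "osc n \<psi> t = cos ((real n + 1/2) * t + phase t + \<psi>)"

lemma osc_measurable [measurable]: "osc n \<psi> \<in> borel_measurable borel"
  unfolding osc_def[abs_def] by measurable

lemma osc_bound: "\<bar>osc n \<psi> t\<bar> \<le> 1"
  by (simp add: osc_def)

lemma integral_abs_u: "(LINT t|arcm. \<bar>u n t\<bar>) \<le> 2"
proof -
  have "(LINT t|arcm. \<bar>u n t\<bar>)\<^sup>2 \<le> pi * (LINT t|arcm. (u n t)\<^sup>2)"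
    by (rule square_integral_abs_le_arc[OF u_integrable u_square(1)])
  also have "\<dots> \<le> pi * 1" using u_square(2)[of n] by (intro mult_left_mono) auto
  also have "\<dots> \<le> 2\<^sup>2" using pi_less_4 by simp
  finally show ?thesis by (rule power2_le_imp_le) simp
qed

text \<open>Replacing u by v costs at most H times their L1 distance. In the product of the two
  cosines the difference frequency is independent of n and free of the phase, and survives as the
  limit; the sum has frequency of order 2n and vanishes by Riemann-Lebesgue.\<close>

lemma oscillating_coefficient_tendsto:
  assumes h [measurable]: "h \<in> borel_measurable borel" and H: "\<And>s. \<bar>h s\<bar> \<le> H"
  shows "(\<lambda>n. LINT s|arcm. h s * osc n \<psi> s * u (n + j) s)
    \<longlonglongrightarrow> sqrt (2 / pi) / 2 * (LINT s|arcm. h s * cos ((1/2 - real j) * s + \<psi>))"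
proof -
  define c where "c = sqrt (2 / pi) / 2"
  have H0: "H \<ge> 0" using H[of 0] by linarith
  have hi: "integrable arcm h" by (rule integrable_arc_bounded[OF _ H]) measurable
  have ib: "integrable arcm (\<lambda>s. h s * cos (e s))" if [measurable]: "e \<in> borel_measurable borel" for e
    using H H0 by (intro integrable_arc_bounded[of _ H])
      (measurable, simp add: abs_mult mult_left_le order_trans[OF mult_left_le[OF abs_cos_le_one abs_ge_zero]])
  have [measurable]: "(\<lambda>s. (1/2 + real j) * s + 2 * phase s + \<psi>) \<in> borel_measurable borel" by measurable
  have sub: "strict_mono (\<lambda>n::nat. 2 * n)" by (simp add: strict_mono_def)
  have RL: "(\<lambda>n. LINT s|arcm. h s * cos (real (2 * n) * s + ((1/2 + real j) * s + 2 * phase s + \<psi>))) \<longlonglongrightarrow> 0"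
    using LIMSEQ_subseq_LIMSEQ[OF riemann_lebesgue_arc[OF hi, of "\<lambda>s. (1/2 + real j) * s + 2 * phase s + \<psi>"] sub]
    unfolding o_def by measurable
  define U where "U n = (LINT s|arcm. h s * osc n \<psi> s * u (n + j) s)" for n
  define V where "V n = (LINT s|arcm. h s * osc n \<psi> s * v (n + j) s)" for n
  define D where "D n = (LINT s|arcm. \<bar>u (n + j) s - v (n + j) s\<bar>)" for n
  let ?a = "\<lambda>s. cos ((1/2 - real j) * s + \<psi>)"
  let ?b = "\<lambda>n s. cos (real (2 * n) * s + ((1/2 + real j) * s + 2 * phase s + \<psi>))"
  have main: "V n = c * (LINT s|arcm. h s * ?a s) + c * (LINT s|arcm. h s * ?b n s)" for n
  proof -
    have "h s * osc n \<psi> s * v (n + j) s = c * (h s * ?a s) + c * (h s * ?b n s)" for s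
    proof -
      have "osc n \<psi> s * cos (real (n + j) * s + phase s) = (?a s + ?b n s) / 2"
        unfolding osc_def cos_times_cos by (simp add: algebra_simps)
      then have "h s * osc n \<psi> s * v (n + j) s = h s * sqrt (2 / pi) * ((?a s + ?b n s) / 2)"
        unfolding v_def by (metis (no_types, lifting) mult.assoc mult.left_commute)
      then show ?thesis unfolding c_def by (simp only: distrib_left add_divide_distrib) (simp add: mult_ac)
    qed
    then have "V n = (LINT s|arcm. c * (h s * ?a s) + c * (h s * ?b n s))" by (simp only: V_def)
    moreover have 1: "integrable arcm (\<lambda>s. h s * ?a s)" by (rule ib) measurable
    moreover have 2: "integrable arcm (\<lambda>s. h s * ?b n s)" by (rule ib) measurable
    ultimately show ?thesis
      by (simp only: Bochner_Integration.integral_add[OF integrable_mult_right[OF 1] integrable_mult_right[OF 2]]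
        integral_mult_right_zero)
  qed
  have err: "\<bar>U n - V n\<bar> \<le> H * D n" for n
  proof -
    let ?d = "\<lambda>s. u (n + j) s - v (n + j) s"
    have ho: "\<bar>h s * osc n \<psi> s\<bar> \<le> H" for s
      unfolding abs_mult using H[of s] osc_bound[of n \<psi> s] by (metis abs_ge_zero mult_left_le order_trans)
    have iu: "integrable arcm (\<lambda>s. h s * osc n \<psi> s * u (n + j) s)"
      by (rule uh_integrable[OF _ ho]) measurable
    have iv: "integrable arcm (\<lambda>s. h s * osc n \<psi> s * v (n + j) s)"
    proof (rule integrable_arc_bounded)
      show "\<bar>h s * osc n \<psi> s * v (n + j) s\<bar> \<le> H * 1" for s
        unfolding abs_mult[of "h s * osc n \<psi> s"] by (intro mult_mono ho v_bound H0) auto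
    qed measurable
    have id: "integrable arcm (\<lambda>s. h s * osc n \<psi> s * ?d s)"
      using Bochner_Integration.integrable_diff[OF iu iv] by (simp only: right_diff_distrib)
    have iuv: "integrable arcm (\<lambda>s. H * \<bar>?d s\<bar>)"
      by (rule integrable_mult_right[OF integrable_abs[OF Bochner_Integration.integrable_diff[OF u_integrable v_integrable]]])
    have le: "\<bar>h s * osc n \<psi> s * ?d s\<bar> \<le> H * \<bar>?d s\<bar>" for s
      unfolding abs_mult[of "h s * osc n \<psi> s"] by (rule mult_right_mono[OF ho abs_ge_zero])
    have "U n - V n = (LINT s|arcm. h s * osc n \<psi> s * ?d s)"
      using iu iv by (simp add: U_def V_def right_diff_distrib)
    then have "\<bar>U n - V n\<bar> = \<bar>LINT s|arcm. h s * osc n \<psi> s * ?d s\<bar>" by (simp only:)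
    also have "\<dots> \<le> (LINT s|arcm. \<bar>h s * osc n \<psi> s * ?d s\<bar>)"
      by (rule integral_abs_bound)
    also have "\<dots> \<le> (LINT s|arcm. H * \<bar>?d s\<bar>)"
      by (rule integral_mono[OF integrable_abs[OF id] iuv le])
    finally show ?thesis by (simp only: D_def integral_mult_right_zero)
  qed
  have "D \<longlonglongrightarrow> 0"
    unfolding D_def[abs_def] by (rule LIMSEQ_ignore_initial_segment[OF uv_L1_tendsto])
  then have l0: "(\<lambda>n. H * D n) \<longlonglongrightarrow> 0" by (rule tendsto_mult_right_zero)
  have "(\<lambda>n. U n - V n) \<longlonglongrightarrow> 0"
  proof (rule Lim_null_comparison[OF _ l0])
    show "\<forall>\<^sub>F n in sequentially. norm (U n - V n) \<le> H * D n"
      unfolding real_norm_def by (intro always_eventually allI err)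
  qed
  moreover have "V \<longlonglongrightarrow> c * (LINT s|arcm. h s * ?a s) + c * 0"
    unfolding main[abs_def] by (intro tendsto_intros RL)
  ultimately have "(\<lambda>n. (U n - V n) + V n) \<longlonglongrightarrow> 0 + (c * (LINT s|arcm. h s * ?a s) + c * 0)"
    by (rule tendsto_add)
  then show ?thesis by (simp add: c_def U_def)
qed

lemma cis_shifted_phase_measurable: "(\<lambda>t. cis (1/2 * t + phase t + \<psi>)) \<in> borel_measurable borel"
proof -
  have "(\<lambda>t. 1/2 * t + phase t + \<psi>) \<in> borel_measurable borel" by measurable
  then show ?thesis by (rule measurable_compose[OF _ cis_measurable])
qed

text \<open>In L1 over X, \<open>W n\<close> is close to (v (Suc n) L 0 - v n L 1) / 2, which
  dominates k0 |osc|. The square of \<open>osc\<close> has mean value tending to 1/2 on X, whereas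
  at points with |W n| \<le> k0/4 it is at most 1/4 up to an error that vanishes in L1. Hence such
  points cannot fill X.\<close>

lemma partial_sum_large_set:
  fixes x0 x1 d k0 \<psi> \<psi>' :: real and g :: "real \<Rightarrow> real"
  assumes X: "0 < x0" "x0 < x1" "x1 < pi"
    and g [measurable]: "g \<in> borel_measurable borel" and G: "\<And>s. \<bar>g s\<bar> \<le> G"
    and d: "d > 0" "\<And>t s. t \<in> {x0..x1} \<Longrightarrow> g s \<noteq> 0 \<Longrightarrow> d \<le> \<bar>cos t - cos s\<bar>"
    and k0: "k0 > 0"
  defines "L j t \<equiv> sqrt (2 / pi) / 2 * (LINT s|arcm. g s / (cos t - cos s) * cos ((1/2 - real j) * s + \<psi>))"
  assumes low: "\<And>n t. t \<in> {x0..x1} \<Longrightarrow> k0 * \<bar>osc n \<psi>' t\<bar> \<le> \<bar>(v (Suc n) t * L 0 t - v n t * L 1 t) / 2\<bar>"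
  defines "W n t \<equiv> partial_sum_op \<nu> P n (lift (\<lambda>s. g s * osc n \<psi> s)) (cos t) * sqrt (w t)"
  shows "\<forall>\<^sub>F n in sequentially. (x1 - x0) / 8 \<le> (LINT t|arcm. indicator {t \<in> {x0..x1}. \<bar>W n t\<bar> > k0 / 4} t)"
proof -
  define X where "X = {x0..x1}"
  have [measurable]: "X \<in> sets borel" by (simp add: X_def)
  define \<rho> where "\<rho> n = \<kappa> n / \<kappa> (Suc n)" for n
  define q where "q t s = g s / (cos t - cos s)" for t s
  have [measurable]: "q t \<in> borel_measurable borel" for t unfolding q_def[abs_def] by measurable
  define H where "H = G / d"
  have G0: "G \<ge> 0" using G[of 0] by linarith
  have H0: "H \<ge> 0" using G0 d(1) by (simp add: H_def)
  have qH: "\<bar>q t s\<bar> \<le> H" if "t \<in> X" for t s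
    unfolding q_def H_def by (rule cauchy_kernel_bound[OF G d(1)]) (use d(2) that in \<open>simp add: X_def\<close>)
  have qoH: "\<bar>q t s * osc n \<psi> s\<bar> \<le> H" if "t \<in> X" for t s n
    unfolding abs_mult using qH[OF that, of s] osc_bound[of n \<psi> s] by (metis abs_ge_zero mult_left_le order_trans)
  define A where "A j n t = (LINT s|arcm. q t s * osc n \<psi> s * u (n + j) s)" for j n t
  have Am [measurable]: "A j n \<in> borel_measurable borel" for j n
  proof -
    have "A j n = (\<lambda>t. LINT s|arcm. (g s * osc n \<psi> s * u (n + j) s) / (cos t - cos s))"
      unfolding A_def[abs_def] q_def by (simp add: mult_ac)
    moreover have "\<dots> \<in> borel_measurable borel" by (rule cauchy_integral_measurable) measurable
    ultimately show ?thesis by (simp only:)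
  qed
  have Lm [measurable]: "L j \<in> borel_measurable borel" for j
  proof -
    have 1: "(\<lambda>t. LINT s|arcm. (g s * cos ((1/2 - real j) * s + \<psi>)) / (cos t - cos s)) \<in> borel_measurable borel"
      by (rule cauchy_integral_measurable) measurable
    have "L j = (\<lambda>t. sqrt (2 / pi) / 2 * (LINT s|arcm. (g s * cos ((1/2 - real j) * s + \<psi>)) / (cos t - cos s)))"
      unfolding L_def[abs_def] by (simp add: mult_ac)
    moreover have "\<dots> \<in> borel_measurable borel"
      by (rule borel_measurable_times[OF borel_measurable_const 1])
    ultimately show ?thesis by (simp only:)
  qed
  have AL: "(\<lambda>n. A j n t) \<longlonglongrightarrow> L j t" if "t \<in> X" for j t
    using oscillating_coefficient_tendsto[of "q t" H \<psi> j] qH[OF that] unfolding A_def L_def q_def by simp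
  have Ab: "\<bar>A j n t\<bar> \<le> H * 2" if "t \<in> X" for j n t
  proof -
    have "\<bar>A j n t\<bar> \<le> (LINT s|arcm. \<bar>q t s * osc n \<psi> s * u (n + j) s\<bar>)" unfolding A_def by (rule integral_abs_bound)
    also have "\<dots> \<le> (LINT s|arcm. H * \<bar>u (n + j) s\<bar>)"
    proof (rule integral_mono)
      show "integrable arcm (\<lambda>s. \<bar>q t s * osc n \<psi> s * u (n + j) s\<bar>)"
        by (rule integrable_abs[OF uh_integrable[OF _ qoH[OF that]]]) measurable
      show "integrable arcm (\<lambda>s. H * \<bar>u (n + j) s\<bar>)"
        by (rule integrable_mult_right[OF integrable_abs[OF u_integrable]])
      show "\<bar>q t s * osc n \<psi> s * u (n + j) s\<bar> \<le> H * \<bar>u (n + j) s\<bar>" for s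
        unfolding abs_mult[of "q t s * osc n \<psi> s"] by (intro mult_right_mono qoH that) auto
    qed
    also have "\<dots> \<le> H * 2" using integral_abs_u[of "n + j"] H0 by (simp add: mult_left_mono)
    finally show ?thesis .
  qed
  have Lb: "\<bar>L j t\<bar> \<le> H * 2" if "t \<in> X" for j t
    by (rule LIMSEQ_le_const2[OF tendsto_rabs[OF AL[OF that]]]) (use Ab[OF that] in auto)
  obtain R where R: "\<And>n. \<bar>\<rho> n\<bar> \<le> R"
  proof -
    have "Bseq \<rho>" unfolding \<rho>_def[abs_def] by (rule convergent_imp_Bseq[OF convergentI[OF kappa_ratio_tendsto]])
    then show ?thesis using that unfolding Bseq_def by (metis real_norm_def)
  qed
  \<comment> \<open>R bounds the ratios of leading coefficients, and \<open>H * 2\<close> bounds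
    \<open>A j n\<close> on X because the L1 norm of every \<open>u n\<close> is at most 2.\<close>
  define C where "C = R * (H * 2)"
  have C0: "C \<ge> 0" using R[of 0] H0 by (auto simp: C_def intro!: mult_nonneg_nonneg)
  have rA: "\<bar>\<rho> n * A j n t\<bar> \<le> C" if "t \<in> X" for n j t
    unfolding C_def abs_mult using R[of n] by (intro mult_mono Ab that) auto
  define e where "e j n t = \<bar>\<rho> n * A j n t - L j t / 2\<bar>" for j n t
  have em [measurable]: "e j n \<in> borel_measurable borel" for j n unfolding e_def[abs_def] by measurable
  have eb: "norm (indicator X t * e j n t) \<le> C + H * 2" for j n t
  proof (cases "t \<in> X")
    case True
    then show ?thesis using rA[OF True, of n j] Lb[OF True, of j] by (auto simp: e_def)
  next
    case False
    then show ?thesis using C0 H0 by simp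
  qed
  have e0: "(\<lambda>n. LINT t|arcm. indicator X t * e j n t) \<longlonglongrightarrow> 0" for j
  proof -
    have "(\<lambda>n. LINT t|arcm. indicator X t * e j n t) \<longlonglongrightarrow> (LINT t|arcm. 0)"
    proof (rule integral_dominated_convergence[where w="\<lambda>_. C + H * 2"])
      show "AE t in arcm. (\<lambda>n. indicator X t * e j n t) \<longlonglongrightarrow> 0"
      proof (rule AE_I2)
        fix t
        show "(\<lambda>n. indicator X t * e j n t) \<longlonglongrightarrow> 0"
        proof (cases "t \<in> X")
          case True
          have "(\<lambda>n. \<bar>\<rho> n * A j n t - L j t / 2\<bar>) \<longlonglongrightarrow> \<bar>1 / 2 * L j t - L j t / 2\<bar>"
            unfolding \<rho>_def by (intro tendsto_intros kappa_ratio_tendsto AL True)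
          then show ?thesis using True by (simp add: e_def)
        qed simp
      qed
      show "(\<lambda>t. indicator X t * e j n t) \<in> borel_measurable arcm" for n
        by (intro borel_measurable_arc borel_measurable_times borel_measurable_indicator em) measurable
      show "AE t in arcm. norm (indicator X t * e j n t) \<le> C + H * 2" for n
        by (intro AE_I2 eb)
    qed simp_all
    then show ?thesis by simp
  qed
  \<comment> \<open>The first two terms pay for replacing u by v, the last two for replacing the
    coefficients by their limits; the halves of \<open>L\<close> in \<open>e\<close> come from the
    limit 1/2 of the ratio \<open>\<rho> n\<close>.\<close>
  define \<Delta> where "\<Delta> n t = C * \<bar>u (n + 1) t - v (n + 1) t\<bar> + C * \<bar>u n t - v n t\<bar>
     + indicator X t * e 0 n t + indicator X t * e 1 n t" for n t
  have iuv: "integrable arcm (\<lambda>t. \<bar>u n t - v n t\<bar>)" for n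
    by (rule integrable_abs[OF Bochner_Integration.integrable_diff[OF u_integrable v_integrable]])
  have ie: "integrable arcm (\<lambda>t. indicator X t * e j n t)" for j n
  proof (rule integrable_arc_bounded)
    show "(\<lambda>t. indicator X t * e j n t) \<in> borel_measurable arcm"
      by (intro borel_measurable_arc borel_measurable_times borel_measurable_indicator em) measurable
    show "\<bar>indicator X t * e j n t\<bar> \<le> C + H * 2" for t using eb[of t j n] by (simp only: real_norm_def)
  qed
  have i\<Delta>: "integrable arcm (\<Delta> n)" for n
    unfolding \<Delta>_def[abs_def] by (intro Bochner_Integration.integrable_add integrable_mult_right iuv ie)
  have "(LINT t|arcm. \<Delta> n t) = C * (LINT t|arcm. \<bar>u (n + 1) t - v (n + 1) t\<bar>) + C * (LINT t|arcm. \<bar>u n t - v n t\<bar>)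
     + (LINT t|arcm. indicator X t * e 0 n t) + (LINT t|arcm. indicator X t * e 1 n t)" for n
    unfolding \<Delta>_def
    by (subst Bochner_Integration.integral_add, (intro Bochner_Integration.integrable_add integrable_mult_right iuv ie)+)+
       (simp only: integral_mult_right_zero)
  moreover have "(\<lambda>n. C * (LINT t|arcm. \<bar>u (n + 1) t - v (n + 1) t\<bar>) + C * (LINT t|arcm. \<bar>u n t - v n t\<bar>)
     + (LINT t|arcm. indicator X t * e 0 n t) + (LINT t|arcm. indicator X t * e 1 n t)) \<longlonglongrightarrow> C * 0 + C * 0 + 0 + 0"
    by (intro tendsto_add tendsto_mult tendsto_const e0 uv_L1_tendsto LIMSEQ_ignore_initial_segment[OF uv_L1_tendsto])
  ultimately have \<Delta>0: "(\<lambda>n. LINT t|arcm. \<Delta> n t) \<longlonglongrightarrow> 0" by simp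
  have go: "(\<lambda>s. g s * osc n \<psi> s) \<in> borel_measurable borel" "\<bar>g s * osc n \<psi> s\<bar> \<le> G" for n s
    subgoal by measurable
    subgoal unfolding abs_mult using G[of s] osc_bound[of n \<psi> s] by (metis abs_ge_zero mult_left_le order_trans)
    done
  have WT: "\<bar>W n t - (v (Suc n) t * L 0 t - v n t * L 1 t) / 2\<bar> \<le> \<Delta> n t" if t: "t \<in> X" for n t
  proof -
    have "W n t = \<rho> n * (u (Suc n) t * A 0 n t - u n t * A 1 n t)"
    proof -
      have dd: "d \<le> \<bar>cos t - cos s\<bar>" if "g s * osc n \<psi> s \<noteq> 0" for s
        using d(2)[of t s] t that by (auto simp: X_def)
      have "W n t = \<kappa> n / \<kappa> (Suc n) *
         (u (Suc n) t * (LINT s|arcm. g s * osc n \<psi> s / (cos t - cos s) * u n s)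
          - u n t * (LINT s|arcm. g s * osc n \<psi> s / (cos t - cos s) * u (Suc n) s))"
        unfolding W_def by (rule partial_sum_lift_cos[OF go d(1) dd])
      then show ?thesis unfolding A_def q_def \<rho>_def by simp
    qed
    then have eq: "W n t - (v (Suc n) t * L 0 t - v n t * L 1 t) / 2 =
       \<rho> n * A 0 n t * (u (n + 1) t - v (n + 1) t) - \<rho> n * A 1 n t * (u n t - v n t)
       + v (n + 1) t * (\<rho> n * A 0 n t - L 0 t / 2) - v n t * (\<rho> n * A 1 n t - L 1 t / 2)"
      by (simp add: algebra_simps diff_divide_distrib)
    have "\<bar>W n t - (v (Suc n) t * L 0 t - v n t * L 1 t) / 2\<bar> \<le> \<bar>\<rho> n * A 0 n t\<bar> * \<bar>u (n + 1) t - v (n + 1) t\<bar> + \<bar>\<rho> n * A 1 n t\<bar> * \<bar>u n t - v n t\<bar>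
       + \<bar>v (n + 1) t\<bar> * \<bar>\<rho> n * A 0 n t - L 0 t / 2\<bar> + \<bar>v n t\<bar> * \<bar>\<rho> n * A 1 n t - L 1 t / 2\<bar>"
      unfolding eq abs_mult[symmetric] by linarith
    also have "\<dots> \<le> C * \<bar>u (n + 1) t - v (n + 1) t\<bar> + C * \<bar>u n t - v n t\<bar>
       + 1 * \<bar>\<rho> n * A 0 n t - L 0 t / 2\<bar> + 1 * \<bar>\<rho> n * A 1 n t - L 1 t / 2\<bar>"
      by (rule add_mono[OF add_mono[OF add_mono[OF mult_right_mono[OF rA[OF t]] mult_right_mono[OF rA[OF t]]]
            mult_right_mono[OF v_bound]] mult_right_mono[OF v_bound]]) (rule abs_ge_zero)+
    also have "\<dots> = \<Delta> n t" using t by (simp add: \<Delta>_def e_def)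
    finally show ?thesis .
  qed
  define E where "E n = {t \<in> X. \<bar>W n t\<bar> > k0 / 4}" for n
  have Wm [measurable]: "W n \<in> borel_measurable borel" for n
    unfolding W_def[abs_def]
    by (intro borel_measurable_times measurable_compose[OF _ partial_sum_lift_measurable[OF go]]) measurable
  have Em [measurable]: "E n \<in> sets borel" for n
  proof -
    have "E n = X \<inter> {t \<in> space borel. \<bar>W n t\<bar> > k0 / 4}" by (auto simp: E_def)
    moreover have "{t \<in> space borel. \<bar>W n t\<bar> > k0 / 4} \<in> sets borel"
      by (rule borel_measurable_less[OF borel_measurable_const borel_measurable_abs[OF Wm]])
    ultimately show ?thesis using \<open>X \<in> sets borel\<close> by (simp only: sets.Int)
  qed
  have \<Delta>n: "\<Delta> n t \<ge> 0" for n t using C0 by (simp add: \<Delta>_def e_def)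
  \<comment> \<open>On X outside \<open>E n\<close>, |osc| is at most 1/4 + \<Delta>/k0, and osc^2
    \<le> |osc|; on \<open>E n\<close> the bound osc^2 \<le> 1 is enough.\<close>
  have pt: "(osc n \<psi>' t)\<^sup>2 * indicator X t \<le> indicator (E n) t + indicator X t / 4 + \<Delta> n t / k0" for n t
  proof (cases "t \<in> X")
    case False
    then show ?thesis using \<Delta>n[of n t] k0 by simp
  next
    case True
    let ?o = "\<bar>osc n \<psi>' t\<bar>"
    have o2: "(osc n \<psi>' t)\<^sup>2 \<le> ?o" using osc_bound[of n \<psi>' t]
      by (metis abs_ge_zero mult_left_le power2_abs power2_eq_square)
    show ?thesis
    proof (cases "t \<in> E n")
      case True
      moreover have "0 \<le> \<Delta> n t / k0" using \<Delta>n[of n t] k0 by simp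
      ultimately show ?thesis using \<open>t \<in> X\<close> o2 osc_bound[of n \<psi>' t] by simp
    next
      case False
      then have "\<bar>W n t\<bar> \<le> k0 / 4" using \<open>t \<in> X\<close> by (auto simp: E_def)
      moreover have "k0 * ?o \<le> \<bar>(v (Suc n) t * L 0 t - v n t * L 1 t) / 2\<bar>"
        using low[of t n] \<open>t \<in> X\<close> by (simp add: X_def)
      ultimately have "k0 * ?o \<le> k0 / 4 + \<Delta> n t" using WT[OF \<open>t \<in> X\<close>, of n] by linarith
      then have "?o \<le> 1 / 4 + \<Delta> n t / k0" using k0 by (simp add: field_simps)
      then show ?thesis using o2 False \<open>t \<in> X\<close> by simp
    qed
  qed
  have ind: "integrable arcm (indicat_real S)" if "S \<in> sets borel" for S
    by (rule integrable_arc_bounded[OF borel_measurable_arc[OF borel_measurable_indicator[OF that]], of 1])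
       (simp add: indicator_def)
  note iX = ind[OF \<open>X \<in> sets borel\<close>] and iE = ind[OF Em]
  have io: "integrable arcm (\<lambda>t. (osc n \<psi>' t)\<^sup>2 * indicator X t)" for n
  proof (rule integrable_arc_bounded)
    show "(\<lambda>t. (osc n \<psi>' t)\<^sup>2 * indicator X t) \<in> borel_measurable arcm"
      by (rule borel_measurable_arc[OF borel_measurable_times[OF borel_measurable_power[OF osc_measurable]
            borel_measurable_indicator[OF \<open>X \<in> sets borel\<close>]]])
    show "\<bar>(osc n \<psi>' t)\<^sup>2 * indicator X t\<bar> \<le> 1" for t
      using osc_bound[of n \<psi>' t] by (simp add: indicator_def abs_square_le_1)
  qed
  have IX: "(LINT t|arcm. indicat_real X t) = x1 - x0"
    unfolding X_def using X by (intro integral_arc_indicator) auto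
  have main: "(LINT t|arcm. (osc n \<psi>' t)\<^sup>2 * indicator X t) \<le> (LINT t|arcm. indicat_real (E n) t) + (x1 - x0) / 4 + (LINT t|arcm. \<Delta> n t) / k0" for n
  proof -
    have "(LINT t|arcm. (osc n \<psi>' t)\<^sup>2 * indicator X t) \<le> (LINT t|arcm. indicat_real (E n) t + indicat_real X t / 4 + \<Delta> n t / k0)"
      by (intro integral_mono pt io Bochner_Integration.integrable_add iE integrable_divide iX i\<Delta>)
    also have "\<dots> = (LINT t|arcm. indicat_real (E n) t) + (LINT t|arcm. indicat_real X t) / 4 + (LINT t|arcm. \<Delta> n t) / k0"
      by (subst Bochner_Integration.integral_add, (intro Bochner_Integration.integrable_add iE integrable_divide iX i\<Delta>)+)+
         (simp only: integral_divide_zero)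
    finally show ?thesis unfolding IX .
  qed
  have "(\<lambda>n. LINT t|arcm. (Re (cis (real n * t) * cis (1/2 * t + phase t + \<psi>')))\<^sup>2 * indicat_real X t)
     \<longlonglongrightarrow> (LINT t|arcm. (norm (cis (1/2 * t + phase t + \<psi>')))\<^sup>2 * indicat_real X t) / 2"
    by (rule tendsto_integral_Re_square[where B=1, OF cis_shifted_phase_measurable _ iX]) simp_all
  moreover have "Re (cis (real n * t) * cis (1/2 * t + phase t + \<psi>')) = osc n \<psi>' t" for n t
    unfolding cis_mult osc_def by (simp add: algebra_simps)
  ultimately have lo: "(\<lambda>n. LINT t|arcm. (osc n \<psi>' t)\<^sup>2 * indicat_real X t) \<longlonglongrightarrow> (x1 - x0) / 2"
    by (simp only: norm_cis power_one mult_1 IX)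
  \<comment> \<open>In sixteenths of the length of X: 7 from the mean square, less 4 for the term
    1/4 and 1 for the error, leave 2, that is 1/8.\<close>
  have "\<forall>\<^sub>F n in sequentially. 7 * (x1 - x0) / 16 < (LINT t|arcm. (osc n \<psi>' t)\<^sup>2 * indicat_real X t)"
    by (rule order_tendstoD[OF lo]) (use X in auto)
  moreover have "\<forall>\<^sub>F n in sequentially. (LINT t|arcm. \<Delta> n t) < k0 * ((x1 - x0) / 16)"
    by (rule order_tendstoD[OF \<Delta>0]) (use X k0 in auto)
  ultimately show ?thesis
  proof eventually_elim
    case (elim n)
    have "(LINT t|arcm. \<Delta> n t) / k0 \<le> (x1 - x0) / 16" using elim(2) k0 by (simp add: field_simps)
    then have "(x1 - x0) / 8 \<le> (LINT t|arcm. indicat_real (E n) t)" using elim(1) main[of n] by linarith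
    then show ?case by (simp add: E_def X_def)
  qed
qed

end

section \<open>Growth comparison and estimates near t = 0\<close>

lemma powr_growth_contradiction:
  fixes K D p :: real
  assumes "K > 0" "D \<ge> 0" "p > 1" and le: "\<And>T. T > 0 \<Longrightarrow> K * T \<le> D * T powr (1 / p)"
  shows False
proof -
  define e where "e = 1 - 1 / p"
  have e: "e > 0" using assms by (simp add: e_def)
  \<comment> \<open>Chosen so that T powr (1 - 1/p) = D/K + 1, just above the value D/K that the
    assumed bound allows.\<close>
  define T where "T = (D / K + 1) powr (1 / e)"
  have b: "D / K + 1 > 0" using assms by (simp add: add_nonneg_pos)
  then have T: "T > 0" by (simp add: T_def)
  have Te: "T powr e = D / K + 1" using b e by (simp add: T_def powr_powr)
  have "T = T powr (e + 1 / p)" using T by (simp add: e_def)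
  also have "\<dots> = (D / K + 1) * T powr (1 / p)" unfolding powr_add Te ..
  finally have "K * ((D / K + 1) * T powr (1 / p)) \<le> D * T powr (1 / p)" using le[OF T] by simp
  moreover have "K * ((D / K + 1) * T powr (1 / p)) = (D + K) * T powr (1 / p)"
    using \<open>K > 0\<close> by (simp add: field_simps)
  ultimately have "(D + K) * T powr (1 / p) \<le> D * T powr (1 / p)" by simp
  then show False using T assms by (simp add: mult_le_cancel_right)
qed

lemma sin_ge_half: assumes "0 \<le> x" "x \<le> (1::real)" shows "x / 2 \<le> sin x"
proof -
  have "\<bar>sin x - (\<Sum>m<3. sin_coeff m * x ^ m)\<bar> \<le> inverse (fact 3) * \<bar>x\<bar> ^ 3" by (rule Maclaurin_sin_bound)
  moreover have "(\<Sum>m<3. sin_coeff m * x ^ m) = x" by (simp add: eval_nat_numeral sin_coeff_def)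
  ultimately have "x - inverse (fact 3) * \<bar>x\<bar> ^ 3 \<le> sin x" by linarith
  moreover have "\<bar>x\<bar> ^ 3 \<le> x" using assms power_decreasing[of 1 3 x] by simp
  moreover have "inverse (fact 3) = (1 / 6 :: real)" by (simp add: eval_nat_numeral)
  ultimately show ?thesis using assms by simp
qed

lemma one_minus_cos_bounds:
  assumes "0 < t" "t \<le> (1::real)"
  shows "t\<^sup>2 / 8 \<le> 1 - cos t" "1 - cos t \<le> t\<^sup>2"
proof -
  have eq: "1 - cos t = 2 * (sin (t / 2))\<^sup>2"
    using cos_double_sin[of "t / 2"] by simp
  have lo: "(t / 2) / 2 \<le> sin (t / 2)" using assms by (intro sin_ge_half) auto
  have up: "sin (t / 2) \<le> t / 2" using assms by (intro sin_x_le_x) auto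
  have "((t / 2) / 2)\<^sup>2 \<le> (sin (t / 2))\<^sup>2" using assms lo by (intro power_mono) auto
  then show "t\<^sup>2 / 8 \<le> 1 - cos t" unfolding eq by (simp add: power_divide)
  have "(sin (t / 2))\<^sup>2 \<le> (t / 2)\<^sup>2" using assms lo up by (intro power_mono) auto
  then have "4 * (sin (t / 2))\<^sup>2 \<le> t\<^sup>2" by (simp add: power_divide)
  moreover have "0 \<le> (sin (t / 2))\<^sup>2" by simp
  ultimately show "1 - cos t \<le> t\<^sup>2" unfolding eq by linarith
qed

lemma cos_ge_half: "\<bar>x\<bar> \<le> 1 \<Longrightarrow> 1 / 2 \<le> cos (x::real)"
  using cos_monotone_0_pi_le[of "\<bar>x\<bar>" "pi / 3"] pi_gt3 by (simp add: cos_60)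

text \<open>With \<delta> = exp (- T) the logarithmic integral is exactly T, so that T can serve as
  the free parameter.\<close>

lemma integral_inverse_arc:
  assumes "T > 0"
  defines "\<delta> \<equiv> exp (- T)"
  shows "integrable arcm (\<lambda>s. indicator {\<delta>..1} s / s)" "(LINT s|arcm. indicator {\<delta>..1} s / s) = T"
proof -
  have \<delta>: "0 < \<delta>" "\<delta> < 1" using assms by auto
  show "integrable arcm (\<lambda>s. indicator {\<delta>..1} s / s)"
    using \<delta> by (intro integrable_arc_bounded[of _ "1 / \<delta>"]) (auto simp: indicator_def frac_le)
  have "(LINT s|arcm. indicator {\<delta>..1} s / s) = (LINT s|lborel. indicat_real {0<..<pi} s *\<^sub>R (indicator {\<delta>..1} s / s))"
    unfolding arcm_def by (subst integral_restrict_space) auto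
  also have "\<dots> = (LINT s|lborel. indicator {\<delta>..1} s *\<^sub>R (1 / s))"
    using \<delta> pi_gt3 by (intro Bochner_Integration.integral_cong) (auto simp: indicator_def)
  also have "\<dots> = ln 1 - ln \<delta>"
    using \<delta> by (intro integral_FTC_Icc)
      (auto intro!: derivative_eq_intros continuous_intros simp flip: has_real_derivative_iff_has_vector_derivative)
  finally show "(LINT s|arcm. indicator {\<delta>..1} s / s) = T" by (simp add: \<delta>_def)
qed

text \<open>At both critical exponents the p-th power of the test function has a density of this
  form, which makes its norm at most of order T^(1/p).\<close>

lemma nn_integral_arc_le_log:
  assumes T: "T > 0" and \<Gamma>: "\<Gamma> \<ge> 0" and le: "\<And>t. t \<in> {exp (- T)..1} \<Longrightarrow> F t \<le> \<Gamma> * (1 / t)"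
    and zero: "\<And>t. t \<notin> {exp (- T)..1} \<Longrightarrow> F t = 0"
  shows "(\<integral>\<^sup>+t. ennreal (F t) \<partial>arcm) \<le> ennreal (\<Gamma> * T)"
proof -
  let ?i = "\<lambda>t. \<Gamma> * (indicator {exp (- T)..1} t / t)"
  have "F t \<le> ?i t" for t using le[of t] zero[of t] by (cases "t \<in> {exp (- T)..1}") auto
  then have "(\<integral>\<^sup>+t. ennreal (F t) \<partial>arcm) \<le> (\<integral>\<^sup>+t. ennreal (?i t) \<partial>arcm)"
    by (intro nn_integral_mono ennreal_leI)
  also have "\<dots> = ennreal (LINT t|arcm. ?i t)"
    by (rule nn_integral_eq_integral[OF integrable_mult_right[OF integral_inverse_arc(1)[OF T]]])
       (use \<Gamma> in \<open>auto intro!: AE_I2\<close>)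
  also have "(LINT t|arcm. ?i t) = \<Gamma> * T"
    unfolding integral_mult_right_zero integral_inverse_arc(2)[OF T] ..
  finally show ?thesis .
qed

lemma integrable_cauchy_kernel:
  assumes [measurable]: "g \<in> borel_measurable borel" "e \<in> borel_measurable borel"
    and G: "\<And>s. \<bar>g s\<bar> \<le> G" and e: "\<And>s. \<bar>e s\<bar> \<le> 1"
    and d: "d > 0" "\<And>s. g s \<noteq> 0 \<Longrightarrow> d \<le> \<bar>cos t - cos s\<bar>"
  shows "integrable arcm (\<lambda>s. g s / (cos t - cos s) * e s)"
proof (rule integrable_arc_bounded)
  show "(\<lambda>s. g s / (cos t - cos s) * e s) \<in> borel_measurable arcm" by measurable
  have G0: "0 \<le> G" using G[of 0] by linarith
  show "\<bar>g s / (cos t - cos s) * e s\<bar> \<le> G / d * 1" for s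
    unfolding abs_mult using d(1) G0 e[of s] by (intro mult_mono cauchy_kernel_bound[OF G d]) auto
qed

section \<open>From large values to a weak type inequality\<close>

context jacobi_mass_system
begin

text \<open>On (0, 1] the factor 1 - cos t is comparable to t^2, hence the exponent 2A, and 1 + cos
  t stays between 1 and 2, so that B only enters the constants.\<close>

lemma w_two_sided: "\<exists>c1>0. \<exists>c2>0. \<forall>t. 0 < t \<longrightarrow> t \<le> 1 \<longrightarrow> c1 * t powr (2 * A) \<le> w t \<and> w t \<le> c2 * t powr (2 * A)"
proof -
  have "2 powr (- \<bar>B\<bar>) / 8 powr A * t powr (2 * A) \<le> w t \<and> w t \<le> 2 powr \<bar>B\<bar> * t powr (2 * A)" if t: "0 < t" "t \<le> 1" for t
  proof -
    note o = one_minus_cos_bounds[OF t]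
    have tt: "(t\<^sup>2) powr A = t powr (2 * A)"
      using t by (simp add: powr_powr flip: powr_numeral)
    have c: "1 \<le> 1 + cos t" "1 + cos t \<le> 2" using cos_ge_half[of t] t by auto
    have b1: "(1 + cos t) powr B \<le> 2 powr \<bar>B\<bar>"
    proof -
      have "(1 + cos t) powr B \<le> (1 + cos t) powr \<bar>B\<bar>" using c by (intro powr_mono) auto
      also have "\<dots> \<le> 2 powr \<bar>B\<bar>" using c by (intro powr_mono2) auto
      finally show ?thesis .
    qed
    have b2: "2 powr (- \<bar>B\<bar>) \<le> (1 + cos t) powr B"
    proof -
      have "2 powr (- \<bar>B\<bar>) \<le> (1 + cos t) powr (- \<bar>B\<bar>)" using c by (intro powr_mono2') auto
      also have "\<dots> \<le> (1 + cos t) powr B" using c by (intro powr_mono) auto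
      finally show ?thesis .
    qed
    have a1: "t powr (2 * A) / 8 powr A \<le> (1 - cos t) powr A"
    proof -
      have "(t\<^sup>2 / 8) powr A \<le> (1 - cos t) powr A" using o A_pos by (intro powr_mono2) auto
      then show ?thesis by (simp only: powr_divide tt)
    qed
    have a2: "(1 - cos t) powr A \<le> t powr (2 * A)"
    proof -
      have "(1 - cos t) powr A \<le> (t\<^sup>2) powr A" using o(2) A_pos by (intro powr_mono2) auto
      then show ?thesis by (simp only: tt)
    qed
    have "(t powr (2 * A) / 8 powr A) * 2 powr (- \<bar>B\<bar>) \<le> w t"
      unfolding w_def arc_weight_def by (intro mult_mono a1 b2) auto
    moreover have "w t \<le> t powr (2 * A) * 2 powr \<bar>B\<bar>"
      unfolding w_def arc_weight_def by (intro mult_mono a2 b1) auto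
    ultimately show ?thesis by (simp add: mult.commute)
  qed
  moreover have "2 powr (- \<bar>B\<bar>) / 8 powr A > 0" "2 powr \<bar>B\<bar> > 0" by auto
  ultimately show ?thesis by blast
qed

text \<open>For given g a single large n suffices. The lower bound m turns Lebesgue measure of
  angles into \<nu>-measure, the upper bound Mh turns a bound on S sqrt(w) into one on S, and N
  bounds the p-th power integral of f because |osc| \<le> 1.\<close>

lemma weak_type_estimate:
  fixes g :: "real \<Rightarrow> real" and \<psi> \<psi>' :: real
  assumes weak: "\<And>n f. in_Lp \<nu> p f \<Longrightarrow> weak_Lp_norm \<nu> p (partial_sum_op \<nu> P n f) \<le> ennreal C * Lp_norm \<nu> p f"
    and p: "p > 0" and X: "0 < x0" "x0 < x1" "x1 < pi"
    and g: "g \<in> borel_measurable borel" and G: "\<And>s. \<bar>g s\<bar> \<le> G"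
    and d: "d > 0" "\<And>t s. t \<in> {x0..x1} \<Longrightarrow> g s \<noteq> 0 \<Longrightarrow> d \<le> \<bar>cos t - cos s\<bar>"
    and N: "(\<integral>\<^sup>+t. ennreal (\<bar>g t\<bar> powr p * w t powr (1 - p / 2)) \<partial>arcm) \<le> ennreal N" "N \<ge> 0"
    and m: "m > 0" "\<And>t. t \<in> {x0..x1} \<Longrightarrow> m \<le> w t \<and> w t \<le> Mh"
    and k0: "k0 > 0"
  defines "L j t \<equiv> sqrt (2 / pi) / 2 * (LINT s|arcm. g s / (cos t - cos s) * cos ((1/2 - real j) * s + \<psi>))"
  assumes low: "\<And>n t. t \<in> {x0..x1} \<Longrightarrow> k0 * \<bar>osc n \<psi>' t\<bar> \<le> \<bar>(v (Suc n) t * L 0 t - v n t * L 1 t) / 2\<bar>"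
  shows "(m * (x1 - x0) / 16) powr (1 / p) * (k0 / (4 * sqrt Mh)) \<le> max C 0 * N powr (1 / p)"
proof -
  define h where "h n s = g s * osc n \<psi> s" for n s
  have h: "h n \<in> borel_measurable borel" "\<bar>h n t\<bar> \<le> \<bar>g t\<bar>" for n t
    unfolding h_def[abs_def] abs_mult
    by (rule borel_measurable_times[OF g osc_measurable], rule mult_left_le[OF osc_bound abs_ge_zero])
  obtain n where n: "(x1 - x0) / 8 \<le>
      (LINT t|arcm. indicat_real {t \<in> {x0..x1}. \<bar>partial_sum_op \<nu> P n (lift (h n)) (cos t) * sqrt (w t)\<bar> > k0 / 4} t)"
    using eventually_happens'[OF sequentially_bot partial_sum_large_set[OF X g G d k0 low[unfolded L_def]]]
    unfolding h_def[abs_def] by blast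
  define f where "f = lift (h n)"
  define S where "S = partial_sum_op \<nu> P n f"
  define E where "E = {t \<in> {x0..x1}. \<bar>S (cos t) * sqrt (w t)\<bar> > k0 / 4}"
  define s where "s = k0 / (4 * sqrt Mh)"
  have hG: "\<bar>h n t\<bar> \<le> G" for t using h(2)[of n t] G[of t] by linarith
  have Sm: "S \<in> borel_measurable borel" unfolding S_def f_def by (rule partial_sum_lift_measurable[OF h(1) hG])
  have Mh: "Mh > 0" using m(1) m(2)[of x0] X by auto
  have s: "s > 0" using k0 Mh by (simp add: s_def)
  have fI: "(\<integral>\<^sup>+x. ennreal (\<bar>f x\<bar> powr p) \<partial>\<nu>) \<le> ennreal N"
  proof -
    have "(\<integral>\<^sup>+x. ennreal (\<bar>f x\<bar> powr p) \<partial>\<nu>) = (\<integral>\<^sup>+t. ennreal (\<bar>h n t\<bar> powr p * w t powr (1 - p / 2)) \<partial>arcm)"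
      unfolding f_def by (rule nn_integral_lift[OF h(1)])
    also have "\<dots> \<le> (\<integral>\<^sup>+t. ennreal (\<bar>g t\<bar> powr p * w t powr (1 - p / 2)) \<partial>arcm)"
      using h(2) p by (intro nn_integral_mono ennreal_leI mult_right_mono powr_mono2) auto
    also note N(1)
    finally show ?thesis .
  qed
  have fm: "f \<in> borel_measurable \<nu>"
    unfolding f_def using lift_measurable[OF h(1)] by (simp only: measurable_cong_sets[OF sets_jacobi_mass_measure refl])
  have in_L: "in_Lp \<nu> p f"
    unfolding in_Lp_def using fm fI by (auto simp: le_less_trans)
  have norm: "Lp_norm \<nu> p f \<le> ennreal (N powr (1 / p))"
  proof -
    have "enn2real (\<integral>\<^sup>+x. ennreal (\<bar>f x\<bar> powr p) \<partial>\<nu>) \<le> N" using fI N(2) by (simp add: enn2real_leI)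
    then show ?thesis unfolding Lp_norm_def using p by (intro ennreal_leI powr_mono2) auto
  qed
  have SetE: "E \<in> sets borel"
  proof -
    have "(\<lambda>t. \<bar>S (cos t) * sqrt (w t)\<bar>) \<in> borel_measurable borel"
      using Sm by (intro borel_measurable_abs borel_measurable_times measurable_compose[OF _ Sm]) measurable
    then have "{t \<in> space borel. k0 / 4 < \<bar>S (cos t) * sqrt (w t)\<bar>} \<in> sets borel"
      by (rule borel_measurable_less[OF borel_measurable_const])
    moreover have "E = {x0..x1} \<inter> {t \<in> space borel. k0 / 4 < \<bar>S (cos t) * sqrt (w t)\<bar>}" by (auto simp: E_def)
    moreover have "{x0..x1} \<in> sets borel" by simp
    ultimately show ?thesis by (simp only: sets.Int)
  qed
  have SetS: "{x. s < \<bar>S x\<bar>} \<in> sets borel"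
  proof -
    have "{x. s < \<bar>S x\<bar>} = {x \<in> space borel. s < \<bar>S x\<bar>}" by (simp only: space_borel UNIV_I simp_thms)
    moreover have "{x \<in> space borel. s < \<bar>S x\<bar>} \<in> sets borel"
      by (rule borel_measurable_less[OF borel_measurable_const borel_measurable_abs[OF Sm]])
    ultimately show ?thesis by (simp only:)
  qed
  have EN: "(x1 - x0) / 8 \<le> (LINT t|arcm. indicat_real E t)"
    using n by (simp only: E_def S_def f_def)
  \<comment> \<open>Halving 1/8 to 1/16 supplies the strict inequality that
    \<open>weak_Lp_norm_ge\<close> asks for.\<close>
  have "ennreal (m * (x1 - x0) / 16) < ennreal (m * ((x1 - x0) / 8))"
  proof (rule ennreal_lessI)
    show "0 < m * ((x1 - x0) / 8)" using m(1) X(2) by simp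
    then show "m * (x1 - x0) / 16 < m * ((x1 - x0) / 8)" by linarith
  qed
  also have "\<dots> \<le> ennreal (m * (LINT t|arcm. indicat_real E t))"
    by (rule ennreal_leI[OF mult_left_mono[OF EN less_imp_le[OF m(1)]]])
  also have "\<dots> = ennreal m * (\<integral>\<^sup>+t. ennreal (indicat_real E t) \<partial>arcm)"
  proof -
    have iE: "integrable arcm (indicat_real E)"
      by (rule integrable_arc_bounded[OF borel_measurable_arc[OF borel_measurable_indicator[OF SetE]], of 1])
         (simp add: indicator_def)
    have "(\<integral>\<^sup>+t. ennreal (indicat_real E t) \<partial>arcm) = ennreal (LINT t|arcm. indicat_real E t)"
      by (rule nn_integral_eq_integral[OF iE AE_I2]) (rule indicator_pos_le)
    then show ?thesis by (simp only: ennreal_mult'[OF less_imp_le[OF m(1)]])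
  qed
  also have "\<dots> = (\<integral>\<^sup>+t. ennreal m * ennreal (indicat_real E t) \<partial>arcm)"
    by (rule nn_integral_cmult[symmetric])
       (rule measurable_compose[OF borel_measurable_arc[OF borel_measurable_indicator[OF SetE]] measurable_ennreal])
  also have "\<dots> \<le> (\<integral>\<^sup>+t. indicator {x. s < \<bar>S x\<bar>} (cos t) * ennreal (w t) \<partial>arcm)"
  proof (rule nn_integral_mono)
    fix t
    show "ennreal m * ennreal (indicat_real E t) \<le> indicator {x. s < \<bar>S x\<bar>} (cos t) * ennreal (w t)"
    proof (cases "t \<in> E")
      case True
      then have t: "t \<in> {x0..x1}" and big: "k0 / 4 < \<bar>S (cos t)\<bar> * sqrt (w t)"
        using w_nonneg[of t] by (auto simp: E_def abs_mult)
      have "\<bar>S (cos t)\<bar> * sqrt (w t) \<le> \<bar>S (cos t)\<bar> * sqrt Mh" using m(2)[OF t] by (intro mult_left_mono) auto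
      with big have "k0 / 4 < \<bar>S (cos t)\<bar> * sqrt Mh" by linarith
      then have "s < \<bar>S (cos t)\<bar>" using Mh by (simp add: s_def field_simps)
      then show ?thesis using True m(2)[OF t] m(1) by (simp add: ennreal_leI)
    qed simp
  qed
  also have "\<dots> \<le> (\<integral>\<^sup>+x. indicator {x. s < \<bar>S x\<bar>} x \<partial>\<nu>)"
    unfolding nn_integral_nu[OF borel_measurable_indicator[OF SetS]] by simp
  also have "\<dots> = emeasure \<nu> {x. s < \<bar>S x\<bar>}"
    by (rule nn_integral_indicator) (simp only: sets_jacobi_mass_measure SetS)
  finally have mea: "ennreal (m * (x1 - x0) / 16) < emeasure \<nu> {x \<in> space \<nu>. \<bar>S x\<bar> > s}"
    by (simp only: space_jacobi_mass_measure UNIV_I simp_thms)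
  have "ennreal ((m * (x1 - x0) / 16) powr (1 / p) * s) \<le> weak_Lp_norm \<nu> p S"
  proof (rule weak_Lp_norm_ge[OF _ mea])
    show "S \<in> borel_measurable \<nu>" using Sm by (simp only: measurable_cong_sets[OF sets_jacobi_mass_measure refl])
  qed (use m(1) X s in auto)
  also have "\<dots> \<le> ennreal C * Lp_norm \<nu> p f" unfolding S_def by (rule weak[OF in_L])
  \<comment> \<open>\<open>ennreal\<close> sends negative numbers to 0, so \<open>max C 0\<close>
    covers a negative C.\<close>
  also have "\<dots> \<le> ennreal (max C 0) * ennreal (N powr (1 / p))"
    by (intro mult_mono norm ennreal_leI) auto
  also have "\<dots> = ennreal (max C 0 * N powr (1 / p))" by (simp add: ennreal_mult)
  finally show ?thesis by (simp add: s_def ennreal_le_iff)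
qed

end

section \<open>The two endpoints\<close>

context jacobi_mass_system
begin

lemma sqrt_two_over_pi: "sqrt (2 / pi) * (sqrt (2 / pi) / 2) = 1 / pi"
  by simp

text \<open>X lives at the scale \<delta>: the bound for its measure is of order \<delta>^(2A+1),
  whose power 1/p is \<delta>^A, and this cancels sqrt(w) on X. The shift - pi/2 turns the slow
  factor into sin(s/2) with opposite signs for j = 0 and j = 1, so the two terms add up. Since cos t
  - cos s \<le> 1 - cos s = 2 sin(s/2)^2, the Cauchy integrand dominates 1/s.\<close>

lemma not_weak_type_upper:
  assumes p: "p = 4 * (\<alpha> + 1) / (2 * \<alpha> + 1)"
    and weak: "\<And>n f. in_Lp \<nu> p f \<Longrightarrow> weak_Lp_norm \<nu> p (partial_sum_op \<nu> P n f) \<le> ennreal C * Lp_norm \<nu> p f"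
  shows False
proof -
  have A: "A > 0" by (rule A_pos)
  have pA: "p = (2 * A + 1) / A" using alpha by (simp add: p A_def field_simps)
  have p2: "p > 2" using A by (simp add: pA field_simps)
  have pA': "(2 * A + 1) / p = A" using A by (simp add: pA)
  \<comment> \<open>Makes w^(1 - p/2) of order 1/t near 0.\<close>
  have ex: "2 * A * (1 - p / 2) = - 1" using A by (simp add: pA field_simps)
  obtain c1 c2 where c: "c1 > 0" "c2 > 0" and wb: "\<And>t. 0 < t \<Longrightarrow> t \<le> 1 \<Longrightarrow> c1 * t powr (2 * A) \<le> w t \<and> w t \<le> c2 * t powr (2 * A)"
    using w_two_sided by blast
  define \<Gamma> where "\<Gamma> = c1 powr (1 - p / 2)"
  have \<Gamma>: "\<Gamma> > 0" using c by (simp add: \<Gamma>_def)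
  \<comment> \<open>What remains on the left of \<open>weak_type_estimate\<close> once the powers of
    \<delta> have cancelled: \<open>2 powr A\<close> compares \<delta>/2 with \<delta>/4, and 8 pi
    is 4 times the 2 pi in T / (2 pi).\<close>
  define K where "K = (c1 / 16) powr (1 / p) / (2 powr A * (8 * pi * sqrt c2))"
  show False
  proof (rule powr_growth_contradiction)
    show "K > 0" using c by (simp add: K_def)
    show "0 \<le> max C 0 * \<Gamma> powr (1 / p)" by simp
    show "p > 1" using p2 by simp
    fix T :: real assume T: "T > 0"
    define \<delta> where "\<delta> = exp (- T)"
    have \<delta>: "0 < \<delta>" "\<delta> < 1" using T by (auto simp: \<delta>_def)
    define g where "g = indicat_real {\<delta>..1}"
    have gm: "g \<in> borel_measurable borel" unfolding g_def by (rule borel_measurable_indicator) simp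
    have g1: "\<bar>g s\<bar> \<le> 1" for s by (simp add: g_def indicator_def)
    define d where "d = cos (\<delta> / 2) - cos \<delta>"
    have d: "d > 0" unfolding d_def using \<delta> pi_gt3 cos_monotone_0_pi[of "\<delta>/2" \<delta>] by simp
    have diff: "d \<le> cos t - cos s" if "t \<in> {\<delta>/4..\<delta>/2}" "g s \<noteq> 0" for t s
    proof -
      have s: "\<delta> \<le> s" "s \<le> 1" using that(2) by (auto simp: g_def indicator_def split: if_splits)
      have "cos (\<delta>/2) \<le> cos t" using that(1) \<delta> pi_gt3 by (intro cos_monotone_0_pi_le) auto
      moreover have "cos s \<le> cos \<delta>" using s \<delta> pi_gt3 by (intro cos_monotone_0_pi_le) auto
      ultimately show ?thesis by (simp add: d_def)
    qed
    define I where "I t = (LINT s|arcm. g s / (cos t - cos s) * sin (s / 2))" for t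
    have I: "T \<le> I t" if t: "t \<in> {\<delta>/4..\<delta>/2}" for t
    proof -
      have "(LINT s|arcm. indicator {\<delta>..1} s / s) \<le> I t"
        unfolding I_def
      proof (rule integral_mono)
        show "integrable arcm (\<lambda>s. indicator {\<delta>..1} s / s)"
          unfolding \<delta>_def by (rule integral_inverse_arc(1)[OF T])
        show "integrable arcm (\<lambda>s. g s / (cos t - cos s) * sin (s / 2))"
          by (rule integrable_cauchy_kernel[OF gm _ g1 _ d]) (use diff[OF t] in \<open>auto intro: order_trans[OF _ abs_ge_self]\<close>)
        fix s
        show "indicator {\<delta>..1} s / s \<le> g s / (cos t - cos s) * sin (s / 2)"
        proof (cases "s \<in> {\<delta>..1}")
          case True
          then have gs: "g s = 1" and s: "0 < s" "s \<le> 1" using \<delta> by (auto simp: g_def)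
          have s2: "0 < sin (s / 2)" "sin (s / 2) \<le> s / 2"
            using s pi_gt3 sin_x_le_x[of "s / 2"] by (auto intro!: sin_gt_zero)
          have den: "0 < cos t - cos s" using diff[OF t, of s] gs d by simp
          have "cos t - cos s \<le> 1 - cos s" by simp
          also have "\<dots> = sin (s/2) * (2 * sin (s/2))" using cos_double_sin[of "s / 2"] by (simp add: power2_eq_square)
          also have "\<dots> \<le> sin (s/2) * s" using s2 by (intro mult_left_mono) auto
          finally have "1 / s \<le> sin (s/2) / (cos t - cos s)"
            using den s by (simp add: field_simps)
          then show ?thesis using True gs by simp
        qed (simp add: g_def)
      qed
      then show ?thesis using integral_inverse_arc(2)[OF T] by (simp add: \<delta>_def)
    qed
    have N: "(\<integral>\<^sup>+t. ennreal (\<bar>g t\<bar> powr p * w t powr (1 - p / 2)) \<partial>arcm) \<le> ennreal (\<Gamma> * T)"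
    proof (rule nn_integral_arc_le_log[OF T less_imp_le[OF \<Gamma>], folded \<delta>_def])
      fix t assume True: "t \<in> {\<delta>..1}"
      then have t: "0 < t" "t \<le> 1" using \<delta> by auto
      have "w t powr (1 - p / 2) \<le> (c1 * t powr (2 * A)) powr (1 - p / 2)"
        using wb[OF t] c t p2 by (intro powr_mono2') auto
      also have "\<dots> = \<Gamma> * t powr (2 * A * (1 - p / 2))"
        by (simp only: powr_mult powr_powr \<Gamma>_def)
      also have "\<dots> = \<Gamma> * (1 / t)" unfolding ex using t by (simp add: powr_minus_divide)
      finally show "\<bar>g t\<bar> powr p * w t powr (1 - p / 2) \<le> \<Gamma> * (1 / t)" using True by (simp add: g_def)
    qed (simp add: g_def)
    have "(c1 * (\<delta>/4) powr (2 * A) * (\<delta>/2 - \<delta>/4) / 16) powr (1 / p) * ((T / (2 * pi)) / (4 * sqrt (c2 * (\<delta>/2) powr (2 * A))))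
        \<le> max C 0 * (\<Gamma> * T) powr (1 / p)"
    proof (rule weak_type_estimate[OF weak _ _ _ _ gm g1 d _ N, where \<psi>="- pi/2" and \<psi>'=0])
      show "p > 0" using p2 by simp
      show "0 < \<delta>/4" "\<delta>/4 < \<delta>/2" "\<delta>/2 < pi" using \<delta> pi_gt3 by auto
      show "d \<le> \<bar>cos t - cos s\<bar>" if "t \<in> {\<delta>/4..\<delta>/2}" "g s \<noteq> 0" for t s using diff[OF that] by linarith
      show "0 \<le> \<Gamma> * T" using \<Gamma> T by simp
      show "0 < c1 * (\<delta>/4) powr (2 * A)" using c \<delta> by simp
      show "0 < T / (2 * pi)" using T by simp
      show "c1 * (\<delta>/4) powr (2 * A) \<le> w t \<and> w t \<le> c2 * (\<delta>/2) powr (2 * A)" if t: "t \<in> {\<delta>/4..\<delta>/2}" for t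
      proof -
        have "c1 * (\<delta>/4) powr (2 * A) \<le> c1 * t powr (2 * A)" "c2 * t powr (2 * A) \<le> c2 * (\<delta>/2) powr (2 * A)"
          using t c \<delta> A by (auto intro!: powr_mono2)
        moreover have "c1 * t powr (2 * A) \<le> w t \<and> w t \<le> c2 * t powr (2 * A)"
          using t \<delta> by (intro wb) auto
        ultimately show ?thesis by linarith
      qed
      fix n t assume t: "t \<in> {\<delta>/4..\<delta>/2}"
      let ?L = "\<lambda>j. sqrt (2 / pi) / 2 * (LINT s|arcm. g s / (cos t - cos s) * cos ((1/2 - real j) * s + (- pi/2)))"
      have c0: "cos ((1/2 - real 0) * s + (- pi/2)) = sin (s / 2)" for s :: real
        by (simp add: cos_diff)
      have c1: "cos ((1/2 - real 1) * s + (- pi/2)) = - sin (s / 2)" for s :: real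
        by (simp add: cos_diff)
      have L0: "?L 0 = sqrt (2 / pi) / 2 * I t" unfolding c0 I_def ..
      have L1: "?L 1 = - (sqrt (2 / pi) / 2 * I t)" unfolding c1 I_def by simp
      \<comment> \<open>The frequencies n and n + 1 have mean n + 1/2, so their sum is the
        oscillation \<open>osc n 0\<close> with the slow factor cos(t/2), which is at least 1/2 on
        X.\<close>
      have sum: "cos (real (Suc n) * t + phase t) + cos (real n * t + phase t) = 2 * (osc n 0 t * cos (t / 2))"
        unfolding osc_def cos_times_cos by (simp add: algebra_simps)
      have "(v (Suc n) t * ?L 0 - v n t * ?L 1) / 2 = sqrt (2 / pi) * (sqrt (2 / pi) / 2) * I t *
          (cos (real (Suc n) * t + phase t) + cos (real n * t + phase t)) / 2"
        unfolding L0 L1 v_def by (simp only: distrib_left mult_minus_right diff_minus_eq_add) (simp only: mult_ac)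
      also have "\<dots> = I t / pi * (osc n 0 t * cos (t / 2))"
        unfolding sqrt_two_over_pi sum by simp
      finally have eq: "(v (Suc n) t * ?L 0 - v n t * ?L 1) / 2 = I t / pi * (osc n 0 t * cos (t / 2))" .
      have ct: "1 / 2 \<le> cos (t / 2)" using t \<delta> by (intro cos_ge_half) auto
      have "T / (2 * pi) * \<bar>osc n 0 t\<bar> = T / pi * (\<bar>osc n 0 t\<bar> * (1 / 2))" by simp
      also have "\<dots> \<le> I t / pi * (\<bar>osc n 0 t\<bar> * cos (t / 2))"
        using I[OF t] T ct by (intro mult_mono divide_right_mono) auto
      also have "\<dots> = \<bar>I t / pi * (osc n 0 t * cos (t / 2))\<bar>"
        using I[OF t] T ct by (simp add: abs_mult)
      finally show "T / (2 * pi) * \<bar>osc n 0 t\<bar> \<le> \<bar>(v (Suc n) t * ?L 0 - v n t * ?L 1) / 2\<bar>" unfolding eq .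
    qed
    moreover have "(c1 * (\<delta>/4) powr (2 * A) * (\<delta>/2 - \<delta>/4) / 16) powr (1 / p) * ((T / (2 * pi)) / (4 * sqrt (c2 * (\<delta>/2) powr (2 * A)))) = K * T"
    proof -
      have d4: "\<delta>/2 - \<delta>/4 = (\<delta>/4) powr 1" using \<delta> by simp
      have "c1 * (\<delta>/4) powr (2 * A) * (\<delta>/2 - \<delta>/4) / 16 = (c1 / 16) * (\<delta>/4) powr (2 * A + 1)"
        unfolding d4 powr_add by simp
      then have "(c1 * (\<delta>/4) powr (2 * A) * (\<delta>/2 - \<delta>/4) / 16) powr (1 / p) = (c1 / 16) powr (1 / p) * (\<delta>/4) powr ((2 * A + 1) / p)"
        by (simp only: powr_mult powr_powr times_divide_eq_right mult_1_right)
      also have "\<dots> = (c1 / 16) powr (1 / p) * (\<delta>/4) powr A" unfolding pA' ..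
      finally have 1: "(c1 * (\<delta>/4) powr (2 * A) * (\<delta>/2 - \<delta>/4) / 16) powr (1 / p) = (c1 / 16) powr (1 / p) * (\<delta>/4) powr A" .
      have 2: "sqrt (c2 * (\<delta>/2) powr (2 * A)) = sqrt c2 * (\<delta>/2) powr A"
      proof -
        have "(\<delta>/2) powr (2 * A) = ((\<delta>/2) powr A)\<^sup>2" by (simp add: power2_eq_square flip: powr_add)
        then show ?thesis by (simp add: real_sqrt_mult)
      qed
      have "(\<delta>/2) powr A = (2 * (\<delta>/4)) powr A" by simp
      then have 3: "(\<delta>/2) powr A = 2 powr A * (\<delta>/4) powr A" by (simp only: powr_mult)
      have "(\<delta>/4) powr A > 0" using \<delta> by simp
      then show ?thesis unfolding 1 2 3 K_def using c \<delta> by (simp add: field_simps)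
    qed
    moreover have "(\<Gamma> * T) powr (1 / p) = \<Gamma> powr (1 / p) * T powr (1 / p)" by (rule powr_mult)
    ultimately show "K * T \<le> max C 0 * \<Gamma> powr (1 / p) * T powr (1 / p)" by (simp only: mult.assoc)
  qed
qed

text \<open>The logarithm comes from s near 0, far from X, where cos s - cos t is bounded above and
  below. With shift 0 the slow factor is cos(s/2), bounded below on the support of g, whereas
  sin(s/2) would cancel the singularity 1/s.\<close>

lemma not_weak_type_lower:
  assumes p: "p = 4 * (\<alpha> + 1) / (2 * \<alpha> + 3)"
    and weak: "\<And>n f. in_Lp \<nu> p f \<Longrightarrow> weak_Lp_norm \<nu> p (partial_sum_op \<nu> P n f) \<le> ennreal C * Lp_norm \<nu> p f"
  shows False
proof -
  have A: "A > 0" by (rule A_pos)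
  have pA: "p = (2 * A + 1) / (A + 1)" using alpha by (simp add: p A_def field_simps)
  have p1: "p > 1" using A by (simp add: pA field_simps)
  have p2: "1 - p / 2 > 0" using A by (simp add: pA field_simps)
  \<comment> \<open>Makes |g|^p w^(1 - p/2) of order s^(-p) s^(p-1) = 1/s near 0.\<close>
  have ex: "2 * A * (1 - p / 2) = p - 1"
  proof -
    have "p * (A + 1) = 2 * A + 1" using A by (simp add: pA)
    then show ?thesis by (simp add: algebra_simps)
  qed
  obtain c1 c2 where c: "c1 > 0" "c2 > 0" and wb: "\<And>t. 0 < t \<Longrightarrow> t \<le> 1 \<Longrightarrow> c1 * t powr (2 * A) \<le> w t \<and> w t \<le> c2 * t powr (2 * A)"
    using w_two_sided by blast
  have X: "0 < (2::real)" "2 < (5/2::real)" "5/2 < pi" using pi_gt3 by auto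
  \<comment> \<open>The interval lies strictly between 1 and pi, hence apart from the support of g
    and from the endpoint pi, where the weight may vanish or blow up; compactness gives both
    bounds.\<close>
  obtain m Mh where m: "m > 0" "\<And>t. t \<in> {2..5/2} \<Longrightarrow> m \<le> w t \<and> w t \<le> Mh"
  proof -
    have sub: "t \<in> {0<..<pi}" if "t \<in> {2..5/2}" for t using that X by auto
    have cont: "continuous_on {2..5/2} w"
      unfolding w_def arc_weight_def
      by (intro continuous_intros) (use cos_arc[OF sub] in force)+
    obtain t1 where t1: "t1 \<in> {2..5/2}" "\<And>t. t \<in> {2..5/2} \<Longrightarrow> w t1 \<le> w t"
      using continuous_attains_inf[OF _ _ cont] by force
    obtain t2 where t2: "t2 \<in> {2..5/2}" "\<And>t. t \<in> {2..5/2} \<Longrightarrow> w t \<le> w t2"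
      using continuous_attains_sup[OF _ _ cont] by force
    show ?thesis by (rule that[of "w t1" "w t2"]) (use t1 t2 w_pos[OF sub[OF t1(1)]] in auto)
  qed
  have Mh: "Mh > 0" using m(1) m(2)[of 2] by simp
  define \<Gamma> where "\<Gamma> = c2 powr (1 - p / 2)"
  have \<Gamma>: "\<Gamma> > 0" using c by (simp add: \<Gamma>_def)
  \<comment> \<open>32 pi is 4 times the 8 pi in T / (8 pi), which in turn combines 1/4 from the
    bound on I with 1/2 from sin(t/2).\<close>
  define K where "K = (m * (5/2 - 2) / 16) powr (1 / p) / (32 * pi * sqrt Mh)"
  show False
  proof (rule powr_growth_contradiction)
    show "K > 0" using m(1) Mh by (simp add: K_def)
    show "0 \<le> max C 0 * \<Gamma> powr (1 / p)" by simp
    show "p > 1" by (rule p1)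
    fix T :: real assume T: "T > 0"
    define \<delta> where "\<delta> = exp (- T)"
    have \<delta>: "0 < \<delta>" "\<delta> < 1" using T by (auto simp: \<delta>_def)
    define g where "g s = indicat_real {\<delta>..1} s / s" for s
    have gm: "g \<in> borel_measurable borel" unfolding g_def[abs_def] by measurable
    have g1: "\<bar>g s\<bar> \<le> 1 / \<delta>" for s using \<delta> by (simp add: g_def indicator_def frac_le)
    define d where "d = cos 1 - cos (2::real)"
    have d: "d > 0" unfolding d_def using pi_gt3 cos_monotone_0_pi[of 1 2] by simp
    have diff: "d \<le> cos s - cos t" if "t \<in> {2..5/2}" "g s \<noteq> 0" for t s
    proof -
      have s: "\<delta> \<le> s" "s \<le> 1" using that(2) by (auto simp: g_def indicator_def split: if_splits)
      have "cos t \<le> cos 2" using that(1) X by (intro cos_monotone_0_pi_le) auto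
      moreover have "cos 1 \<le> cos s" using s \<delta> pi_gt3 by (intro cos_monotone_0_pi_le) auto
      ultimately show ?thesis by (simp add: d_def)
    qed
    define I where "I t = (LINT s|arcm. g s / (cos t - cos s) * cos (s / 2))" for t
    have I: "T / 4 \<le> - I t" if t: "t \<in> {2..5/2}" for t
    proof -
      have "(LINT s|arcm. 1 / 4 * (indicator {\<delta>..1} s / s)) \<le> (LINT s|arcm. - (g s / (cos t - cos s) * cos (s / 2)))"
      proof (rule integral_mono)
        show "integrable arcm (\<lambda>s. 1 / 4 * (indicator {\<delta>..1} s / s))"
          unfolding \<delta>_def by (rule integrable_mult_right[OF integral_inverse_arc(1)[OF T]])
        show "integrable arcm (\<lambda>s. - (g s / (cos t - cos s) * cos (s / 2)))"
          by (rule Bochner_Integration.integrable_minus, rule integrable_cauchy_kernel[OF gm _ g1 _ d])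
             (use diff[OF t] in \<open>auto intro: order_trans[OF _ abs_ge_minus_self]\<close>)
        fix s
        show "1 / 4 * (indicator {\<delta>..1} s / s) \<le> - (g s / (cos t - cos s) * cos (s / 2))"
        proof (cases "s \<in> {\<delta>..1}")
          case True
          then have gs: "g s = 1 / s" and s: "0 < s" "s \<le> 1" using \<delta> by (auto simp: g_def)
          have den: "0 < cos s - cos t" using diff[OF t, of s] gs s d by simp
          have den2: "cos s - cos t \<le> 2" using cos_le_one[of s] cos_ge_minus_one[of t] by linarith
          have c2: "1 / 2 \<le> cos (s / 2)" using s by (intro cos_ge_half) auto
          have "1 / 4 = (1 / 2) / (2::real)" by simp
          also have "\<dots> \<le> cos (s / 2) / (cos s - cos t)" using den den2 c2 by (intro frac_le) auto
          finally have "1 / s * (1 / 4) \<le> 1 / s * (cos (s / 2) / (cos s - cos t))"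
            using s by (intro mult_left_mono) auto
          also have "\<dots> = - (g s / (cos t - cos s) * cos (s / 2))"
          proof -
            define y where "y = cos s - cos t"
            have e: "cos t - cos s = - y" by (simp add: y_def)
            show ?thesis unfolding gs e y_def[symmetric] by simp
          qed
          finally show ?thesis using True by simp
        qed (simp add: g_def)
      qed
      moreover have "(LINT s|arcm. 1 / 4 * (indicator {\<delta>..1} s / s)) = 1 / 4 * T"
        unfolding integral_mult_right_zero \<delta>_def integral_inverse_arc(2)[OF T] ..
      moreover have "(LINT s|arcm. - (g s / (cos t - cos s) * cos (s / 2))) = - I t"
        unfolding I_def by (rule integral_minus)
      ultimately show ?thesis by linarith
    qed
    have N: "(\<integral>\<^sup>+t. ennreal (\<bar>g t\<bar> powr p * w t powr (1 - p / 2)) \<partial>arcm) \<le> ennreal (\<Gamma> * T)"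
    proof (rule nn_integral_arc_le_log[OF T less_imp_le[OF \<Gamma>], folded \<delta>_def])
      fix t assume True: "t \<in> {\<delta>..1}"
      then have t: "0 < t" "t \<le> 1" using \<delta> by auto
      have "w t powr (1 - p / 2) \<le> (c2 * t powr (2 * A)) powr (1 - p / 2)"
        using wb[OF t] w_nonneg[of t] p2 by (intro powr_mono2) auto
      also have "\<dots> = \<Gamma> * t powr (2 * A * (1 - p / 2))"
        by (simp only: powr_mult powr_powr \<Gamma>_def)
      also have "\<dots> = \<Gamma> * t powr (p - 1)" unfolding ex ..
      finally have "\<bar>g t\<bar> powr p * w t powr (1 - p / 2) \<le> (1 / t) powr p * (\<Gamma> * t powr (p - 1))"
        using True t by (intro mult_mono) (auto simp: g_def)
      also have "\<dots> = \<Gamma> * (1 / t)"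
        using t by (simp add: powr_divide powr_diff)
      finally show "\<bar>g t\<bar> powr p * w t powr (1 - p / 2) \<le> \<Gamma> * (1 / t)" .
    qed (simp add: g_def)
    have "(m * (5/2 - 2) / 16) powr (1 / p) * ((T / (8 * pi)) / (4 * sqrt Mh)) \<le> max C 0 * (\<Gamma> * T) powr (1 / p)"
    proof (rule weak_type_estimate[OF weak _ X gm g1 d _ N _ m, where \<psi>=0 and \<psi>'="- pi/2"])
      show "p > 0" using p1 by simp
      show "d \<le> \<bar>cos t - cos s\<bar>" if "t \<in> {2..5/2}" "g s \<noteq> 0" for t s using diff[OF that] by linarith
      show "0 \<le> \<Gamma> * T" using \<Gamma> T by simp
      show "0 < T / (8 * pi)" using T by simp
      fix n t assume t: "t \<in> {2..5/2::real}"
      let ?L = "\<lambda>j. sqrt (2 / pi) / 2 * (LINT s|arcm. g s / (cos t - cos s) * cos ((1/2 - real j) * s + 0))"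
      have c0: "cos ((1/2 - real 0) * s + 0) = cos (s / 2)" for s :: real by simp
      have c1: "cos ((1/2 - real 1) * s + 0) = cos (s / 2)" for s :: real by simp
      have L0: "?L 0 = sqrt (2 / pi) / 2 * I t" unfolding c0 I_def ..
      have L1: "?L 1 = sqrt (2 / pi) / 2 * I t" unfolding c1 I_def ..
      \<comment> \<open>Here the coefficients for j = 0 and j = 1 coincide, so the difference of
        neighbouring frequencies enters. It carries the factor sin(t/2), bounded below on X, and a
        quarter period shift, whence \<psi>' = - pi/2.\<close>
      have sum: "cos (real (Suc n) * t + phase t) - cos (real n * t + phase t) = - 2 * (osc n (- pi/2) t * sin (t / 2))"
      proof -
        define x where "x = (real n + 1/2) * t + phase t"
        have "osc n (- pi/2) t = sin x"
          unfolding osc_def x_def by (simp add: cos_diff)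
        moreover have "real (Suc n) * t + phase t = x + t / 2" "real n * t + phase t = x - t / 2"
          by (simp_all add: x_def algebra_simps)
        ultimately show ?thesis by (simp only: cos_add cos_diff)
      qed
      have "(v (Suc n) t * ?L 0 - v n t * ?L 1) / 2 = sqrt (2 / pi) * (sqrt (2 / pi) / 2) * I t *
          (cos (real (Suc n) * t + phase t) - cos (real n * t + phase t)) / 2"
        unfolding L0 L1 v_def by (simp only: right_diff_distrib) (simp only: mult_ac)
      also have "\<dots> = - I t / pi * (osc n (- pi/2) t * sin (t / 2))"
        unfolding sqrt_two_over_pi sum by simp
      finally have eq: "(v (Suc n) t * ?L 0 - v n t * ?L 1) / 2 = - I t / pi * (osc n (- pi/2) t * sin (t / 2))" .
      have st: "1 / 2 \<le> sin (t / 2)"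
      proof -
        have "1 / 2 \<le> sin (1::real)" using sin_ge_half[of 1] by simp
        also have "\<dots> \<le> sin (t / 2)" using t pi_gt3 by (intro sin_monotone_2pi_le) auto
        finally show ?thesis .
      qed
      have In: "- I t / pi \<ge> 0" using I[OF t] T by (intro divide_nonneg_pos) auto
      have "T / (8 * pi) * \<bar>osc n (- pi/2) t\<bar> = (T / 4) / pi * (\<bar>osc n (- pi/2) t\<bar> * (1 / 2))" by simp
      also have "\<dots> \<le> - I t / pi * (\<bar>osc n (- pi/2) t\<bar> * sin (t / 2))"
        using In I[OF t] st by (intro mult_mono divide_right_mono) auto
      also have "\<dots> = \<bar>- I t / pi * (osc n (- pi/2) t * sin (t / 2))\<bar>"
      proof -
        have "\<bar>- I t / pi\<bar> = - I t / pi" using In by (rule abs_of_nonneg)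
        then show ?thesis unfolding abs_mult using st by simp
      qed
      finally show "T / (8 * pi) * \<bar>osc n (- pi/2) t\<bar> \<le> \<bar>(v (Suc n) t * ?L 0 - v n t * ?L 1) / 2\<bar>" unfolding eq .
    qed
    moreover have "(m * (5/2 - 2) / 16) powr (1 / p) * ((T / (8 * pi)) / (4 * sqrt Mh)) = K * T"
      by (simp add: K_def)
    moreover have "(\<Gamma> * T) powr (1 / p) = \<Gamma> powr (1 / p) * T powr (1 / p)" by (rule powr_mult)
    ultimately show "K * T \<le> max C 0 * \<Gamma> powr (1 / p) * T powr (1 / p)" by (simp only: mult.assoc)
  qed
qed

end

theorem theorem13:
  fixes \<alpha> \<beta> p :: real and k :: nat and a M :: "nat \<Rightarrow> real"
    and P :: "nat \<Rightarrow> real poly"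
  assumes "\<alpha> > -1/2" and "\<alpha> \<ge> \<beta>" and "\<beta> > -1"
    and "\<forall>i<k. a i \<in> {-1..1}" and "inj_on a {..<k}" and "\<forall>i<k. M i > 0"
    and "orthonormal_polys (jacobi_mass_measure \<alpha> \<beta> k a M) P"
    and "p = 4 * (\<alpha> + 1) / (2 * \<alpha> + 1) \<or> p = 4 * (\<alpha> + 1) / (2 * \<alpha> + 3)"
  shows "\<not> (\<exists>C::real. \<forall>n f. in_Lp (jacobi_mass_measure \<alpha> \<beta> k a M) p f \<longrightarrow>
            weak_Lp_norm (jacobi_mass_measure \<alpha> \<beta> k a M) p
               (partial_sum_op (jacobi_mass_measure \<alpha> \<beta> k a M) P n f)
            \<le> ennreal C * Lp_norm (jacobi_mass_measure \<alpha> \<beta> k a M) p f)"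
proof (rule notI, elim exE)
  fix C
  assume C: "\<forall>n f. in_Lp (jacobi_mass_measure \<alpha> \<beta> k a M) p f \<longrightarrow>
            weak_Lp_norm (jacobi_mass_measure \<alpha> \<beta> k a M) p
               (partial_sum_op (jacobi_mass_measure \<alpha> \<beta> k a M) P n f)
            \<le> ennreal C * Lp_norm (jacobi_mass_measure \<alpha> \<beta> k a M) p f"
  interpret jacobi_mass_system \<alpha> \<beta> k a M P
    using assms(1,4,7) by unfold_locales auto
  from assms(8) show False
    using not_weak_type_upper[OF _ C[rule_format]] not_weak_type_lower[OF _ C[rule_format]] by blast
qed

end
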